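(* Let $(M^4,g)$ be a 4-dimensional orientable Riemannian manifold equipped with a minimal and conformal foliation $\mathcal{F}$ of codimension 2. Let $\mathcal{V}$ be the distribution tangent to $\mathcal{F}$, let $\mathcal{H}$ be its orthogonal complement (the horizontal distribution), and let $J_1$ and $J_2$ be the two almost Hermitian structures (unique up to sign) adapted to the orthogonal decomposition $TM=\mathcal{V}\oplus\mathcal{H}$. Then $J_1$ and $J_2$ are both cosymplectic if and only if $\mathcal{F}$ is Riemannian and the horizontal distribution $\mathcal{H}$ is integrable.
   Context: Let $(M,g)$ be a Riemannian manifold with Levi-Civita connection $\nabla$, let $\mathcal{V}$ be an involutive distribution on $M$, $\mathcal{F}$ the foliation tangent to $\mathcal{V}$, and $\mathcal{H}$ the orthogonal complement of $\mathcal{V}$. The symbols $\mathcal{V}$ and $\mathcal{H}$ also denote the orthogonal projections of $TM$ onto these subbundles. The second fundamental forms are $$B^{\mathcal{V}}(U,V)=\tfrac12\mathcal{H}(\nabla_UV+\nabla_VU)\quad (U,V\in\mathcal{V}),\qquad B^{\mathcal{H}}(X,Y)=\tfrac12\mathcal{V}(\nabla_XY+\nabla_YX)\quad (X,Y\in\mathcal{H}).$$ - $\mathcal{F}$ is conformal if there is a vector field $V\in\mathcal{V}$ such that $B^{\mathcal{H}}=g\otimes V$, i.e. $B^{\mathcal{H}}(X,Y)=g(X,Y)V$ for all $X,Y\in\mathcal{H}$. It is Riemannian if this holds with $V=0$, i.e. $B^{\mathcal{H}}=0$. - $\mathcal{F}$ is minimal if $\operatorname{trace} B^{\mathcal{V}}=0$.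 - $\mathcal{H}$ is integrable if $[X,Y]\in\mathcal{H}$ for all local sections $X,Y$ of $\mathcal{H}$. Adapted almost Hermitian structures: fix an orientation of $M^4$. For $\mathcal{F}$ of codimension 2, there are, up to sign, exactly two almost Hermitian structures $J_1,J_2$ adapted to the decomposition $TM=\mathcal{V}\oplus\mathcal{H}$. For a positively oriented local orthonormal frame $\{X,Y,Z,W\}$ of $TM$ with $X,Y\in\mathcal{H}$ and $Z,W\in\mathcal{V}$ they are given by $$J_1X=Y,\ J_1Y=-X,\ J_1Z=W,\ J_1W=-Z,$$ $$J_2X=Y,\ J_2Y=-X,\ J_2Z=-W,\ J_2W=Z.$$ Changing to another such frame changes each $J_k$ at most by a sign, which does not affect the property of being cosymplectic; the structures are understood up to (local) sign. An almost Hermitian structure $J$ on $(M^m,g)$ is cosymplectic if it is divergence-free, i.e. $$\delta J=\operatorname{div}J=\sum_{k=1}^m(\nabla_{X_k}J)(X_k)=0$$ for any local orthonormal frame $\{X_1,\dots,X_m\}$ of $TM$. *)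

theory Defs
  imports "HOL-Analysis.Analysis" "HOL-Library.Function_Algebras"
begin

text \<open>Pointwise scalar multiplication makes the linear-algebra notions of the library
  (\<^const>\<open>subspace\<close>, \<^const>\<open>span\<close>, \<^const>\<open>dim\<close>) available for tangent vectors,
  which below are functionals on real functions.\<close>

instantiation "fun" :: (type, real_vector) real_vector
begin

definition scaleR_fun :: "real \<Rightarrow> ('a \<Rightarrow> 'b) \<Rightarrow> 'a \<Rightarrow> 'b"
  where "scaleR_fun r f = (\<lambda>x. r *\<^sub>R f x)"

instance
  by standard (simp_all add: scaleR_fun_def fun_eq_iff scaleR_add_left scaleR_add_right)

end


section \<open>Smooth 4-manifolds\<close>

text \<open>Both predicates are meant for open sets only: the derivatives are not taken within the set.\<close>

fun Ck_on :: "nat \<Rightarrow> 'a::euclidean_space set \<Rightarrow> ('a \<Rightarrow> 'b::real_normed_vector) \<Rightarrow> bool" where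
  "Ck_on 0 S f \<longleftrightarrow> continuous_on S f"
| "Ck_on (Suc k) S f \<longleftrightarrow>
     (\<forall>x\<in>S. f differentiable (at x)) \<and>
     (\<forall>v. Ck_on k S (\<lambda>x. frechet_derivative f (at x) v))"

definition smooth_on :: "'a::euclidean_space set \<Rightarrow> ('a \<Rightarrow> 'b::real_normed_vector) \<Rightarrow> bool"
  where "smooth_on S f \<longleftrightarrow> (\<forall>k. Ck_on k S f)"

text \<open>A chart consists of its domain and the coordinate map; the values of the coordinate map
  outside the domain are irrelevant. The manifold is the whole type \<^typ>\<open>'a\<close>, which carries a
  Hausdorff and second countable topology.\<close>

type_synonym 'a chart = "'a set \<times> ('a \<Rightarrow> real^4)"

definition smooth_atlas :: "'a::{t2_space,second_countable_topology} chart set \<Rightarrow> bool" where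
  "smooth_atlas A \<longleftrightarrow>
     (\<Union>(D, \<phi>)\<in>A. D) = UNIV \<and>
     (\<forall>(D, \<phi>)\<in>A. open D \<and> open (\<phi> ` D) \<and> homeomorphism D (\<phi> ` D) \<phi> (inv_into D \<phi>)) \<and>
     (\<forall>(D, \<phi>)\<in>A. \<forall>(E, \<psi>)\<in>A. smooth_on (\<phi> ` (D \<inter> E)) (\<psi> \<circ> inv_into D \<phi>))"

text \<open>An orientation is given by an atlas of charts compatible with \<^term>\<open>A\<close> whose coordinate
  changes have positive Jacobian determinant.\<close>

definition orientation ::
  "'a::{t2_space,second_countable_topology} chart set \<Rightarrow> 'a chart set \<Rightarrow> bool" where
  "orientation A Or \<longleftrightarrow>
     smooth_atlas (A \<union> Or) \<and>
     (\<Union>(D, \<phi>)\<in>Or. D) = UNIV \<and>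
     (\<forall>(D, \<phi>)\<in>Or. \<forall>(E, \<psi>)\<in>Or. \<forall>p\<in>D \<inter> E.
        det (matrix (frechet_derivative (\<psi> \<circ> inv_into D \<phi>) (at (\<phi> p)))) > 0)"

definition smooth_fun ::
  "'a::{t2_space,second_countable_topology} chart set \<Rightarrow> 'a set \<Rightarrow> ('a \<Rightarrow> real) \<Rightarrow> bool" where
  "smooth_fun A U f \<longleftrightarrow> (\<forall>(D, \<phi>)\<in>A. smooth_on (\<phi> ` (D \<inter> U)) (f \<circ> inv_into D \<phi>))"

definition smooth_near ::
  "'a::{t2_space,second_countable_topology} chart set \<Rightarrow> 'a \<Rightarrow> ('a \<Rightarrow> real) \<Rightarrow> bool" where
  "smooth_near A p f \<longleftrightarrow> (\<exists>U. open U \<and> p \<in> U \<and> smooth_fun A U f)"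


section \<open>Tangent vectors and vector fields\<close>

text \<open>Tangent vectors at \<^term>\<open>p\<close> are the derivations of the functions that are smooth near
  \<^term>\<open>p\<close>. The value on all other functions is fixed to be 0, so that equality of tangent vectors
  is equality of functionals. That a derivation depends only on the germ of its argument
  is a consequence of the product rule, since the indicator function of an open neighbourhood of
  \<^term>\<open>p\<close> is smooth near \<^term>\<open>p\<close>.\<close>

type_synonym 'a tangent_vector = "('a \<Rightarrow> real) \<Rightarrow> real"

definition tangent_space ::
  "'a::{t2_space,second_countable_topology} chart set \<Rightarrow> 'a \<Rightarrow> 'a tangent_vector set" where
  "tangent_space A p = {v.
     (\<forall>f h a b. smooth_near A p f \<longrightarrow> smooth_near A p h \<longrightarrow>
        v (\<lambda>q. a * f q + b * h q) = a * v f + b * v h) \<and>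
     (\<forall>f h. smooth_near A p f \<longrightarrow> smooth_near A p h \<longrightarrow>
        v (\<lambda>q. f q * h q) = f p * v h + h p * v f) \<and>
     (\<forall>f. \<not> smooth_near A p f \<longrightarrow> v f = 0)}"

type_synonym 'a vector_field = "'a \<Rightarrow> 'a tangent_vector"

text \<open>The smooth vector fields on an open set \<^term>\<open>U\<close>; values outside \<^term>\<open>U\<close> are arbitrary, so
  restriction to a smaller open set is the identity.\<close>

definition vector_fields ::
  "'a::{t2_space,second_countable_topology} chart set \<Rightarrow> 'a set \<Rightarrow> 'a vector_field set" where
  "vector_fields A U = {X.
     (\<forall>p\<in>U. X p \<in> tangent_space A p) \<and>
     (\<forall>S f. open S \<longrightarrow> S \<subseteq> U \<longrightarrow> smooth_fun A S f \<longrightarrow> smooth_fun A S (\<lambda>p. X p f))}"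

definition lie_bracket ::
  "'a::{t2_space,second_countable_topology} chart set \<Rightarrow>
     'a vector_field \<Rightarrow> 'a vector_field \<Rightarrow> 'a vector_field" where
  "lie_bracket A X Y p f =
     (if smooth_near A p f then X p (\<lambda>q. Y q f) - Y p (\<lambda>q. X q f) else 0)"


section \<open>Riemannian metrics and the Levi-Civita connection\<close>

type_synonym 'a metric_tensor = "'a \<Rightarrow> 'a tangent_vector \<Rightarrow> 'a tangent_vector \<Rightarrow> real"

definition riemannian_metric ::
  "'a::{t2_space,second_countable_topology} chart set \<Rightarrow> 'a metric_tensor \<Rightarrow> bool" where
  "riemannian_metric A g \<longleftrightarrow>
     (\<forall>p. \<forall>u\<in>tangent_space A p. \<forall>v\<in>tangent_space A p. \<forall>w\<in>tangent_space A p. \<forall>a b.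
        g p (a *\<^sub>R u + b *\<^sub>R v) w = a * g p u w + b * g p v w) \<and>
     (\<forall>p. \<forall>u\<in>tangent_space A p. \<forall>v\<in>tangent_space A p. g p u v = g p v u) \<and>
     (\<forall>p. \<forall>v\<in>tangent_space A p. v \<noteq> 0 \<longrightarrow> g p v v > 0) \<and>
     (\<forall>U. \<forall>X\<in>vector_fields A U. \<forall>Y\<in>vector_fields A U.
        open U \<longrightarrow> smooth_fun A U (\<lambda>p. g p (X p) (Y p)))"

text \<open>A connection acts on vector fields that are defined on an arbitrary open set, compatibly
  with restriction; \<^term>\<open>nabla X Y\<close> is the covariant derivative of \<^term>\<open>Y\<close> along \<^term>\<open>X\<close>.\<close>

type_synonym 'a connection = "'a vector_field \<Rightarrow> 'a vector_field \<Rightarrow> 'a vector_field"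

definition affine_connection ::
  "'a::{t2_space,second_countable_topology} chart set \<Rightarrow> 'a connection \<Rightarrow> bool" where
  "affine_connection A nabla \<longleftrightarrow>
     (\<forall>U. open U \<longrightarrow>
       (\<forall>X\<in>vector_fields A U. \<forall>Y\<in>vector_fields A U.
          nabla X Y \<in> vector_fields A U \<and>
          (\<forall>X'\<in>vector_fields A U. \<forall>Y'\<in>vector_fields A U.
             (\<forall>p\<in>U. X' p = X p \<and> Y' p = Y p) \<longrightarrow> (\<forall>p\<in>U. nabla X' Y' p = nabla X Y p)) \<and>
          (\<forall>Z\<in>vector_fields A U. \<forall>p\<in>U.
             nabla (\<lambda>q. X q + Y q) Z p = nabla X Z p + nabla Y Z p \<and>
             nabla Z (\<lambda>q. X q + Y q) p = nabla Z X p + nabla Z Y p) \<and>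
          (\<forall>f. smooth_fun A U f \<longrightarrow> (\<forall>p\<in>U.
             nabla (\<lambda>q. f q *\<^sub>R X q) Y p = f p *\<^sub>R nabla X Y p \<and>
             nabla X (\<lambda>q. f q *\<^sub>R Y q) p = X p f *\<^sub>R Y p + f p *\<^sub>R nabla X Y p))))"

definition levi_civita ::
  "'a::{t2_space,second_countable_topology} chart set \<Rightarrow> 'a metric_tensor \<Rightarrow>
     'a connection \<Rightarrow> bool" where
  "levi_civita A g nabla \<longleftrightarrow>
     affine_connection A nabla \<and>
     (\<forall>U. open U \<longrightarrow>
       (\<forall>X\<in>vector_fields A U. \<forall>Y\<in>vector_fields A U. \<forall>p\<in>U.
          nabla X Y p - nabla Y X p = lie_bracket A X Y p) \<and>
       (\<forall>X\<in>vector_fields A U. \<forall>Y\<in>vector_fields A U. \<forall>Z\<in>vector_fields A U. \<forall>p\<in>U.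
          X p (\<lambda>q. g q (Y q) (Z q)) = g p (nabla X Y p) (Z p) + g p (Y p) (nabla X Z p)))"


section \<open>Distributions and foliations\<close>

type_synonym 'a distribution = "'a \<Rightarrow> 'a tangent_vector set"

definition sections ::
  "'a::{t2_space,second_countable_topology} chart set \<Rightarrow> 'a set \<Rightarrow> 'a distribution \<Rightarrow>
     'a vector_field set" where
  "sections A U D = {X \<in> vector_fields A U. \<forall>p\<in>U. X p \<in> D p}"

definition smooth_distribution ::
  "'a::{t2_space,second_countable_topology} chart set \<Rightarrow> nat \<Rightarrow> 'a distribution \<Rightarrow> bool" where
  "smooth_distribution A k D \<longleftrightarrow>
     (\<forall>p. \<exists>U E. open U \<and> p \<in> U \<and> (\<forall>i<k. E i \<in> vector_fields A U) \<and>
        (\<forall>q\<in>U. D q = span ((\<lambda>i. E i q) ` {..<k}) \<and> dim (D q) = k))"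

text \<open>A foliation is represented by its tangent distribution, which is involutive. For the
  orthogonal complement the same condition is usually called integrability.\<close>

definition involutive ::
  "'a::{t2_space,second_countable_topology} chart set \<Rightarrow> 'a distribution \<Rightarrow> bool" where
  "involutive A D \<longleftrightarrow>
     (\<forall>U. open U \<longrightarrow> (\<forall>X\<in>sections A U D. \<forall>Y\<in>sections A U D. \<forall>p\<in>U. lie_bracket A X Y p \<in> D p))"

definition orthogonal_complement ::
  "'a::{t2_space,second_countable_topology} chart set \<Rightarrow> 'a metric_tensor \<Rightarrow> 'a distribution \<Rightarrow>
     'a distribution" where
  "orthogonal_complement A g D p = {w \<in> tangent_space A p. \<forall>v\<in>D p. g p w v = 0}"

definition orthogonal_projection ::
  "'a::{t2_space,second_countable_topology} chart set \<Rightarrow> 'a metric_tensor \<Rightarrow> 'a distribution \<Rightarrow>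
     'a \<Rightarrow> 'a tangent_vector \<Rightarrow> 'a tangent_vector" where
  "orthogonal_projection A g D p u =
     (THE v. v \<in> D p \<and> u - v \<in> orthogonal_complement A g D p)"

text \<open>The second fundamental form of a distribution \<open>D\<close> with orthogonal complement \<^term>\<open>N\<close>,
  evaluated on local sections \<^term>\<open>X\<close>, \<^term>\<open>Y\<close> of \<open>D\<close>. Thus \<open>N = \<H>\<close> gives the form of the
  vertical distribution and \<open>N = \<V>\<close> that of the horizontal one.\<close>

definition second_fundamental_form ::
  "'a::{t2_space,second_countable_topology} chart set \<Rightarrow> 'a metric_tensor \<Rightarrow> 'a connection \<Rightarrow>
     'a distribution \<Rightarrow> 'a vector_field \<Rightarrow> 'a vector_field \<Rightarrow> 'a vector_field" where
  "second_fundamental_form A g nabla N X Y p =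
     (1/2) *\<^sub>R orthogonal_projection A g N p (nabla X Y p + nabla Y X p)"

definition orthonormal_frame ::
  "'a::{t2_space,second_countable_topology} chart set \<Rightarrow> 'a metric_tensor \<Rightarrow> 'a set \<Rightarrow>
     'a distribution \<Rightarrow> nat \<Rightarrow> (nat \<Rightarrow> 'a vector_field) \<Rightarrow> bool" where
  "orthonormal_frame A g U D k E \<longleftrightarrow>
     (\<forall>i<k. E i \<in> sections A U D) \<and>
     (\<forall>p\<in>U. \<forall>i<k. \<forall>j<k. g p (E i p) (E j p) = (if i = j then 1 else 0)) \<and>
     (\<forall>p\<in>U. D p = span ((\<lambda>i. E i p) ` {..<k}))"

text \<open>For a foliation with 2-dimensional leaves the trace of the second fundamental form is a sum
  over local orthonormal frames of two sections.\<close>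

definition minimal_foliation ::
  "'a::{t2_space,second_countable_topology} chart set \<Rightarrow> 'a metric_tensor \<Rightarrow> 'a connection \<Rightarrow>
     'a distribution \<Rightarrow> bool" where
  "minimal_foliation A g nabla V \<longleftrightarrow>
     (\<forall>U E. open U \<longrightarrow> orthonormal_frame A g U V 2 E \<longrightarrow>
       (\<forall>p\<in>U. (\<Sum>i<2. second_fundamental_form A g nabla (orthogonal_complement A g V)
                       (E i) (E i) p) = 0))"

definition conformal_foliation_with ::
  "'a::{t2_space,second_countable_topology} chart set \<Rightarrow> 'a metric_tensor \<Rightarrow> 'a connection \<Rightarrow>
     'a distribution \<Rightarrow> 'a vector_field \<Rightarrow> bool" where
  "conformal_foliation_with A g nabla V \<xi> \<longleftrightarrow>
     (\<forall>U. open U \<longrightarrow>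
       (\<forall>X\<in>sections A U (orthogonal_complement A g V).
        \<forall>Y\<in>sections A U (orthogonal_complement A g V). \<forall>p\<in>U.
          second_fundamental_form A g nabla V X Y p = g p (X p) (Y p) *\<^sub>R \<xi> p))"

definition conformal_foliation ::
  "'a::{t2_space,second_countable_topology} chart set \<Rightarrow> 'a metric_tensor \<Rightarrow> 'a connection \<Rightarrow>
     'a distribution \<Rightarrow> bool" where
  "conformal_foliation A g nabla V \<longleftrightarrow>
     (\<exists>\<xi>\<in>sections A UNIV V. conformal_foliation_with A g nabla V \<xi>)"

definition riemannian_foliation ::
  "'a::{t2_space,second_countable_topology} chart set \<Rightarrow> 'a metric_tensor \<Rightarrow> 'a connection \<Rightarrow>
     'a distribution \<Rightarrow> bool" where
  "riemannian_foliation A g nabla V \<longleftrightarrow> conformal_foliation_with A g nabla V (\<lambda>p. 0)"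


section \<open>Adapted almost Hermitian structures\<close>

type_synonym 'a endomorphism_field = "'a \<Rightarrow> 'a tangent_vector \<Rightarrow> 'a tangent_vector"

definition almost_hermitian ::
  "'a::{t2_space,second_countable_topology} chart set \<Rightarrow> 'a metric_tensor \<Rightarrow> 'a set \<Rightarrow>
     'a endomorphism_field \<Rightarrow> bool" where
  "almost_hermitian A g U J \<longleftrightarrow>
     (\<forall>p\<in>U. \<forall>v\<in>tangent_space A p. J p v \<in> tangent_space A p \<and> J p (J p v) = - v) \<and>
     (\<forall>p\<in>U. \<forall>v\<in>tangent_space A p. \<forall>w\<in>tangent_space A p.
        (\<forall>a b. J p (a *\<^sub>R v + b *\<^sub>R w) = a *\<^sub>R J p v + b *\<^sub>R J p w) \<and>
        g p (J p v) (J p w) = g p v w) \<and>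
     (\<forall>S. open S \<longrightarrow> S \<subseteq> U \<longrightarrow>
        (\<forall>X\<in>vector_fields A S. (\<lambda>p. J p (X p)) \<in> vector_fields A S))"

definition frame_of ::
  "'a vector_field \<Rightarrow> 'a vector_field \<Rightarrow> 'a vector_field \<Rightarrow> 'a vector_field \<Rightarrow>
     nat \<Rightarrow> 'a vector_field" where
  "frame_of X Y Z W = (\<lambda>i. [X, Y, Z, W] ! i)"

definition coordinates_in :: "('a \<Rightarrow> real^4) \<Rightarrow> 'a tangent_vector \<Rightarrow> real^4" where
  "coordinates_in \<phi> v = (\<chi> i. v (\<lambda>q. \<phi> q $ i))"

definition positively_oriented ::
  "'a chart set \<Rightarrow> 'a \<Rightarrow> 'a tangent_vector \<Rightarrow> 'a tangent_vector \<Rightarrow> 'a tangent_vector \<Rightarrow>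
     'a tangent_vector \<Rightarrow> bool" where
  "positively_oriented Or p x y z w \<longleftrightarrow>
     (\<forall>(D, \<phi>)\<in>Or. p \<in> D \<longrightarrow>
        det (vector [coordinates_in \<phi> x, coordinates_in \<phi> y,
                     coordinates_in \<phi> z, coordinates_in \<phi> w] :: real^4^4) > 0)"

definition adapted_frame ::
  "'a::{t2_space,second_countable_topology} chart set \<Rightarrow> 'a chart set \<Rightarrow> 'a metric_tensor \<Rightarrow>
     'a distribution \<Rightarrow> 'a set \<Rightarrow> 'a vector_field \<Rightarrow> 'a vector_field \<Rightarrow> 'a vector_field \<Rightarrow>
     'a vector_field \<Rightarrow> bool" where
  "adapted_frame A Or g V U X Y Z W \<longleftrightarrow>
     orthonormal_frame A g U (tangent_space A) 4 (frame_of X Y Z W) \<and>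
     X \<in> sections A U (orthogonal_complement A g V) \<and>
     Y \<in> sections A U (orthogonal_complement A g V) \<and>
     Z \<in> sections A U V \<and> W \<in> sections A U V \<and>
     (\<forall>p\<in>U. positively_oriented Or p (X p) (Y p) (Z p) (W p))"

text \<open>The structures adapted to the splitting need not exist on the whole manifold, only up to a
  local sign. Hence they are treated as structures on open sets \<^term>\<open>U\<close>: the following
  predicates hold for exactly those \<^term>\<open>J\<close> that near each point of \<^term>\<open>U\<close> are one of the two
  opposite representatives of the first (respectively second) structure.\<close>

definition adapted_structure_1 ::
  "'a::{t2_space,second_countable_topology} chart set \<Rightarrow> 'a chart set \<Rightarrow> 'a metric_tensor \<Rightarrow>
     'a distribution \<Rightarrow> 'a set \<Rightarrow> 'a endomorphism_field \<Rightarrow> bool" where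
  "adapted_structure_1 A Or g V U J \<longleftrightarrow>
     almost_hermitian A g U J \<and>
     (\<forall>p\<in>U. \<exists>S X Y Z W. open S \<and> p \<in> S \<and> S \<subseteq> U \<and> adapted_frame A Or g V S X Y Z W \<and>
        (\<forall>q\<in>S. J q (X q) = Y q \<and> J q (Y q) = - X q \<and> J q (Z q) = W q \<and> J q (W q) = - Z q))"

definition adapted_structure_2 ::
  "'a::{t2_space,second_countable_topology} chart set \<Rightarrow> 'a chart set \<Rightarrow> 'a metric_tensor \<Rightarrow>
     'a distribution \<Rightarrow> 'a set \<Rightarrow> 'a endomorphism_field \<Rightarrow> bool" where
  "adapted_structure_2 A Or g V U J \<longleftrightarrow>
     almost_hermitian A g U J \<and>
     (\<forall>p\<in>U. \<exists>S X Y Z W. open S \<and> p \<in> S \<and> S \<subseteq> U \<and> adapted_frame A Or g V S X Y Z W \<and>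
        (\<forall>q\<in>S. J q (X q) = Y q \<and> J q (Y q) = - X q \<and> J q (Z q) = - W q \<and> J q (W q) = Z q))"

text \<open>The covariant derivative of the endomorphism field \<^term>\<open>J\<close> along \<^term>\<open>X\<close>, applied to
  \<^term>\<open>Y\<close>.\<close>

definition covariant_derivative_endo ::
  "'a connection \<Rightarrow> 'a endomorphism_field \<Rightarrow> 'a vector_field \<Rightarrow> 'a vector_field \<Rightarrow>
     'a vector_field" where
  "covariant_derivative_endo nabla J X Y p = nabla X (\<lambda>q. J q (Y q)) p - J p (nabla X Y p)"

definition cosymplectic ::
  "'a::{t2_space,second_countable_topology} chart set \<Rightarrow> 'a metric_tensor \<Rightarrow> 'a connection \<Rightarrow>
     'a set \<Rightarrow> 'a endomorphism_field \<Rightarrow> bool" where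
  "cosymplectic A g nabla U J \<longleftrightarrow>
     (\<forall>S E. open S \<longrightarrow> S \<subseteq> U \<longrightarrow> orthonormal_frame A g S (tangent_space A) 4 E \<longrightarrow>
       (\<forall>p\<in>S. (\<Sum>k<4. covariant_derivative_endo nabla J (E k) (E k) p) = 0))"

end

theory Submission
  imports Defs
begin

text \<open>
Let \<open>X\<close>, \<open>Y\<close> be horizontal and \<open>Z\<close>, \<open>W\<close> vertical fields forming a positively oriented
orthonormal frame, and let \<open>J\<close> be the adapted structure with \<open>J X = Y\<close> and \<open>J Z = \<epsilon> W\<close>, where
\<open>\<epsilon> = 1\<close> for the first and \<open>\<epsilon> = -1\<close> for the second structure. Since
\<open>(\<nabla>\<^sub>K J) K = \<nabla>\<^sub>K (J K) - J (\<nabla>\<^sub>K K)\<close> and the connection has no torsion,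

  \<open>div J = [X, Y] + \<epsilon> [Z, W] - J (\<nabla>\<^sub>X X + \<nabla>\<^sub>Y Y + \<nabla>\<^sub>Z Z + \<nabla>\<^sub>W W)\<close>.

In a plane spanned by two orthonormal fields, skew-symmetry of \<open>\<nabla>\<close> with respect to the metric
makes the component of \<open>[X, Y]\<close> in the plane equal to that of \<open>J (\<nabla>\<^sub>X X + \<nabla>\<^sub>Y Y)\<close>, and likewise
for \<open>Z\<close> and \<open>W\<close>. So in the horizontal part of the divergence these terms cancel; the remaining
ones vanish, as \<open>[Z, W]\<close> is vertical by involutivity and \<open>\<nabla>\<^sub>Z Z + \<nabla>\<^sub>W W\<close> is vertical by
minimality. In the vertical part, conformality says that \<open>\<nabla>\<^sub>X X\<close> and \<open>\<nabla>\<^sub>Y Y\<close> both have vertical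
part \<open>\<xi>\<close>, and what is left is \<open>\<V> [X, Y] - 2 J \<xi>\<close> (\<open>divergence_in_adapted_frame\<close>). The two
structures are opposite on vertical vectors, so both divergences vanish if and only if
\<open>\<V> [X, Y] = 0\<close> and \<open>\<xi> = 0\<close>, that is, if and only if the horizontal distribution is integrable
and the foliation is Riemannian.

Two general facts connect this computation with the theorem. A cosymplectic structure is tested
on arbitrary orthonormal frames, so the divergence must be shown to be the trace of a tensor
(\<open>divergence_frame_independent\<close>). And in order to exploit that all adapted structures are
cosymplectic, one has to exhibit such structures near every point, hence adapted frames
(\<open>adapted_frame_exists\<close>). These arise by the Gram-Schmidt process from local generators of the
foliation, followed by coordinate fields. This uses that coordinate fields span the space of
derivations (\<open>tangent_in_coordinates\<close>), which rests on Hadamard's lemma and so on a calculus of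
iterated derivatives.
\<close>

section \<open>Calculus of iterated Frechet derivatives\<close>

lemma Ck_on_cong:
  assumes "open S" "\<And>x. x \<in> S \<Longrightarrow> f x = g x" "Ck_on k S f"
  shows "Ck_on k S g"
  using assms
proof (induction k arbitrary: f g)
  case 0
  then show ?case by (simp cong: continuous_on_cong)
next
  case (Suc k)
  have diff: "f differentiable at x" if "x \<in> S" for x
    using Suc.prems(3) that by simp
  have "frechet_derivative f (at x) = frechet_derivative g (at x)" if "x \<in> S" for x
    using frechet_derivative_transform_within_open[OF diff[OF that] Suc.prems(1) that Suc.prems(2)] .
  moreover have "g differentiable at x" if x: "x \<in> S" for x
  proof -
    obtain f' where "(f has_derivative f') (at x)"
      using diff[OF x] unfolding differentiable_def by blast
    then have "(g has_derivative f') (at x)"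
      by (rule has_derivative_transform_within_open[OF _ Suc.prems(1) x Suc.prems(2)])
    then show ?thesis by (rule differentiableI)
  qed
  moreover have "Ck_on k S (\<lambda>x. frechet_derivative f (at x) v)" for v
    using Suc.prems(3) by simp
  ultimately show ?case
    using Suc.IH[OF Suc.prems(1), of "\<lambda>x. frechet_derivative f (at x) v"
        "\<lambda>x. frechet_derivative g (at x) v" for v] by simp
qed

text \<open>A candidate \<open>f'\<close> for the derivative has to be correct on \<open>S\<close> only; outside \<open>S\<close> it may differ from
  the Frechet derivative.\<close>

lemma Ck_on_Suc_intro:
  assumes "\<And>x. x \<in> S \<Longrightarrow> (f has_derivative f' x) (at x)"
    and "\<And>v. Ck_on k S (\<lambda>x. f' x v)" and "open S"
  shows "Ck_on (Suc k) S f"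
proof -
  have "Ck_on k S (\<lambda>x. frechet_derivative f (at x) v)" for v
    by (rule Ck_on_cong[OF assms(3) _ assms(2)[of v]])
      (use assms(1) frechet_derivative_at in \<open>metis\<close>)
  then show ?thesis using assms(1) by (auto simp: differentiable_def)
qed

lemma Ck_on_derivative:
  assumes "Ck_on (Suc k) S f" "x \<in> S"
  shows "(f has_derivative frechet_derivative f (at x)) (at x)"
  using assms by (simp add: frechet_derivative_works)

lemma Ck_on_Suc_imp: "Ck_on (Suc k) S f \<Longrightarrow> Ck_on k S f"
proof (induction k arbitrary: f)
  case 0
  then show ?case
    by (auto intro!: continuous_at_imp_continuous_on differentiable_imp_continuous_within)
next
  case (Suc k)
  then show ?case by (metis Ck_on.simps(2))
qed

lemma Ck_on_continuous: "Ck_on k S f \<Longrightarrow> continuous_on S f"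
  by (induction k) (auto dest: Ck_on_Suc_imp simp del: Ck_on.simps(2))

lemma Ck_on_subset: "T \<subseteq> S \<Longrightarrow> Ck_on k S f \<Longrightarrow> Ck_on k T f"
  by (induction k arbitrary: f) (auto intro: continuous_on_subset)

lemma Ck_on_const: "open S \<Longrightarrow> Ck_on k S (\<lambda>x. c)"
  by (induction k arbitrary: c) (auto intro!: Ck_on_Suc_intro derivative_eq_intros)

lemma Ck_on_linear:
  assumes "bounded_linear L" "open S"
  shows "Ck_on k S f \<Longrightarrow> Ck_on k S (\<lambda>x. L (f x))"
proof (induction k arbitrary: f)
  case 0
  then show ?case using assms bounded_linear.continuous_on by (simp) blast
next
  case (Suc k)
  show ?case
    by (rule Ck_on_Suc_intro[OF bounded_linear.has_derivative[OF assms(1) Ck_on_derivative[OF Suc.prems]]])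
      (use Suc assms in auto)
qed

lemma Ck_on_add:
  assumes "open S"
  shows "Ck_on k S f \<Longrightarrow> Ck_on k S g \<Longrightarrow> Ck_on k S (\<lambda>x. f x + g x)"
proof (induction k arbitrary: f g)
  case 0
  then show ?case by (simp add: continuous_on_add)
next
  case (Suc k)
  show ?case
    by (rule Ck_on_Suc_intro[OF has_derivative_add[OF Ck_on_derivative[OF Suc.prems(1)]
          Ck_on_derivative[OF Suc.prems(2)]]]) (use Suc assms in auto)
qed

lemma Ck_on_sum:
  assumes "open S" "\<And>i. i \<in> I \<Longrightarrow> Ck_on k S (f i)"
  shows "Ck_on k S (\<lambda>x. \<Sum>i\<in>I. f i x)"
  using assms(2) by (induction I rule: infinite_finite_induct) (auto intro: Ck_on_const Ck_on_add assms(1))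

lemma Ck_on_scaleR:
  assumes "open S"
  shows "Ck_on k S a \<Longrightarrow> Ck_on k S f \<Longrightarrow> Ck_on k S (\<lambda>x. a x *\<^sub>R f x)"
proof (induction k arbitrary: a f)
  case 0
  then show ?case by (simp add: continuous_on_scaleR)
next
  case (Suc k)
  show ?case
    by (rule Ck_on_Suc_intro[OF has_derivative_scaleR[OF Ck_on_derivative[OF Suc.prems(1)]
          Ck_on_derivative[OF Suc.prems(2)]]])
      (use Suc.prems assms in \<open>auto intro!: Ck_on_add Suc.IH intro: Ck_on_Suc_imp simp del: Ck_on.simps
         simp: Ck_on.simps(2)[of k S a] Ck_on.simps(2)[of k S f]\<close>)
qed

text \<open>By the chain rule the derivative of a composition is a sum of products of derivatives of the
  two factors, so one order less is needed of each of them.\<close>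

lemma Ck_on_compose:
  fixes f :: "'b::euclidean_space \<Rightarrow> 'c::real_normed_vector" and h :: "'a::euclidean_space \<Rightarrow> 'b"
  assumes "open S" "open T" "h ` S \<subseteq> T"
  shows "Ck_on k T f \<Longrightarrow> Ck_on k S h \<Longrightarrow> Ck_on k S (f \<circ> h)"
proof (induction k arbitrary: f)
  case 0
  then show ?case
    using assms(3) continuous_on_compose continuous_on_subset by (metis Ck_on.simps(1))
next
  case (Suc k)
  let ?D = "\<lambda>x v. \<Sum>b\<in>Basis. (frechet_derivative h (at x) v \<bullet> b) *\<^sub>R ((\<lambda>y. frechet_derivative f (at y) b) \<circ> h) x"
  show ?case
  proof (rule Ck_on_Suc_intro[OF _ _ assms(1)])
    fix x assume x: "x \<in> S"
    have f: "(f has_derivative frechet_derivative f (at (h x))) (at (h x))"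
      using Ck_on_derivative[OF Suc.prems(1)] x assms(3) by blast
    have "((f \<circ> h) has_derivative frechet_derivative f (at (h x)) \<circ> frechet_derivative h (at x)) (at x)"
      by (rule diff_chain_at[OF Ck_on_derivative[OF Suc.prems(2) x] f])
    moreover have "frechet_derivative f (at (h x)) (frechet_derivative h (at x) v) = ?D x v" for v
    proof -
      have l: "linear (frechet_derivative f (at (h x)))"
        using f has_derivative_linear by blast
      have "frechet_derivative f (at (h x)) (frechet_derivative h (at x) v) =
        frechet_derivative f (at (h x)) (\<Sum>b\<in>Basis. (frechet_derivative h (at x) v \<bullet> b) *\<^sub>R b)"
        by (simp add: euclidean_representation)
      then show ?thesis by (simp add: linear_sum[OF l] linear_scale[OF l])
    qed
    ultimately show "((f \<circ> h) has_derivative ?D x) (at x)" by (simp add: o_def)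
  next
    fix v
    have "Ck_on k S (\<lambda>x. frechet_derivative h (at x) v \<bullet> b)" for b
      by (rule Ck_on_linear[OF bounded_linear_inner_left assms(1)]) (use Suc.prems in simp)
    moreover have "Ck_on k S ((\<lambda>y. frechet_derivative f (at y) b) \<circ> h)" for b
      by (rule Suc.IH) (use Suc.prems Ck_on_Suc_imp in auto)
    ultimately show "Ck_on k S (\<lambda>x. ?D x v)"
      by (intro Ck_on_sum Ck_on_scaleR assms(1))
  qed
qed

text \<open>Needed for the exponent \<open>-1/2\<close>, to normalise vector fields; the induction needs all exponents,
  because differentiation lowers them.\<close>

lemma Ck_on_powr: "Ck_on k {0<..} (\<lambda>x::real. x powr a)"
proof (induction k arbitrary: a)
  case 0
  then show ?case by (auto intro!: continuous_intros)
next
  case (Suc k)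
  show ?case
  proof (rule Ck_on_Suc_intro)
    fix x :: real assume "x \<in> {0<..}"
    then show "((\<lambda>x. x powr a) has_derivative (\<lambda>v. (a * v) *\<^sub>R x powr (a - 1))) (at x)"
      by (auto intro!: derivative_eq_intros simp: powr_diff)
  next
    fix v show "Ck_on k {0<..} (\<lambda>x::real. (a * v) *\<^sub>R x powr (a - 1))"
      by (intro Ck_on_scaleR Ck_on_const Suc.IH) auto
  qed auto
qed

text \<open>Averages along segments issuing from a fixed point. The weight \<open>t ^ m\<close> makes the statement
  stable under differentiation, which increases \<open>m\<close> by one.\<close>

lemma Ck_on_segment_average:
  fixes F :: "'a::euclidean_space \<Rightarrow> real"
  shows "Ck_on k (ball c r) F \<Longrightarrow>
    Ck_on k (ball c r) (\<lambda>x. integral {0..1} (\<lambda>t. t ^ m * F (c + t *\<^sub>R (x - c))))"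
proof (induction k arbitrary: F m)
  case 0
  have in_ball: "c + t *\<^sub>R (x - c) \<in> ball c r" if "x \<in> ball c r" "t \<in> {0..1}" for x t
    using that mult_left_le_one_le[of "norm (x - c)" t]
    by (auto simp: dist_norm norm_minus_commute)
  have "continuous_on (ball c r \<times> cbox 0 1) (\<lambda>(x, t). t ^ m * F (c + t *\<^sub>R (x - c)))"
    unfolding split_beta
    by (intro continuous_intros continuous_on_compose2[OF 0[unfolded Ck_on.simps]]) (use in_ball in auto)
  from integral_continuous_on_param[OF this] show ?case by simp
next
  case (Suc k)
  have in_ball: "c + t *\<^sub>R (x - c) \<in> ball c r" if "x \<in> ball c r" "t \<in> {0..1}" for x t
    using that mult_left_le_one_le[of "norm (x - c)" t]
    by (auto simp: dist_norm norm_minus_commute)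
  let ?F = "\<lambda>x t. t ^ m * F (c + t *\<^sub>R (x - c))"
  let ?DF = "\<lambda>y. frechet_derivative F (at y)"
  define D where "D x t = Blinfun (\<lambda>v. t ^ Suc m * ?DF (c + t *\<^sub>R (x - c)) v)" for x and t :: real
  have FD: "(F has_derivative ?DF y) (at y)" if "y \<in> ball c r" for y
    using Ck_on_derivative[OF Suc.prems that] .
  have D: "blinfun_apply (D x t) = (\<lambda>v. t ^ Suc m * ?DF (c + t *\<^sub>R (x - c)) v)"
    if "x \<in> ball c r" "t \<in> {0..1}" for x t
    unfolding D_def by (rule bounded_linear_Blinfun_apply)
      (use FD[OF in_ball[OF that]] bounded_linear_const_mult has_derivative_bounded_linear in blast)
  have cF: "continuous_on (ball c r) F"
    by (rule Ck_on_continuous[OF Suc.prems])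
  have cDF: "continuous_on (ball c r) (\<lambda>y. ?DF y v)" for v
    by (rule Ck_on_continuous[of k]) (use Suc.prems in simp)
  have der: "((\<lambda>x. ?F x t) has_derivative blinfun_apply (D x t)) (at x within ball c r)"
    if "x \<in> ball c r" "t \<in> cbox 0 1" for x t
  proof -
    have t: "t \<in> {0..1}" using that by simp
    have l: "linear (?DF (c + t *\<^sub>R (x - c)))"
      using FD[OF in_ball[OF that(1) t]] has_derivative_linear by blast
    have "((\<lambda>x. c + t *\<^sub>R (x - c)) has_derivative (\<lambda>v. t *\<^sub>R v)) (at x)"
      by (auto intro!: derivative_eq_intros)
    from diff_chain_at[OF this FD[OF in_ball[OF that(1) t]]]
    have "((\<lambda>x. F (c + t *\<^sub>R (x - c))) has_derivative (\<lambda>v. t * ?DF (c + t *\<^sub>R (x - c)) v)) (at x)"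
      by (simp add: o_def linear_scale[OF l])
    from has_derivative_mult_right[OF this, of "t ^ m"]
    show ?thesis unfolding D[OF that(1) t]
      by (auto intro: has_derivative_at_withinI simp: mult_ac)
  qed
  have cont: "continuous_on (ball c r \<times> cbox 0 1) (\<lambda>(x, t). D x t)"
    unfolding split_beta
  proof (rule continuous_on_blinfun_componentwise)
    fix i :: 'a
    have "continuous_on (ball c r \<times> cbox 0 1)
        (\<lambda>z. snd z ^ Suc m * ?DF (c + snd z *\<^sub>R (fst z - c)) i)"
      by (intro continuous_intros continuous_on_compose2[OF cDF]) (use in_ball in auto)
    then show "continuous_on (ball c r \<times> cbox 0 1) (\<lambda>z. blinfun_apply (D (fst z) (snd z)) i)"
      by (rule continuous_on_eq) (auto simp: D)
  qed
  have int: "?F x integrable_on cbox 0 1" if "x \<in> ball c r" for x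
    by (intro integrable_continuous continuous_intros continuous_on_compose2[OF cF]) (use in_ball that in auto)
  have intD: "D x integrable_on {0..1}" if "x \<in> ball c r" for x
  proof -
    have "continuous_on (cbox 0 1) (\<lambda>t. (\<lambda>(x, t). D x t) (x, t))"
      by (rule continuous_on_compose2[OF cont]) (use that in \<open>auto intro!: continuous_intros\<close>)
    from integrable_continuous[OF this] show ?thesis by simp
  qed
  show ?case
  proof (rule Ck_on_Suc_intro)
    fix x assume x: "x \<in> ball c r"
    have "((\<lambda>x. integral (cbox 0 1) (?F x)) has_derivative integral (cbox 0 1) (D x)) (at x within ball c r)"
      by (rule leibniz_rule[OF der int cont x]) auto
    moreover have "blinfun_apply (integral (cbox 0 1) (D x)) =
        (\<lambda>v. integral {0..1} (\<lambda>t. t ^ Suc m * ?DF (c + t *\<^sub>R (x - c)) v))"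
      unfolding box_real blinfun_apply_integral[OF intD[OF x]]
      by (rule ext, rule Henstock_Kurzweil_Integration.integral_cong) (simp add: D[OF x])
    ultimately show "((\<lambda>x. integral {0..1} (?F x)) has_derivative
        (\<lambda>v. integral {0..1} (\<lambda>t. t ^ Suc m * ?DF (c + t *\<^sub>R (x - c)) v))) (at x)"
      using x by (simp add: at_within_open[OF x])
  next
    fix v
    show "Ck_on k (ball c r) (\<lambda>x. integral {0..1} (\<lambda>t. t ^ Suc m * ?DF (c + t *\<^sub>R (x - c)) v))"
      by (rule Suc.IH) (use Suc.prems in auto)
  qed auto
qed

lemma smooth_onD: "smooth_on S f \<Longrightarrow> Ck_on k S f"
  by (simp add: smooth_on_def)

lemma smooth_on_derivative:
  "smooth_on S f \<Longrightarrow> x \<in> S \<Longrightarrow> (f has_derivative frechet_derivative f (at x)) (at x)"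
  using Ck_on_derivative smooth_onD by blast

lemma smooth_on_frechet: "smooth_on S f \<Longrightarrow> smooth_on S (\<lambda>x. frechet_derivative f (at x) v)"
  unfolding smooth_on_def by (metis Ck_on.simps(2))

lemma smooth_on_continuous: "smooth_on S f \<Longrightarrow> continuous_on S f"
  using smooth_onD[of S f 0] by simp

lemma smooth_on_cong:
  "open S \<Longrightarrow> (\<And>x. x \<in> S \<Longrightarrow> f x = g x) \<Longrightarrow> smooth_on S f \<Longrightarrow> smooth_on S g"
  unfolding smooth_on_def using Ck_on_cong by blast

lemma Ck_on_local:
  assumes "\<And>x. x \<in> S \<Longrightarrow> \<exists>T. open T \<and> x \<in> T \<and> Ck_on k T f"
  shows "Ck_on k S f"
  using assms
proof (induction k arbitrary: f)
  case 0
  then show ?case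
    by (metis Ck_on.simps(1) continuous_at_imp_continuous_on continuous_on_eq_continuous_at)
next
  case (Suc k)
  have "f differentiable at x" if "x \<in> S" for x
    using Suc.prems[OF that] by auto
  moreover have "Ck_on k S (\<lambda>x. frechet_derivative f (at x) v)" for v
    by (rule Suc.IH) (use Suc.prems in \<open>auto, metis\<close>)
  ultimately show ?case by simp
qed

lemma smooth_on_local:
  "(\<And>x. x \<in> S \<Longrightarrow> \<exists>T. open T \<and> x \<in> T \<and> smooth_on T f) \<Longrightarrow> smooth_on S f"
  unfolding smooth_on_def using Ck_on_local by metis

lemma smooth_on_subset: "T \<subseteq> S \<Longrightarrow> smooth_on S f \<Longrightarrow> smooth_on T f"
  unfolding smooth_on_def using Ck_on_subset by blast

lemma smooth_on_const: "open S \<Longrightarrow> smooth_on S (\<lambda>x. c)"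
  unfolding smooth_on_def using Ck_on_const by blast

lemma smooth_on_ident: "open S \<Longrightarrow> smooth_on S (\<lambda>x. x)"
proof -
  assume "open S"
  then have "Ck_on k S (\<lambda>x. x)" for k
    by (cases k) (auto simp del: Ck_on.simps(2) intro: Ck_on_Suc_intro[OF has_derivative_ident Ck_on_const])
  then show ?thesis by (simp add: smooth_on_def)
qed

lemma smooth_on_linear: "bounded_linear L \<Longrightarrow> open S \<Longrightarrow> smooth_on S f \<Longrightarrow> smooth_on S (\<lambda>x. L (f x))"
  unfolding smooth_on_def using Ck_on_linear by blast

lemma smooth_on_add: "open S \<Longrightarrow> smooth_on S f \<Longrightarrow> smooth_on S g \<Longrightarrow> smooth_on S (\<lambda>x. f x + g x)"
  unfolding smooth_on_def using Ck_on_add by blast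

lemma smooth_on_mult:
  fixes f g :: "'a::euclidean_space \<Rightarrow> real"
  shows "open S \<Longrightarrow> smooth_on S f \<Longrightarrow> smooth_on S g \<Longrightarrow> smooth_on S (\<lambda>x. f x * g x)"
  unfolding smooth_on_def using Ck_on_scaleR[of S _ f g] by simp

lemma smooth_on_compose:
  "open S \<Longrightarrow> open T \<Longrightarrow> h ` S \<subseteq> T \<Longrightarrow> smooth_on T f \<Longrightarrow> smooth_on S h \<Longrightarrow> smooth_on S (f \<circ> h)"
  unfolding smooth_on_def using Ck_on_compose by blast

text \<open>Hadamard's lemma: integrate the derivative of \<open>F\<close> along the segment from \<open>c\<close> to \<open>x\<close>.\<close>

lemma Hadamard_lemma:
  fixes F :: "real^'n \<Rightarrow> real"
  assumes F: "smooth_on (ball c r) F" and "0 < r"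
  obtains h where "\<And>i. smooth_on (ball c r) (h i)"
    and "\<And>x. x \<in> ball c r \<Longrightarrow> F x = F c + (\<Sum>i\<in>UNIV. (x $ i - c $ i) * h i x)"
    and "\<And>i. h i c = frechet_derivative F (at c) (axis i 1)"
proof
  let ?D = "\<lambda>y. frechet_derivative F (at y)"
  let ?h = "\<lambda>i x. integral {0..1} (\<lambda>t. ?D (c + t *\<^sub>R (x - c)) (axis i 1))"
  show "smooth_on (ball c r) (?h i)" for i
    using Ck_on_segment_average[of _ c r "\<lambda>y. ?D y (axis i 1)" 0] smooth_on_frechet[OF F]
    unfolding smooth_on_def by simp
  show "?h i c = ?D c (axis i 1)" for i by simp
  fix x assume x: "x \<in> ball c r"
  have in_ball: "c + t *\<^sub>R (x - c) \<in> ball c r" if "t \<in> {0..1}" for t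
    using x that mult_left_le_one_le[of "norm (x - c)" t]
    by (auto simp: dist_norm norm_minus_commute)
  have expand: "?D y v = (\<Sum>i\<in>UNIV. v $ i * ?D y (axis i 1))" if "y \<in> ball c r" for y v
  proof -
    have l: "linear (?D y)"
      using smooth_on_derivative[OF F that] has_derivative_linear by blast
    have "?D y v = ?D y (\<Sum>i\<in>UNIV. v $ i *\<^sub>R axis i 1)"
      using basis_expansion[of v] by (simp add: scalar_mult_eq_scaleR)
    then show ?thesis by (simp add: linear_sum[OF l] linear_scale[OF l])
  qed
  have "((\<lambda>t. ?D (c + t *\<^sub>R (x - c)) (x - c)) has_integral F (c + 1 *\<^sub>R (x - c)) - F (c + 0 *\<^sub>R (x - c))) {0..1}"
  proof (rule fundamental_theorem_of_calculus)
    fix t :: real assume t: "t \<in> {0..1}"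
    have l: "linear (?D (c + t *\<^sub>R (x - c)))"
      using smooth_on_derivative[OF F in_ball[OF t]] has_derivative_linear by blast
    have "((\<lambda>t. c + t *\<^sub>R (x - c)) has_derivative (\<lambda>s. s *\<^sub>R (x - c))) (at t)"
      by (auto intro!: derivative_eq_intros)
    from diff_chain_at[OF this smooth_on_derivative[OF F in_ball[OF t]]]
    have "((\<lambda>t. F (c + t *\<^sub>R (x - c))) has_derivative (\<lambda>s. s * ?D (c + t *\<^sub>R (x - c)) (x - c))) (at t)"
      by (simp add: o_def linear_scale[OF l])
    then show "((\<lambda>t. F (c + t *\<^sub>R (x - c))) has_vector_derivative ?D (c + t *\<^sub>R (x - c)) (x - c)) (at t within {0..1})"
      by (simp add: has_vector_derivative_def has_derivative_at_withinI)
  qed simp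
  then have "F x = F c + integral {0..1} (\<lambda>t. ?D (c + t *\<^sub>R (x - c)) (x - c))"
    by (simp add: integral_unique)
  also have "integral {0..1} (\<lambda>t. ?D (c + t *\<^sub>R (x - c)) (x - c)) =
      integral {0..1} (\<lambda>t. \<Sum>i\<in>UNIV. (x $ i - c $ i) * ?D (c + t *\<^sub>R (x - c)) (axis i 1))"
    by (rule Henstock_Kurzweil_Integration.integral_cong)
      (simp only: expand[OF in_ball, of _ "x - c"] vector_minus_component)
  also have "\<dots> = (\<Sum>i\<in>UNIV. (x $ i - c $ i) * ?h i x)"
  proof -
    have "(\<lambda>t. ?D (c + t *\<^sub>R (x - c)) (axis i 1)) integrable_on {0..1}" for i
      by (rule integrable_continuous_interval,
          intro continuous_on_compose2[OF smooth_on_continuous[OF smooth_on_frechet[OF F]]] continuous_intros)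
        (use in_ball in auto)
    then show ?thesis
      by (subst integral_sum) (auto intro: integrable_on_mult_right)
  qed
  finally show "F x = F c + (\<Sum>i\<in>UNIV. (x $ i - c $ i) * ?h i x)" .
qed

section \<open>Smooth functions on a manifold\<close>

text \<open>The charts of an orientation need not belong to the atlas, but coordinates in them are
  used to measure the sign of a frame. Hence charts are treated up to compatibility.\<close>

definition compatible_chart ::
  "'a::{t2_space,second_countable_topology} chart set \<Rightarrow> 'a set \<Rightarrow> ('a \<Rightarrow> real^4) \<Rightarrow> bool" where
  "compatible_chart A D \<phi> \<longleftrightarrow> smooth_atlas (insert (D, \<phi>) A)"

lemma compatible_chart_of_larger_atlas:
  assumes "smooth_atlas A" "smooth_atlas B" "A \<subseteq> B" "(D, \<phi>) \<in> B"
  shows "compatible_chart A D \<phi>"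
proof -
  have sub: "insert (D, \<phi>) A \<subseteq> B" using assms by blast
  have mono1: "\<forall>x\<in>insert (D, \<phi>) A. P x" if "\<forall>x\<in>B. P x" for P
    using sub that by blast
  have mono2: "\<forall>x\<in>insert (D, \<phi>) A. \<forall>y\<in>insert (D, \<phi>) A. Q x y" if "\<forall>x\<in>B. \<forall>y\<in>B. Q x y" for Q
    using sub that by blast
  have cover: "(\<Union>(D, \<phi>)\<in>insert (D, \<phi>) A. D) = UNIV"
    using assms(1) unfolding smooth_atlas_def by auto
  note B = assms(2)[unfolded smooth_atlas_def split_beta]
  show ?thesis
    unfolding compatible_chart_def smooth_atlas_def split_beta
    by (rule conjI[OF cover[unfolded split_beta] conjI[OF mono1 mono2]],
        rule B[THEN conjunct2, THEN conjunct1], rule B[THEN conjunct2, THEN conjunct2])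
qed

context
  fixes A :: "'a::{t2_space,second_countable_topology} chart set" and D \<phi>
  assumes c: "compatible_chart A D \<phi>"
begin

lemma chart_open: "open D" and chart_open_image: "open (\<phi> ` D)"
  and chart_homeomorphism: "homeomorphism D (\<phi> ` D) \<phi> (inv_into D \<phi>)"
  using c unfolding compatible_chart_def smooth_atlas_def by auto

lemma chart_inv: "q \<in> D \<Longrightarrow> inv_into D \<phi> (\<phi> q) = q"
  using chart_homeomorphism unfolding homeomorphism_def by auto

lemma chart_open_map:
  assumes "open U" shows "open (\<phi> ` (D \<inter> U))"
proof -
  have "\<phi> ` (D \<inter> U) = \<phi> ` D \<inter> inv_into D \<phi> -` U"
    using chart_inv by auto
  then show ?thesis
    using continuous_open_preimage[OF homeomorphism_cont2[OF chart_homeomorphism] chart_open_image assms]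
    by simp
qed

lemma chart_open_preimage:
  assumes "open T" shows "open (D \<inter> \<phi> -` T)"
  using continuous_open_preimage[OF homeomorphism_cont1[OF chart_homeomorphism] chart_open assms] .

lemma chart_transition:
  assumes "(E, \<psi>) \<in> A"
  shows "smooth_on (\<phi> ` (D \<inter> E)) (\<psi> \<circ> inv_into D \<phi>)"
    and "smooth_on (\<psi> ` (E \<inter> D)) (\<phi> \<circ> inv_into E \<psi>)"
  using c assms unfolding compatible_chart_def smooth_atlas_def by blast+

end

lemma compatible_chart_atlas: "smooth_atlas A \<Longrightarrow> (E, \<psi>) \<in> A \<Longrightarrow> compatible_chart A E \<psi>"
  unfolding compatible_chart_def by (simp add: insert_absorb)

locale smooth_manifold =
  fixes A :: "'a::{t2_space,second_countable_topology} chart set"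
  assumes atlas: "smooth_atlas A"
begin

lemma chart_at:
  obtains E \<psi> where "(E, \<psi>) \<in> A" "p \<in> E" "compatible_chart A E \<psi>"
proof -
  have "p \<in> (\<Union>(D, \<phi>)\<in>A. D)" using atlas unfolding smooth_atlas_def by simp
  then show ?thesis using that compatible_chart_atlas[OF atlas] by auto
qed

lemma smooth_funI:
  assumes "\<And>E \<psi>. (E, \<psi>) \<in> A \<Longrightarrow> compatible_chart A E \<psi> \<Longrightarrow>
    smooth_on (\<psi> ` (E \<inter> U)) (f \<circ> inv_into E \<psi>)"
  shows "smooth_fun A U f"
  using assms compatible_chart_atlas[OF atlas] unfolding smooth_fun_def by blast

lemma smooth_funD:
  "smooth_fun A U f \<Longrightarrow> (E, \<psi>) \<in> A \<Longrightarrow> smooth_on (\<psi> ` (E \<inter> U)) (f \<circ> inv_into E \<psi>)"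
  unfolding smooth_fun_def by blast

text \<open>A compatible chart is covered only piecewise by charts of the atlas, so smoothness has to be
  checked near each point, in a chart of the atlas around it.\<close>

lemma smooth_fun_in_chart:
  assumes c: "compatible_chart A D \<phi>" and U: "open U" and f: "smooth_fun A U f"
  shows "smooth_on (\<phi> ` (D \<inter> U)) (f \<circ> inv_into D \<phi>)"
proof (rule smooth_on_local)
  fix x assume "x \<in> \<phi> ` (D \<inter> U)"
  then obtain q where q: "q \<in> D" "q \<in> U" "x = \<phi> q" by blast
  obtain E \<psi> where E: "(E, \<psi>) \<in> A" "q \<in> E" and cE: "compatible_chart A E \<psi>"
    by (rule chart_at)
  let ?T = "\<phi> ` (D \<inter> (E \<inter> U))"
  have T: "open ?T" by (intro chart_open_map[OF c] open_Int chart_open[OF cE] U)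
  have "smooth_on ?T ((f \<circ> inv_into E \<psi>) \<circ> (\<psi> \<circ> inv_into D \<phi>))"
    by (rule smooth_on_compose[OF T chart_open_map[OF cE U] _ smooth_funD[OF f E(1)]
          smooth_on_subset[OF _ chart_transition(1)[OF c E(1)]]]) (auto simp: chart_inv[OF c])
  then have "smooth_on ?T (f \<circ> inv_into D \<phi>)"
    by (rule smooth_on_cong[OF T, rotated]) (auto simp: chart_inv[OF c] chart_inv[OF cE])
  then show "\<exists>T. open T \<and> x \<in> T \<and> smooth_on T (f \<circ> inv_into D \<phi>)"
    using T q E(2) by blast
qed

lemma smooth_fun_from_chart:
  assumes c: "compatible_chart A D \<phi>" and T: "open T" "T \<subseteq> \<phi> ` D" and h: "smooth_on T h"
  shows "smooth_fun A (D \<inter> \<phi> -` T) (h \<circ> \<phi>)"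
proof (rule smooth_funI)
  fix E \<psi> assume E: "(E, \<psi>) \<in> A" and cE: "compatible_chart A E \<psi>"
  let ?S = "\<psi> ` (E \<inter> (D \<inter> \<phi> -` T))"
  have S: "open ?S" by (intro chart_open_map[OF cE] chart_open_preimage[OF c] T)
  have "smooth_on ?S (h \<circ> (\<phi> \<circ> inv_into E \<psi>))"
    by (rule smooth_on_compose[OF S T(1) _ h smooth_on_subset[OF _ chart_transition(2)[OF c E]]])
      (auto simp: chart_inv[OF cE])
  then show "smooth_on ?S ((h \<circ> \<phi>) \<circ> inv_into E \<psi>)" by (simp add: o_assoc)
qed

lemma smooth_fun_coordinate:
  assumes c: "compatible_chart A D \<phi>"
  shows "smooth_fun A D (\<lambda>q. \<phi> q $ i)"
proof -
  have "smooth_on (\<phi> ` D) (\<lambda>x. x $ i)"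
    by (rule smooth_on_linear[OF bounded_linear_vec_nth _ smooth_on_ident]; rule chart_open_image[OF c])
  from smooth_fun_from_chart[OF c chart_open_image[OF c] subset_refl this]
  show ?thesis by (simp add: o_def inf.absorb1 image_subset_iff_subset_vimage[symmetric])
qed

lemma smooth_fun_subset: "V \<subseteq> U \<Longrightarrow> smooth_fun A U f \<Longrightarrow> smooth_fun A V f"
  by (rule smooth_funI, rule smooth_on_subset[OF _ smooth_funD]) auto

lemma smooth_fun_cong:
  assumes "open U" "\<And>q. q \<in> U \<Longrightarrow> f q = h q" "smooth_fun A U f"
  shows "smooth_fun A U h"
  by (rule smooth_funI, rule smooth_on_cong[OF chart_open_map[OF _ assms(1)] _ smooth_funD[OF assms(3)]])
    (auto simp: assms(2) chart_inv)

lemma smooth_fun_const: "open U \<Longrightarrow> smooth_fun A U (\<lambda>q. c)"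
  by (rule smooth_funI) (simp add: o_def smooth_on_const chart_open_map)

lemma smooth_fun_add:
  "open U \<Longrightarrow> smooth_fun A U f \<Longrightarrow> smooth_fun A U h \<Longrightarrow> smooth_fun A U (\<lambda>q. f q + h q)"
  by (rule smooth_funI)
    (use smooth_on_add[OF chart_open_map smooth_funD smooth_funD] in \<open>simp add: o_def\<close>)

lemma smooth_fun_mult:
  "open U \<Longrightarrow> smooth_fun A U f \<Longrightarrow> smooth_fun A U h \<Longrightarrow> smooth_fun A U (\<lambda>q. f q * h q)"
  by (rule smooth_funI)
    (use smooth_on_mult[OF chart_open_map smooth_funD smooth_funD] in \<open>simp add: o_def\<close>)

lemma smooth_fun_powr:
  assumes U: "open U" and f: "smooth_fun A U f" and pos: "\<And>q. q \<in> U \<Longrightarrow> f q > 0"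
  shows "smooth_fun A U (\<lambda>q. f q powr a)"
proof (rule smooth_funI)
  fix E \<psi> assume E: "(E, \<psi>) \<in> A" and cE: "compatible_chart A E \<psi>"
  have "smooth_on (\<psi> ` (E \<inter> U)) ((\<lambda>x. x powr a) \<circ> (f \<circ> inv_into E \<psi>))"
    by (rule smooth_on_compose[where T = "{0<..}", OF chart_open_map[OF cE U] open_greaterThan _ _ smooth_funD[OF f E]])
      (auto simp: chart_inv[OF cE] pos smooth_on_def Ck_on_powr)
  then show "smooth_on (\<psi> ` (E \<inter> U)) ((\<lambda>q. f q powr a) \<circ> inv_into E \<psi>)" by (simp add: o_def)
qed

lemma smooth_fun_continuous:
  assumes U: "open U" and f: "smooth_fun A U f"
  shows "continuous_on U f"
proof (rule continuous_at_imp_continuous_on, rule ballI)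
  fix p assume p: "p \<in> U"
  obtain E \<psi> where E: "(E, \<psi>) \<in> A" "p \<in> E" and cE: "compatible_chart A E \<psi>"
    by (rule chart_at)
  have "continuous_on (E \<inter> U) ((f \<circ> inv_into E \<psi>) \<circ> \<psi>)"
    by (rule continuous_on_compose[OF _ smooth_on_continuous[OF smooth_funD[OF f E(1)]]])
      (rule continuous_on_subset[OF homeomorphism_cont1[OF chart_homeomorphism[OF cE]]], blast)
  then have "continuous_on (E \<inter> U) f"
    by (rule continuous_on_eq) (auto simp: chart_inv[OF cE])
  then show "isCont f p"
    using p E(2) open_Int[OF chart_open[OF cE] U] by (simp add: continuous_on_eq_continuous_at)
qed

lemma smooth_nearI: "open U \<Longrightarrow> p \<in> U \<Longrightarrow> smooth_fun A U f \<Longrightarrow> smooth_near A p f"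
  unfolding smooth_near_def by blast

lemma smooth_near_cong:
  assumes "open U" "p \<in> U" "\<And>q. q \<in> U \<Longrightarrow> f q = h q" "smooth_near A p f"
  shows "smooth_near A p h"
proof -
  obtain V where V: "open V" "p \<in> V" "smooth_fun A V f"
    using assms(4) unfolding smooth_near_def by blast
  show ?thesis
  proof (rule smooth_nearI)
    show "smooth_fun A (U \<inter> V) h"
      by (rule smooth_fun_cong[OF _ _ smooth_fun_subset[OF _ V(3)]]) (use assms V in auto)
  qed (use assms V in auto)
qed

lemma smooth_near_const: "smooth_near A p (\<lambda>q. c)"
  by (rule smooth_nearI[OF open_UNIV UNIV_I smooth_fun_const[OF open_UNIV]])


section \<open>Tangent vectors in coordinates\<close>

lemma tangent_linear:
  "v \<in> tangent_space A p \<Longrightarrow> smooth_near A p f \<Longrightarrow> smooth_near A p h \<Longrightarrow>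
    v (\<lambda>q. a * f q + b * h q) = a * v f + b * v h"
  unfolding tangent_space_def by blast

lemma tangent_product:
  "v \<in> tangent_space A p \<Longrightarrow> smooth_near A p f \<Longrightarrow> smooth_near A p h \<Longrightarrow>
    v (\<lambda>q. f q * h q) = f p * v h + h p * v f"
  unfolding tangent_space_def by blast

lemma tangent_not_smooth: "v \<in> tangent_space A p \<Longrightarrow> \<not> smooth_near A p f \<Longrightarrow> v f = 0"
  unfolding tangent_space_def by blast

lemma tangent_add:
  "v \<in> tangent_space A p \<Longrightarrow> smooth_near A p f \<Longrightarrow> smooth_near A p h \<Longrightarrow>
    v (\<lambda>q. f q + h q) = v f + v h"
  using tangent_linear[of v p f h 1 1] by simp

text \<open>Compare \<open>f\<close> and \<open>h\<close> through their common product with the indicator function of \<open>U\<close>, whose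
  derivative vanishes because it is idempotent.\<close>

lemma tangent_local:
  assumes v: "v \<in> tangent_space A p" and U: "open U" "p \<in> U" and eq: "\<And>q. q \<in> U \<Longrightarrow> f q = h q"
  shows "v f = v h"
proof (cases "smooth_near A p f")
  case True
  have h: "smooth_near A p h" by (rule smooth_near_cong[OF U _ True]) (rule eq)
  let ?e = "indicat_real U"
  have e: "smooth_near A p ?e"
    by (rule smooth_near_cong[OF U _ smooth_near_const[of p 1]]) simp
  have "v (\<lambda>q. ?e q * ?e q) = ?e p * v ?e + ?e p * v ?e" by (rule tangent_product[OF v e e])
  moreover have "(\<lambda>q. ?e q * ?e q) = ?e" by (auto simp: indicator_def)
  ultimately have "v ?e = 0" using U(2) by simp
  moreover have "(\<lambda>q. ?e q * f q) = (\<lambda>q. ?e q * h q)" using eq by (auto simp: indicator_def)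
  ultimately show ?thesis
    using tangent_product[OF v e True] tangent_product[OF v e h] U(2) by simp
next
  case False
  then have "\<not> smooth_near A p h" using smooth_near_cong[OF U, of h f] eq by auto
  then show ?thesis using False tangent_not_smooth[OF v] by simp
qed

lemma tangent_const:
  assumes v: "v \<in> tangent_space A p" shows "v (\<lambda>q. c) = 0"
proof -
  have "v (\<lambda>q. 1 * 1) = 1 * v (\<lambda>q. 1) + 1 * v (\<lambda>q. 1)"
    by (rule tangent_product[OF v]) (rule smooth_near_const)+
  then have "v (\<lambda>q. 1) = 0" by simp
  then show ?thesis
    using tangent_linear[OF v smooth_near_const[of p 1] smooth_near_const[of p 1], of c 0] by simp
qed

lemma tangent_locally_const:
  "v \<in> tangent_space A p \<Longrightarrow> open U \<Longrightarrow> p \<in> U \<Longrightarrow> (\<And>q. q \<in> U \<Longrightarrow> f q = c) \<Longrightarrow> v f = 0"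
  using tangent_local[of v p U f "\<lambda>q. c"] tangent_const[of v p c] by simp

lemma subspace_tangent_space: "subspace (tangent_space A p)"
proof (rule subspaceI)
  show "0 \<in> tangent_space A p" unfolding tangent_space_def by simp
next
  fix v w assume "v \<in> tangent_space A p" "w \<in> tangent_space A p"
  then show "v + w \<in> tangent_space A p"
    unfolding tangent_space_def by (simp add: algebra_simps)
next
  fix c v assume "v \<in> tangent_space A p"
  then show "c *\<^sub>R v \<in> tangent_space A p"
    unfolding tangent_space_def by (simp add: algebra_simps scaleR_fun_def)
qed

lemma sum_fun_apply: "(\<Sum>i\<in>I. u i) x = (\<Sum>i\<in>I. u i x)"
  by (induction I rule: infinite_finite_induct) auto

text \<open>The partial derivatives of a chart. The value 0 on functions that are not smooth follows the
  convention for tangent vectors.\<close>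

definition coordinate_field :: "'a set \<Rightarrow> ('a \<Rightarrow> real^4) \<Rightarrow> 4 \<Rightarrow> 'a vector_field" where
  "coordinate_field D \<phi> i p f =
     (if smooth_near A p f then frechet_derivative (f \<circ> inv_into D \<phi>) (at (\<phi> p)) (axis i 1) else 0)"

lemma smooth_near_in_chart:
  assumes c: "compatible_chart A D \<phi>" and p: "p \<in> D" and f: "smooth_near A p f"
  shows "((f \<circ> inv_into D \<phi>) has_derivative frechet_derivative (f \<circ> inv_into D \<phi>) (at (\<phi> p))) (at (\<phi> p))"
proof -
  obtain U where U: "open U" "p \<in> U" "smooth_fun A U f" using f unfolding smooth_near_def by blast
  show ?thesis
    by (rule smooth_on_derivative[OF smooth_fun_in_chart[OF c U(1,3)]]) (use p U in auto)
qed

lemma coordinate_field_tangent: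
  assumes c: "compatible_chart A D \<phi>" and p: "p \<in> D"
  shows "coordinate_field D \<phi> i p \<in> tangent_space A p"
proof -
  let ?D = "\<lambda>f. frechet_derivative (f \<circ> inv_into D \<phi>) (at (\<phi> p))"
  have lin: "smooth_near A p (\<lambda>q. a * f q + b * h q)"
    "?D (\<lambda>q. a * f q + b * h q) = (\<lambda>v. a * ?D f v + b * ?D h v)"
    and prod: "smooth_near A p (\<lambda>q. f q * h q)"
    "?D (\<lambda>q. f q * h q) = (\<lambda>v. f p * ?D h v + ?D f v * h p)"
    if f: "smooth_near A p f" and h: "smooth_near A p h" for f h a b
  proof -
    obtain U where U: "open U" "p \<in> U" "smooth_fun A U f" using f unfolding smooth_near_def by blast
    obtain V where V: "open V" "p \<in> V" "smooth_fun A V h" using h unfolding smooth_near_def by blast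
    have UV: "open (U \<inter> V)" "p \<in> U \<inter> V" "smooth_fun A (U \<inter> V) f" "smooth_fun A (U \<inter> V) h"
      using U V smooth_fun_subset[of "U \<inter> V"] by auto
    show "smooth_near A p (\<lambda>q. a * f q + b * h q)" "smooth_near A p (\<lambda>q. f q * h q)"
      by (rule smooth_nearI[OF UV(1,2)],
          intro smooth_fun_add smooth_fun_mult smooth_fun_const UV)+
    note d = smooth_near_in_chart[OF c p f] smooth_near_in_chart[OF c p h]
    show "?D (\<lambda>q. a * f q + b * h q) = (\<lambda>v. a * ?D f v + b * ?D h v)"
      using has_derivative_add[OF has_derivative_mult_right[OF d(1), of a]
          has_derivative_mult_right[OF d(2), of b]]
      by (intro frechet_derivative_at[symmetric]) (simp add: o_def)
    show "?D (\<lambda>q. f q * h q) = (\<lambda>v. f p * ?D h v + ?D f v * h p)"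
      using has_derivative_mult[OF d] p
      by (intro frechet_derivative_at[symmetric]) (simp add: o_def chart_inv[OF c])
  qed
  show ?thesis
    unfolding tangent_space_def by (auto simp: coordinate_field_def lin prod)
qed

lemma coordinate_field_smooth:
  assumes c: "compatible_chart A D \<phi>"
  shows "coordinate_field D \<phi> i \<in> vector_fields A D"
  unfolding vector_fields_def
proof (intro CollectI conjI ballI allI impI)
  fix S f assume S: "open S" "S \<subseteq> D" "smooth_fun A S f"
  have T: "open (\<phi> ` S)" using chart_open_map[OF c S(1)] S(2) by (simp add: inf.absorb2)
  have "smooth_on (\<phi> ` S) (f \<circ> inv_into D \<phi>)"
    using smooth_fun_in_chart[OF c S(1,3)] S(2) by (simp add: inf.absorb2)
  from smooth_fun_from_chart[OF c T _ smooth_on_frechet[OF this, of "axis i 1"]] S(2)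
  have "smooth_fun A (D \<inter> \<phi> -` \<phi> ` S)
     ((\<lambda>x. frechet_derivative (f \<circ> inv_into D \<phi>) (at x) (axis i 1)) \<circ> \<phi>)" by blast
  then have "smooth_fun A S ((\<lambda>x. frechet_derivative (f \<circ> inv_into D \<phi>) (at x) (axis i 1)) \<circ> \<phi>)"
    by (rule smooth_fun_subset[rotated]) (use S in auto)
  then show "smooth_fun A S (\<lambda>p. coordinate_field D \<phi> i p f)"
    by (rule smooth_fun_cong[OF S(1), rotated])
      (use S in \<open>auto simp: coordinate_field_def intro: smooth_nearI\<close>)
qed (rule coordinate_field_tangent[OF c])

lemma coordinate_field_coordinate:
  assumes c: "compatible_chart A D \<phi>" and p: "p \<in> D"
  shows "coordinate_field D \<phi> i p (\<lambda>q. \<phi> q $ j) = (if i = j then 1 else 0)"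
proof -
  have "smooth_near A p (\<lambda>q. \<phi> q $ j)"
    using smooth_nearI[OF chart_open[OF c] p smooth_fun_coordinate[OF c]] .
  moreover have "((\<lambda>q. \<phi> q $ j) \<circ> inv_into D \<phi> has_derivative (\<lambda>x. x $ j)) (at (\<phi> p))"
  proof (rule has_derivative_transform_within_open[OF _ chart_open_image[OF c]])
    show "((\<lambda>x. x $ j) has_derivative (\<lambda>x. x $ j)) (at (\<phi> p))"
      by (rule bounded_linear_imp_has_derivative[OF bounded_linear_vec_nth])
  qed (use p in \<open>auto simp: chart_inv[OF c]\<close>)
  ultimately show ?thesis
    unfolding coordinate_field_def by (simp add: frechet_derivative_at[symmetric] axis_def)
qed

text \<open>Hadamard's lemma writes \<open>f\<close> near \<open>p\<close> as a constant plus products of functions of which one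
  factor, a centred coordinate, vanishes at \<open>p\<close>. Hence a derivation is determined by its values on
  the coordinates.\<close>

theorem tangent_in_coordinates:
  assumes c: "compatible_chart A D \<phi>" and p: "p \<in> D" and v: "v \<in> tangent_space A p"
  shows "v = (\<Sum>i\<in>UNIV. v (\<lambda>q. \<phi> q $ i) *\<^sub>R coordinate_field D \<phi> i p)"
proof
  fix f
  have "v f = (\<Sum>i\<in>UNIV. v (\<lambda>q. \<phi> q $ i) * coordinate_field D \<phi> i p f)"
  proof (cases "smooth_near A p f")
    case False
    then show ?thesis using tangent_not_smooth[OF v] by (simp add: coordinate_field_def)
  next
    case True
    then obtain U where U: "open U" "p \<in> U" "smooth_fun A U f" unfolding smooth_near_def by blast
    let ?F = "f \<circ> inv_into D \<phi>" and ?x = "\<phi> p"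
    obtain r where r: "r > 0" "ball ?x r \<subseteq> \<phi> ` (D \<inter> U)"
      using chart_open_map[OF c U(1)] p U(2) openE by (metis IntI imageI)
    have sF: "smooth_on (ball ?x r) ?F"
      using smooth_on_subset[OF r(2) smooth_fun_in_chart[OF c U(1,3)]] .
    obtain h where h: "\<And>i. smooth_on (ball ?x r) (h i)"
      and F: "\<And>x. x \<in> ball ?x r \<Longrightarrow> ?F x = ?F ?x + (\<Sum>i\<in>UNIV. (x $ i - ?x $ i) * h i x)"
      and hx: "\<And>i. h i ?x = frechet_derivative ?F (at ?x) (axis i 1)"
      by (rule Hadamard_lemma[OF sF r(1)], rule that)
    \<comment> \<open>the part of the chart on which Hadamard's formula holds\<close>
    define N where "N = D \<inter> \<phi> -` ball ?x r"
    have N: "open N" "p \<in> N" unfolding N_def using chart_open_preimage[OF c] p r(1) by auto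
    let ?a = "\<lambda>i q. \<phi> q $ i + - (?x $ i)" and ?b = "\<lambda>i. h i \<circ> \<phi>"
    have co: "smooth_fun A N (\<lambda>q. \<phi> q $ i)" for i
      by (rule smooth_fun_subset[OF _ smooth_fun_coordinate[OF c]]) (auto simp: N_def)
    have a: "smooth_fun A N (?a i)" for i
      by (intro smooth_fun_add N co smooth_fun_const)
    have b: "smooth_fun A N (?b i)" for i
      unfolding N_def by (rule smooth_fun_from_chart[OF c _ _ h]) (use r(2) in auto)
    have near: "smooth_near A p u" if "smooth_fun A N u" for u
      using smooth_nearI[OF N that] .
    have va: "v (?a i) = v (\<lambda>q. \<phi> q $ i)" for i
      by (simp only: tangent_add[OF v near[OF co] smooth_near_const] tangent_const[OF v] add_0_right)
    have vab: "v (\<lambda>q. ?a i q * ?b i q) = v (\<lambda>q. \<phi> q $ i) * h i ?x" for i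
      by (simp only: tangent_product[OF v near[OF a] near[OF b]] va) simp
    have vsum: "smooth_fun A N (\<lambda>q. \<Sum>i\<in>I. ?a i q * ?b i q) \<and>
        v (\<lambda>q. \<Sum>i\<in>I. ?a i q * ?b i q) = (\<Sum>i\<in>I. v (\<lambda>q. \<phi> q $ i) * h i ?x)" if "finite I" for I
      using that
    proof induction
      case empty
      then show ?case using smooth_fun_const[OF N(1)] tangent_const[OF v] by simp
    next
      case (insert j I)
      have ab: "smooth_fun A N (\<lambda>q. ?a j q * ?b j q)" by (rule smooth_fun_mult[OF N(1) a b])
      have "v (\<lambda>q. ?a j q * ?b j q + (\<Sum>i\<in>I. ?a i q * ?b i q)) =
          v (\<lambda>q. ?a j q * ?b j q) + v (\<lambda>q. \<Sum>i\<in>I. ?a i q * ?b i q)"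
        by (rule tangent_add[OF v near[OF ab] near]) (use insert.IH in blast)
      moreover have "smooth_fun A N (\<lambda>q. ?a j q * ?b j q + (\<Sum>i\<in>I. ?a i q * ?b i q))"
        by (rule smooth_fun_add[OF N(1) ab]) (use insert.IH in blast)
      ultimately show ?case
        using insert.IH vab[of j] by (simp only: sum.insert[OF insert.hyps])
    qed
    have "v f = v (\<lambda>q. f p + (\<Sum>i\<in>UNIV. ?a i q * ?b i q))"
    proof (rule tangent_local[OF v N])
      fix q assume "q \<in> N"
      then show "f q = f p + (\<Sum>i\<in>UNIV. ?a i q * ?b i q)"
        using F[of "\<phi> q"] p by (simp add: N_def chart_inv[OF c])
    qed
    also have "\<dots> = (\<Sum>i\<in>UNIV. v (\<lambda>q. \<phi> q $ i) * h i ?x)"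
      using vsum[OF finite] tangent_add[OF v smooth_near_const near] tangent_const[OF v] by simp
    finally show ?thesis using True by (simp add: coordinate_field_def hx)
  qed
  then show "v f = (\<Sum>i\<in>UNIV. v (\<lambda>q. \<phi> q $ i) *\<^sub>R coordinate_field D \<phi> i p) f"
    by (simp add: sum_fun_apply scaleR_fun_def)
qed

end

section \<open>Vector fields\<close>

context smooth_manifold
begin

lemma vector_field_tangent: "X \<in> vector_fields A U \<Longrightarrow> p \<in> U \<Longrightarrow> X p \<in> tangent_space A p"
  unfolding vector_fields_def by blast

lemma vector_field_smooth:
  "X \<in> vector_fields A U \<Longrightarrow> open S \<Longrightarrow> S \<subseteq> U \<Longrightarrow> smooth_fun A S f \<Longrightarrow> smooth_fun A S (\<lambda>p. X p f)"
  unfolding vector_fields_def by blast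

lemma vector_fieldI:
  assumes "\<And>p. p \<in> U \<Longrightarrow> X p \<in> tangent_space A p"
    and "\<And>S f. open S \<Longrightarrow> S \<subseteq> U \<Longrightarrow> smooth_fun A S f \<Longrightarrow> smooth_fun A S (\<lambda>p. X p f)"
  shows "X \<in> vector_fields A U"
  using assms unfolding vector_fields_def by blast

lemma vector_field_subset: "V \<subseteq> U \<Longrightarrow> X \<in> vector_fields A U \<Longrightarrow> X \<in> vector_fields A V"
  by (rule vector_fieldI) (auto intro: vector_field_tangent vector_field_smooth)

lemma vector_field_add:
  assumes "X \<in> vector_fields A U" "Y \<in> vector_fields A U"
  shows "(\<lambda>q. X q + Y q) \<in> vector_fields A U"
  by (rule vector_fieldI)
    (use assms in \<open>auto intro: subspace_add[OF subspace_tangent_space] vector_field_tangent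
        smooth_fun_add vector_field_smooth\<close>)

lemma vector_field_scale:
  assumes "smooth_fun A U a" "X \<in> vector_fields A U"
  shows "(\<lambda>q. a q *\<^sub>R X q) \<in> vector_fields A U"
proof (rule vector_fieldI)
  show "a p *\<^sub>R X p \<in> tangent_space A p" if "p \<in> U" for p
    using subspace_scale[OF subspace_tangent_space vector_field_tangent[OF assms(2) that]] .
next
  fix S f assume S: "open S" "S \<subseteq> U" "smooth_fun A S f"
  have "smooth_fun A S (\<lambda>p. a p * X p f)"
    by (rule smooth_fun_mult[OF S(1) smooth_fun_subset[OF S(2) assms(1)] vector_field_smooth[OF assms(2) S]])
  then show "smooth_fun A S (\<lambda>p. (a p *\<^sub>R X p) f)" by (simp add: scaleR_fun_def)
qed

lemma vector_field_minus:
  "open U \<Longrightarrow> X \<in> vector_fields A U \<Longrightarrow> (\<lambda>q. - X q) \<in> vector_fields A U"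
  using vector_field_scale[OF smooth_fun_const[of U "-1"]] by simp

lemma vector_field_sum:
  assumes "open U" "\<And>i. i \<in> I \<Longrightarrow> X i \<in> vector_fields A U"
  shows "(\<lambda>q. \<Sum>i\<in>I. X i q) \<in> vector_fields A U"
  using assms(2)
proof (induction I rule: infinite_finite_induct)
  case (insert i I)
  have "(\<lambda>q. \<Sum>j\<in>insert i I. X j q) = (\<lambda>q. X i q + (\<Sum>j\<in>I. X j q))"
    using insert.hyps by (simp add: fun_eq_iff)
  then show ?case
    using vector_field_add[of "X i" U "\<lambda>q. \<Sum>j\<in>I. X j q"] insert by (simp only: insertI1 insertI2)
qed (auto intro!: vector_fieldI subspace_0[OF subspace_tangent_space] smooth_fun_const)

text \<open>The coordinates themselves form the dual basis, whence independence.\<close>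

lemma coordinate_fields_basis:
  assumes c: "compatible_chart A D \<phi>" and p: "p \<in> D"
  shows "span (range (\<lambda>i. coordinate_field D \<phi> i p)) = tangent_space A p"
    and "independent (range (\<lambda>i. coordinate_field D \<phi> i p))"
    and "card (range (\<lambda>i. coordinate_field D \<phi> i p)) = 4"
proof -
  let ?d = "\<lambda>i. coordinate_field D \<phi> i p"
  note co = coordinate_field_coordinate[OF c p]
  have inj: "inj ?d"
  proof
    fix i j assume "?d i = ?d j"
    then have "?d i (\<lambda>q. \<phi> q $ j) = ?d j (\<lambda>q. \<phi> q $ j)" by simp
    then show "i = j" unfolding co by (simp split: if_splits)
  qed
  then show "card (range ?d) = 4" by (simp add: card_image)
  show "span (range ?d) = tangent_space A p"
  proof
    show "span (range ?d) \<subseteq> tangent_space A p"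
      by (rule span_minimal[OF _ subspace_tangent_space]) (auto intro: coordinate_field_tangent[OF c p])
    show "tangent_space A p \<subseteq> span (range ?d)"
    proof
      fix v assume "v \<in> tangent_space A p"
      then show "v \<in> span (range ?d)"
        by (subst tangent_in_coordinates[OF c p, of v], assumption)
          (intro span_sum span_scale span_base rangeI)
    qed
  qed
  show "independent (range ?d)"
  proof
    assume "dependent (range ?d)"
    then obtain a j where zero: "(\<Sum>x\<in>range ?d. a x *\<^sub>R x) = 0" and j: "a (?d j) \<noteq> 0"
      by (subst (asm) dependent_finite) auto
    have "(\<Sum>x\<in>range ?d. a x *\<^sub>R x) = (\<Sum>i\<in>UNIV. a (?d i) *\<^sub>R ?d i)"
      by (simp only: sum.reindex[OF inj] o_def)
    then have "(\<Sum>i\<in>UNIV. a (?d i) *\<^sub>R ?d i) = 0" using zero by (rule trans[OF sym])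
    then have zero_j: "(\<Sum>i\<in>UNIV. a (?d i) *\<^sub>R ?d i) (\<lambda>q. \<phi> q $ j) = 0" by simp
    have "a (?d j) = (\<Sum>i\<in>UNIV. if i = j then a (?d i) else 0)"
      by (subst sum.delta) auto
    also have "\<dots> = (\<Sum>i\<in>UNIV. a (?d i) * ?d i (\<lambda>q. \<phi> q $ j))"
      by (rule sum.cong[OF refl], subst co) auto
    also have "\<dots> = 0"
      by (subst zero_j[symmetric]) (simp only: sum_fun_apply scaleR_fun_def real_scaleR_def)
    finally show False using j by contradiction
  qed
qed

end


section \<open>Orthonormal families of tangent vectors\<close>

locale riemannian_manifold = smooth_manifold A
  for A :: "'a::{t2_space,second_countable_topology} chart set" +
  fixes g :: "'a metric_tensor"
  assumes metric: "riemannian_metric A g"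
begin

lemma metric_lin:
  "u \<in> tangent_space A p \<Longrightarrow> v \<in> tangent_space A p \<Longrightarrow> w \<in> tangent_space A p \<Longrightarrow>
    g p (a *\<^sub>R u + b *\<^sub>R v) w = a * g p u w + b * g p v w"
  by (rule metric[unfolded riemannian_metric_def, THEN conjunct1, rule_format])

lemma metric_sym:
  "u \<in> tangent_space A p \<Longrightarrow> v \<in> tangent_space A p \<Longrightarrow> g p u v = g p v u"
  by (rule metric[unfolded riemannian_metric_def, THEN conjunct2, THEN conjunct1, rule_format])

lemma metric_pos: "v \<in> tangent_space A p \<Longrightarrow> v \<noteq> 0 \<Longrightarrow> g p v v > 0"
  by (rule metric[unfolded riemannian_metric_def, THEN conjunct2, THEN conjunct2, THEN conjunct1, rule_format])

lemma metric_smooth: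
  "open U \<Longrightarrow> X \<in> vector_fields A U \<Longrightarrow> Y \<in> vector_fields A U \<Longrightarrow> smooth_fun A U (\<lambda>p. g p (X p) (Y p))"
  by (rule metric[unfolded riemannian_metric_def, THEN conjunct2, THEN conjunct2, THEN conjunct2, rule_format])

lemmas tangent_closed = subspace_0[OF subspace_tangent_space] subspace_add[OF subspace_tangent_space]
  subspace_scale[OF subspace_tangent_space] subspace_diff[OF subspace_tangent_space]
  subspace_neg[OF subspace_tangent_space]

lemma tangent_sum:
  "(\<And>i. i \<in> I \<Longrightarrow> u i \<in> tangent_space A p) \<Longrightarrow> (\<Sum>i\<in>I. u i) \<in> tangent_space A p"
  using subspace_sum[OF subspace_tangent_space] .

lemma metric_add_left:
  "u \<in> tangent_space A p \<Longrightarrow> v \<in> tangent_space A p \<Longrightarrow> w \<in> tangent_space A p \<Longrightarrow>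
    g p (u + v) w = g p u w + g p v w"
  using metric_lin[of u p v w 1 1] by simp

lemma metric_scale_left:
  "u \<in> tangent_space A p \<Longrightarrow> w \<in> tangent_space A p \<Longrightarrow> g p (a *\<^sub>R u) w = a * g p u w"
  using metric_lin[of u p u w a 0] by simp

lemma metric_zero_left: "w \<in> tangent_space A p \<Longrightarrow> g p 0 w = 0"
  using metric_scale_left[of 0 p w 0] tangent_closed(1) by simp

lemma metric_neg_left:
  "u \<in> tangent_space A p \<Longrightarrow> w \<in> tangent_space A p \<Longrightarrow> g p (- u) w = - g p u w"
  using metric_scale_left[of u p w "-1"] by simp

lemma metric_diff_left:
  "u \<in> tangent_space A p \<Longrightarrow> v \<in> tangent_space A p \<Longrightarrow> w \<in> tangent_space A p \<Longrightarrow>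
    g p (u - v) w = g p u w - g p v w"
  using metric_lin[of u p v w 1 "-1"] by simp

lemma metric_sum_left:
  "(\<And>i. i \<in> I \<Longrightarrow> u i \<in> tangent_space A p) \<Longrightarrow> w \<in> tangent_space A p \<Longrightarrow>
    g p (\<Sum>i\<in>I. u i) w = (\<Sum>i\<in>I. g p (u i) w)"
  by (induction I rule: infinite_finite_induct)
    (simp_all add: metric_zero_left metric_add_left tangent_sum)

lemmas metric_left = metric_add_left metric_scale_left metric_zero_left metric_neg_left
  metric_diff_left metric_sum_left

lemma metric_right:
  assumes w: "w \<in> tangent_space A p"
  shows "u \<in> tangent_space A p \<Longrightarrow> v \<in> tangent_space A p \<Longrightarrow> g p w (u + v) = g p w u + g p w v"
    and "u \<in> tangent_space A p \<Longrightarrow> g p w (a *\<^sub>R u) = a * g p w u"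
    and "g p w 0 = 0"
    and "u \<in> tangent_space A p \<Longrightarrow> g p w (- u) = - g p w u"
    and "u \<in> tangent_space A p \<Longrightarrow> v \<in> tangent_space A p \<Longrightarrow> g p w (u - v) = g p w u - g p w v"
    and "(\<And>i. i \<in> I \<Longrightarrow> x i \<in> tangent_space A p) \<Longrightarrow> g p w (\<Sum>i\<in>I. x i) = (\<Sum>i\<in>I. g p w (x i))"
proof -
  have s: "g p w x = g p x w" if "x \<in> tangent_space A p" for x
    using metric_sym[OF w that] .
  show "u \<in> tangent_space A p \<Longrightarrow> v \<in> tangent_space A p \<Longrightarrow> g p w (u + v) = g p w u + g p w v"
    using s metric_add_left[of u p v w] w tangent_closed(2) by simp
  show "u \<in> tangent_space A p \<Longrightarrow> g p w (a *\<^sub>R u) = a * g p w u"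
    using s metric_scale_left[of u p w a] w tangent_closed(3) by simp
  show "g p w 0 = 0"
    using s[of 0] metric_zero_left[OF w] tangent_closed(1) by simp
  show "u \<in> tangent_space A p \<Longrightarrow> g p w (- u) = - g p w u"
    using s metric_neg_left[of u p w] w tangent_closed(5) by simp
  show "u \<in> tangent_space A p \<Longrightarrow> v \<in> tangent_space A p \<Longrightarrow> g p w (u - v) = g p w u - g p w v"
    using s metric_diff_left[of u p v w] w tangent_closed(4) by simp
  assume x: "\<And>i. i \<in> I \<Longrightarrow> x i \<in> tangent_space A p"
  have "g p w (\<Sum>i\<in>I. x i) = g p (\<Sum>i\<in>I. x i) w"
    by (rule s, rule tangent_sum, rule x)
  also have "\<dots> = (\<Sum>i\<in>I. g p (x i) w)"
    by (rule metric_sum_left[OF x w])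
  also have "\<dots> = (\<Sum>i\<in>I. g p w (x i))"
    by (rule sum.cong[OF refl], rule s[symmetric], rule x)
  finally show "g p w (\<Sum>i\<in>I. x i) = (\<Sum>i\<in>I. g p w (x i))" .
qed

definition orthonormal_at :: "'a \<Rightarrow> nat \<Rightarrow> (nat \<Rightarrow> 'a tangent_vector) \<Rightarrow> bool" where
  "orthonormal_at p n u \<longleftrightarrow> (\<forall>i<n. u i \<in> tangent_space A p) \<and>
     (\<forall>i<n. \<forall>j<n. g p (u i) (u j) = (if i = j then 1 else 0))"

lemma orthonormal_expansion:
  assumes u: "orthonormal_at p n u" and w: "w \<in> span (u ` {..<n})"
  shows "w = (\<Sum>i<n. g p w (u i) *\<^sub>R u i)"
proof -
  have uT: "u i \<in> tangent_space A p" if "i < n" for i using u that unfolding orthonormal_at_def by blast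
  have "span (u ` {..<n}) \<subseteq> {w. w \<in> tangent_space A p \<and> w = (\<Sum>i<n. g p w (u i) *\<^sub>R u i)}"
  proof (rule span_minimal[OF subsetI])
    show "subspace {w. w \<in> tangent_space A p \<and> w = (\<Sum>i<n. g p w (u i) *\<^sub>R u i)}"
    proof (rule subspaceI; clarify)
      fix v w
      assume v: "v \<in> tangent_space A p" and ve: "v = (\<Sum>i<n. g p v (u i) *\<^sub>R u i)"
        and w: "w \<in> tangent_space A p" and we: "w = (\<Sum>i<n. g p w (u i) *\<^sub>R u i)"
      have "(\<Sum>i<n. g p (v + w) (u i) *\<^sub>R u i) = (\<Sum>i<n. g p v (u i) *\<^sub>R u i) + (\<Sum>i<n. g p w (u i) *\<^sub>R u i)"
        by (simp add: metric_add_left v w uT scaleR_add_left sum.distrib)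
      then show "v + w \<in> tangent_space A p \<and> v + w = (\<Sum>i<n. g p (v + w) (u i) *\<^sub>R u i)"
        using ve we tangent_closed(2)[OF v w] by simp
    next
      fix c v
      assume v: "v \<in> tangent_space A p" and ve: "v = (\<Sum>i<n. g p v (u i) *\<^sub>R u i)"
      have "(\<Sum>i<n. g p (c *\<^sub>R v) (u i) *\<^sub>R u i) = c *\<^sub>R (\<Sum>i<n. g p v (u i) *\<^sub>R u i)"
        by (simp add: metric_scale_left v uT scaleR_sum_right)
      then show "c *\<^sub>R v \<in> tangent_space A p \<and> c *\<^sub>R v = (\<Sum>i<n. g p (c *\<^sub>R v) (u i) *\<^sub>R u i)"
        using ve tangent_closed(3)[OF v] by simp
    qed (simp add: metric_zero_left uT tangent_closed)
    fix x assume "x \<in> u ` {..<n}"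
    then obtain j where j: "j < n" "x = u j" by blast
    have "(\<Sum>i<n. g p x (u i) *\<^sub>R u i) = (\<Sum>i<n. if i = j then u i else 0)"
      by (rule sum.cong) (use u j in \<open>auto simp: orthonormal_at_def\<close>)
    then show "x \<in> {w. w \<in> tangent_space A p \<and> w = (\<Sum>i<n. g p w (u i) *\<^sub>R u i)}"
      using j uT by simp
  qed
  then show ?thesis using w by blast
qed

lemma orthonormal_Parseval:
  assumes u: "orthonormal_at p n u" and v: "v \<in> span (u ` {..<n})" and w: "w \<in> tangent_space A p"
  shows "g p v w = (\<Sum>i<n. g p v (u i) * g p (u i) w)"
proof -
  have uT: "u i \<in> tangent_space A p" if "i < n" for i using u that unfolding orthonormal_at_def by blast
  have "g p v w = g p (\<Sum>i<n. g p v (u i) *\<^sub>R u i) w"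
    using orthonormal_expansion[OF u v] by simp
  also have "\<dots> = (\<Sum>i<n. g p v (u i) * g p (u i) w)"
    using uT w by (subst metric_sum_left) (auto simp: metric_scale_left tangent_closed)
  finally show ?thesis .
qed

lemma orthonormal_independent:
  "orthonormal_at p n u \<Longrightarrow> independent (u ` {..<n}) \<and> card (u ` {..<n}) = n"
proof (induction n)
  case (Suc n)
  have u: "orthonormal_at p n u" using Suc.prems unfolding orthonormal_at_def by auto
  have "u n \<notin> span (u ` {..<n})"
  proof
    assume "u n \<in> span (u ` {..<n})"
    from orthonormal_expansion[OF u this] have "u n = (\<Sum>i<n. g p (u n) (u i) *\<^sub>R u i)" .
    also have "\<dots> = 0" using Suc.prems by (intro sum.neutral) (auto simp: orthonormal_at_def)
    finally have "g p (u n) (u n) = 0"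
      using metric_zero_left[of "u n" p] Suc.prems by (auto simp: orthonormal_at_def)
    then show False using Suc.prems by (auto simp: orthonormal_at_def)
  qed
  moreover from this have "u n \<notin> u ` {..<n}" by (rule contrapos_nn) (rule span_base)
  ultimately show ?case
    using Suc.IH[OF u] by (simp add: lessThan_Suc independent_insertI)
qed (simp add: independent_empty)

text \<open>Orthonormal vectors are independent, so \<open>n\<close> of them exhaust a span of at most \<open>n\<close> vectors.\<close>

lemma orthonormal_span:
  assumes u: "orthonormal_at p n u" and sub: "u ` {..<n} \<subseteq> span S" and S: "finite S" "card S \<le> n"
  shows "span (u ` {..<n}) = span S"
proof
  show "span (u ` {..<n}) \<subseteq> span S" using span_minimal[OF sub] by simp
  have "s \<in> span (u ` {..<n})" if s: "s \<in> S" for s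
  proof (rule ccontr)
    assume ns: "s \<notin> span (u ` {..<n})"
    then have "independent (insert s (u ` {..<n}))"
      using orthonormal_independent[OF u] by (simp add: independent_insertI)
    moreover have "insert s (u ` {..<n}) \<subseteq> span S" using sub s span_base by blast
    ultimately have "card (insert s (u ` {..<n})) \<le> card S"
      using independent_span_bound[OF S(1)] by blast
    moreover have "s \<notin> u ` {..<n}" using ns by (rule contrapos_nn) (rule span_base)
    ultimately show False using orthonormal_independent[OF u] S(2) by simp
  qed
  then show "span S \<subseteq> span (u ` {..<n})" by (intro span_minimal) auto
qed


section \<open>Existence of adapted frames\<close>

definition orthonormal_fields :: "'a set \<Rightarrow> nat \<Rightarrow> (nat \<Rightarrow> 'a vector_field) \<Rightarrow> bool" where
  "orthonormal_fields U n F \<longleftrightarrow>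
     (\<forall>i<n. F i \<in> vector_fields A U) \<and> (\<forall>q\<in>U. orthonormal_at q n (\<lambda>i. F i q))"

lemma orthonormal_fields_subset: "V \<subseteq> U \<Longrightarrow> orthonormal_fields U n F \<Longrightarrow> orthonormal_fields V n F"
  unfolding orthonormal_fields_def using vector_field_subset by blast

text \<open>One Gram-Schmidt step. The component of \<open>G\<close> orthogonal to the family does not vanish at
  \<open>p\<close>, hence not near \<open>p\<close>, and can be normalised there.\<close>

lemma Gram_Schmidt_step:
  assumes U: "open U" "p \<in> U" and F: "orthonormal_fields U n F" and G: "G \<in> vector_fields A U"
    and indep: "G p \<notin> span ((\<lambda>i. F i p) ` {..<n})"
    and D: "\<And>q. q \<in> U \<Longrightarrow> subspace (D q)" "\<And>q. q \<in> U \<Longrightarrow> G q \<in> D q"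
      "\<And>q i. q \<in> U \<Longrightarrow> i < n \<Longrightarrow> F i q \<in> D q"
  obtains V H where "open V" "p \<in> V" "V \<subseteq> U" "orthonormal_fields V (Suc n) (F(n := H))"
    "\<And>q. q \<in> V \<Longrightarrow> H q \<in> D q"
proof -
  have FV: "F i \<in> vector_fields A U" if "i < n" for i
    using F that unfolding orthonormal_fields_def by blast
  have FF: "g q (F i q) (F j q) = (if i = j then 1 else 0)" if "q \<in> U" "i < n" "j < n" for q i j
    using F that unfolding orthonormal_fields_def orthonormal_at_def by blast
  define P where "P q = (\<Sum>i<n. g q (G q) (F i q) *\<^sub>R F i q)" for q
  \<comment> \<open>the orthogonal component of \<open>G\<close> and its squared length\<close>
  define R where "R q = G q + - P q" for q
  define s where "s q = g q (R q) (R q)" for q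
  define V where "V = {q \<in> U. 0 < s q}"
  define H where "H q = (s q powr (-1/2)) *\<^sub>R R q" for q
  have P: "P \<in> vector_fields A U"
    unfolding P_def by (intro vector_field_sum vector_field_scale metric_smooth G FV U) auto
  have R: "R \<in> vector_fields A U"
    unfolding R_def by (intro vector_field_add G vector_field_minus P U)
  have s: "smooth_fun A U s"
    unfolding s_def by (intro metric_smooth R U)
  have V_open: "open V"
  proof -
    have "V = U \<inter> s -` {0<..}" unfolding V_def by auto
    then show ?thesis
      using continuous_open_preimage[OF smooth_fun_continuous[OF U(1) s] U(1) open_greaterThan] by simp
  qed
  have VU: "V \<subseteq> U" unfolding V_def by blast
  have "R p \<noteq> 0"
  proof
    assume "R p = 0"
    then have "G p = P p" by (simp add: R_def)
    moreover have "P p \<in> span ((\<lambda>i. F i p) ` {..<n})"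
      unfolding P_def by (intro span_sum span_scale span_base) auto
    ultimately show False using indep by simp
  qed
  then have pV: "p \<in> V"
    using metric_pos[OF vector_field_tangent[OF R U(2)]] U(2) by (simp add: V_def s_def)
  have H: "H \<in> vector_fields A V"
    unfolding H_def
    by (intro vector_field_scale smooth_fun_powr V_open smooth_fun_subset[OF VU s] vector_field_subset[OF VU R])
      (simp add: V_def)
  have RF: "g q (R q) (F j q) = 0" if q: "q \<in> U" and j: "j < n" for q j
  proof -
    have T: "G q \<in> tangent_space A q" "P q \<in> tangent_space A q" "\<And>i. i < n \<Longrightarrow> F i q \<in> tangent_space A q"
      using vector_field_tangent[OF _ q] G P FV by auto
    have "g q (P q) (F j q) = (\<Sum>i<n. g q (G q) (F i q) * g q (F i q) (F j q))"
      unfolding P_def using T j by (subst metric_sum_left) (auto simp: metric_scale_left tangent_closed)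
    also have "\<dots> = (\<Sum>i<n. if i = j then g q (G q) (F i q) else 0)"
      by (rule sum.cong) (use FF q j in auto)
    also have "\<dots> = g q (G q) (F j q)" using j by simp
    finally show ?thesis
      unfolding R_def using T j by (simp add: metric_left tangent_closed)
  qed
  have HF: "g q (H q) (F j q) = 0" if q: "q \<in> V" and j: "j < n" for q j
    using RF[of q j] that VU vector_field_tangent[OF R, of q] vector_field_tangent[OF FV[OF j], of q]
    unfolding H_def by (auto simp: metric_scale_left)
  have HH: "g q (H q) (H q) = 1" if q: "q \<in> V" for q
  proof -
    have "R q \<in> tangent_space A q" using vector_field_tangent[OF R] q VU by blast
    then have "g q (H q) (H q) = (s q powr (-1/2) * s q powr (-1/2)) * s q"
      unfolding H_def by (simp add: metric_left metric_right tangent_closed s_def)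
    also have "\<dots> = 1" using q unfolding V_def by (simp add: powr_add[symmetric] powr_minus_divide)
    finally show ?thesis .
  qed
  have "orthonormal_fields V (Suc n) (F(n := H))"
    unfolding orthonormal_fields_def orthonormal_at_def
  proof (intro conjI allI impI ballI)
    show FH: "(F(n := H)) i \<in> vector_fields A V" if "i < Suc n" for i
      using H FV[of i] vector_field_subset[OF VU] that by (auto simp: less_Suc_eq)
    fix q assume q: "q \<in> V"
    show "(F(n := H)) i q \<in> tangent_space A q" if "i < Suc n" for i
      using FH[OF that] vector_field_tangent q by blast
    fix i j assume ij: "i < Suc n" "j < Suc n"
    have "g q (F i q) (H q) = g q (H q) (F i q)" if "i < n"
      using metric_sym vector_field_tangent[OF H q] vector_field_tangent[OF FV[OF that]] q VU by blast
    then show "g q ((F(n := H)) i q) ((F(n := H)) j q) = (if i = j then 1 else 0)"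
      using ij HF[OF q] HH[OF q] FF[of q i j] q VU by (auto simp: less_Suc_eq)
  qed
  moreover have "H q \<in> D q" if "q \<in> V" for q
  proof -
    have q: "q \<in> U" using that VU by blast
    have "P q \<in> D q"
      unfolding P_def by (intro subspace_sum[OF D(1)[OF q]] subspace_scale[OF D(1)[OF q]]) (use D(3) q in auto)
    then show ?thesis
      unfolding H_def R_def
      by (intro subspace_scale[OF D(1)[OF q]] subspace_add[OF D(1)[OF q]] subspace_neg[OF D(1)[OF q]] D(2)[OF q])
  qed
  ultimately show thesis using that V_open pV VU by blast
qed

text \<open>Fields whose values at \<open>p\<close> span a space of dimension greater than \<open>n\<close> cannot all lie in the
  span of \<open>n\<close> vectors, so one of them can enter the Gram-Schmidt step. The distribution \<open>D\<close> records
  that the new field stays vertical as long as only vertical fields have been used.\<close>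

lemma orthonormal_fields_extend:
  assumes U: "open U" "p \<in> U" and F: "orthonormal_fields U n F"
    and G: "\<And>j. j \<in> J \<Longrightarrow> G j \<in> vector_fields A U"
    and dim: "n < dim ((\<lambda>j. G j p) ` J)"
    and D: "\<And>q. q \<in> U \<Longrightarrow> subspace (D q)" "\<And>q j. q \<in> U \<Longrightarrow> j \<in> J \<Longrightarrow> G j q \<in> D q"
      "\<And>q i. q \<in> U \<Longrightarrow> i < n \<Longrightarrow> F i q \<in> D q"
  obtains V H where "open V" "p \<in> V" "V \<subseteq> U" "orthonormal_fields V (Suc n) (F(n := H))"
    "\<And>q. q \<in> V \<Longrightarrow> H q \<in> D q"
proof -
  have "\<exists>j\<in>J. G j p \<notin> span ((\<lambda>i. F i p) ` {..<n})"
  proof (rule ccontr)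
    assume "\<not> ?thesis"
    then have "(\<lambda>j. G j p) ` J \<subseteq> span ((\<lambda>i. F i p) ` {..<n})" by blast
    then have "dim ((\<lambda>j. G j p) ` J) \<le> card ((\<lambda>i. F i p) ` {..<n})" by (intro dim_le_card) auto
    also have "\<dots> \<le> n" using card_image_le[of "{..<n}" "\<lambda>i. F i p"] by simp
    finally show False using dim by simp
  qed
  then obtain j where j: "j \<in> J" "G j p \<notin> span ((\<lambda>i. F i p) ` {..<n})" by blast
  show thesis
    by (rule Gram_Schmidt_step[OF U F G[OF j(1)] j(2), of D]) (use D j that in auto)
qed

lemma orthonormal_fields_orthonormal_at:
  "orthonormal_fields U n F \<Longrightarrow> q \<in> U \<Longrightarrow> orthonormal_at q n (\<lambda>i. F i q)"
  unfolding orthonormal_fields_def by blast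

end

lemma all_less_4: "(\<forall>i<4::nat. P i) \<longleftrightarrow> P 0 \<and> P 1 \<and> P 2 \<and> P 3"
  by (auto simp: numeral_eq_Suc less_Suc_eq)

lemma all_less_2: "(\<forall>i<2::nat. P i) \<longleftrightarrow> P 0 \<and> P 1"
  by (auto simp: numeral_eq_Suc less_Suc_eq)

lemma lessThan_4: "{..<4::nat} = {0, 1, 2, 3}"
  by auto

lemma lessThan_2: "{..<2::nat} = {0, 1}"
  by auto

lemma frame_of_simps [simp]:
  "frame_of X Y Z W 0 = X" "frame_of X Y Z W (Suc 0) = Y" "frame_of X Y Z W 2 = Z"
  "frame_of X Y Z W 3 = W"
  by (simp_all add: frame_of_def numeral_eq_Suc)

lemma vector_4 [simp]:
  "(vector [x, y, z, w] :: 'b::zero^4) $ 1 = x" "(vector [x, y, z, w] :: 'b^4) $ 2 = y"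
  "(vector [x, y, z, w] :: 'b^4) $ 3 = z" "(vector [x, y, z, w] :: 'b^4) $ 4 = w"
  unfolding vector_def by simp_all

context riemannian_manifold
begin

lemma orthonormal_orthogonal_span:
  assumes u: "orthonormal_at p n u" and w: "w \<in> tangent_space A p"
    and orth: "\<And>i. i < n \<Longrightarrow> g p w (u i) = 0" and v: "v \<in> span (u ` {..<n})"
  shows "g p w v = 0"
proof -
  have uT: "u i \<in> tangent_space A p" if "i < n" for i using u that unfolding orthonormal_at_def by blast
  have "span (u ` {..<n}) \<subseteq> tangent_space A p"
    by (rule span_minimal[OF _ subspace_tangent_space]) (use uT in auto)
  then have "g p w v = g p v w" using metric_sym w v by blast
  also have "\<dots> = (\<Sum>i<n. g p v (u i) * g p (u i) w)" by (rule orthonormal_Parseval[OF u v w])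
  also have "\<dots> = 0"
    by (rule sum.neutral) (use orth metric_sym[OF w uT] in auto)
  finally show ?thesis .
qed

lemma orthonormal_fields_frame:
  assumes F: "orthonormal_fields U 4 F"
  shows "orthonormal_frame A g U (tangent_space A) 4 F"
  unfolding orthonormal_frame_def
proof (intro conjI allI impI ballI)
  show "F i \<in> sections A U (tangent_space A)" if "i < 4" for i
    using F that vector_field_tangent unfolding orthonormal_fields_def sections_def by blast
  fix q assume q: "q \<in> U"
  show "g q (F i q) (F j q) = (if i = j then 1 else 0)" if "i < 4" "j < 4" for i j
    using orthonormal_fields_orthonormal_at[OF F q] that unfolding orthonormal_at_def by blast
  obtain D \<phi> where D: "q \<in> D" and c: "compatible_chart A D \<phi>" by (rule chart_at)
  note basis = coordinate_fields_basis[OF c D]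
  have "(\<lambda>i. F i q) ` {..<4} \<subseteq> tangent_space A q"
    using orthonormal_fields_orthonormal_at[OF F q] unfolding orthonormal_at_def by auto
  then show "tangent_space A q = span ((\<lambda>i. F i q) ` {..<4})"
    using orthonormal_span[OF orthonormal_fields_orthonormal_at[OF F q], of "range (\<lambda>i. coordinate_field D \<phi> i q)"]
      basis by simp
qed

text \<open>The first two steps use generators of the foliation and stay vertical; the remaining two use
  coordinate fields and are orthogonal to the vertical vectors already found, hence horizontal.\<close>

lemma split_frame_exists:
  assumes V: "smooth_distribution A 2 \<V>" and N: "open N" "p \<in> N"
  obtains U X Y Z W where "open U" "p \<in> U" "U \<subseteq> N" "orthonormal_fields U 4 (frame_of X Y Z W)"
    and "X \<in> sections A U (orthogonal_complement A g \<V>)" "Y \<in> sections A U (orthogonal_complement A g \<V>)"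
    and "Z \<in> sections A U \<V>" "W \<in> sections A U \<V>"
proof -
  have "\<exists>U E. open U \<and> p \<in> U \<and> (\<forall>i<2. E i \<in> vector_fields A U) \<and>
      (\<forall>q\<in>U. \<V> q = span ((\<lambda>i. E i q) ` {..<2::nat}) \<and> dim (\<V> q) = 2)"
    using V unfolding smooth_distribution_def by (rule spec)
  then obtain U0 E where UE: "open U0 \<and> p \<in> U0 \<and> (\<forall>i<2. E i \<in> vector_fields A U0) \<and>
      (\<forall>q\<in>U0. \<V> q = span ((\<lambda>i. E i q) ` {..<2::nat}) \<and> dim (\<V> q) = 2)"
    by (elim exE)
  then have U0: "open U0" "p \<in> U0" and E: "\<And>i. i < 2 \<Longrightarrow> E i \<in> vector_fields A U0"
    and VE: "\<And>q. q \<in> U0 \<Longrightarrow> \<V> q = span ((\<lambda>i. E i q) ` {..<2}) \<and> dim (\<V> q) = 2"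
    by blast+
  obtain D \<phi> where D: "p \<in> D" and c: "compatible_chart A D \<phi>" by (rule chart_at)
  define U1 where "U1 = N \<inter> U0 \<inter> D"
  have U1: "open U1" "p \<in> U1" "U1 \<subseteq> U0" "U1 \<subseteq> N" "U1 \<subseteq> D"
    unfolding U1_def using N U0 D chart_open[OF c] by auto
  have EV: "E i \<in> vector_fields A S" if "S \<subseteq> U1" "i \<in> {..<2}" for i S
    using vector_field_subset[OF _ E] that U1(3) by auto
  have subV: "subspace (\<V> q)" if "q \<in> U1" for q using VE that U1(3) by auto
  have EinV: "E i q \<in> \<V> q" if "q \<in> U1" "i \<in> {..<2}" for q i
    using VE that U1(3) by (auto intro!: span_base)
  have dimE: "dim ((\<lambda>i. E i p) ` {..<2}) = 2"
    using VE[OF U0(2)] dim_span by metis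
  \<comment> \<open>the family of length 0 with which the Gram-Schmidt process starts\<close>
  define F0 :: "nat \<Rightarrow> 'a vector_field" where "F0 = (\<lambda>i p. 0)"
  have "orthonormal_fields U1 0 F0" by (simp add: orthonormal_fields_def orthonormal_at_def)
  then obtain U2 H0 where U2: "open U2" "p \<in> U2" "U2 \<subseteq> U1"
    and F1: "orthonormal_fields U2 (Suc 0) (F0(0 := H0))" and H0: "\<And>q. q \<in> U2 \<Longrightarrow> H0 q \<in> \<V> q"
    by (rule orthonormal_fields_extend[OF U1(1,2), of 0 F0 "{..<2}" E \<V>])
      (use EV[of U1] dimE subV EinV in auto)
  obtain U3 H1 where U3: "open U3" "p \<in> U3" "U3 \<subseteq> U2"
    and F2: "orthonormal_fields U3 (Suc (Suc 0)) (F0(0 := H0, Suc 0 := H1))"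
    and H1: "\<And>q. q \<in> U3 \<Longrightarrow> H1 q \<in> \<V> q"
    by (rule orthonormal_fields_extend[OF U2(1,2) F1, of "{..<2}" E \<V>])
      (use EV[of U2] dimE subV EinV H0 U2 in auto)
  have co: "coordinate_field D \<phi> i \<in> vector_fields A S" if "S \<subseteq> U1" for i S
    using vector_field_subset[OF _ coordinate_field_smooth[OF c]] that U1(5) by blast
  have coT: "coordinate_field D \<phi> i q \<in> tangent_space A q" if "q \<in> U1" for i q
    using coordinate_field_tangent[OF c] that U1(5) by blast
  have dimT: "dim ((\<lambda>i. coordinate_field D \<phi> i p) ` UNIV) = 4"
    using coordinate_fields_basis(2,3)[OF c D] by (simp add: dim_eq_card_independent)
  have F2T: "(F0(0 := H0, Suc 0 := H1)) i q \<in> tangent_space A q" if "q \<in> U3" "i < Suc (Suc 0)" for q i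
    using orthonormal_fields_orthonormal_at[OF F2 that(1)] that(2) unfolding orthonormal_at_def by blast
  obtain U4 H2 where U4: "open U4" "p \<in> U4" "U4 \<subseteq> U3"
    and F3: "orthonormal_fields U4 (Suc (Suc (Suc 0))) (F0(0 := H0, Suc 0 := H1, Suc (Suc 0) := H2))"
    and "\<And>q. q \<in> U4 \<Longrightarrow> H2 q \<in> tangent_space A q"
    by (rule orthonormal_fields_extend[OF U3(1,2) F2, of UNIV "coordinate_field D \<phi>" "tangent_space A"])
      (use co[of U3] dimT subspace_tangent_space U2 U3 coT F2T in auto)
  have U4_U1: "U4 \<subseteq> U1" using U4(3) U3(3) U2(3) by (meson order_trans)
  have F3T: "(F0(0 := H0, Suc 0 := H1, Suc (Suc 0) := H2)) i q \<in> tangent_space A q"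
    if "q \<in> U4" "i < Suc (Suc (Suc 0))" for q i
    using orthonormal_fields_orthonormal_at[OF F3 that(1)] that(2) unfolding orthonormal_at_def by blast
  obtain U H3 where U: "open U" "p \<in> U" "U \<subseteq> U4"
    and F4: "orthonormal_fields U (Suc (Suc (Suc (Suc 0))))
      (F0(0 := H0, Suc 0 := H1, Suc (Suc 0) := H2, Suc (Suc (Suc 0)) := H3))"
    and "\<And>q. q \<in> U \<Longrightarrow> H3 q \<in> tangent_space A q"
    by (rule orthonormal_fields_extend[OF U4(1,2) F3, of UNIV "coordinate_field D \<phi>" "tangent_space A"])
      (use co[of U4] dimT subspace_tangent_space U4_U1 coT F3T in auto)
  have sub: "U \<subseteq> U3" "U \<subseteq> U2" "U \<subseteq> N"
    using U(3) U4(3) U3(3) U2(3) U1(4) by (meson order_trans)+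
  let ?F = "F0(0 := H0, Suc 0 := H1, Suc (Suc 0) := H2, Suc (Suc (Suc 0)) := H3)"
  have F4': "orthonormal_fields U 4 ?F" using F4 by (simp add: numeral_eq_Suc)
  have fields: "H0 \<in> vector_fields A U" "H1 \<in> vector_fields A U" "H2 \<in> vector_fields A U" "H3 \<in> vector_fields A U"
    using F4' unfolding orthonormal_fields_def all_less_4 by (simp_all add: numeral_eq_Suc)
  have ON: "orthonormal_fields U 4 (frame_of H2 H3 H0 H1)"
    using F4' unfolding orthonormal_fields_def orthonormal_at_def all_less_4
    by (simp add: numeral_eq_Suc frame_of_def)
  have F2U: "orthonormal_fields U 2 (F0(0 := H0, Suc 0 := H1))"
    using orthonormal_fields_subset[OF _ F2] U U4 U3 by (simp add: numeral_eq_Suc)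
  have spanV: "\<V> q = span ((\<lambda>i. (F0(0 := H0, Suc 0 := H1)) i q) ` {..<2})" if q: "q \<in> U" for q
  proof -
    have q1: "q \<in> U1" "q \<in> U2" "q \<in> U3" using q U U4 U3 U2 by auto
    have V: "\<V> q = span ((\<lambda>i. E i q) ` {..<2})" using VE q1 U1 by blast
    have "(\<lambda>i. (F0(0 := H0, Suc 0 := H1)) i q) ` {..<2} \<subseteq> \<V> q"
      using H0 H1 q1 unfolding lessThan_2 by auto
    moreover have "card ((\<lambda>i. E i q) ` {..<2::nat}) \<le> 2"
      using card_image_le[of "{..<2::nat}" "\<lambda>i. E i q"] by simp
    ultimately show ?thesis
      unfolding V by (intro orthonormal_span[OF orthonormal_fields_orthonormal_at[OF F2U q], symmetric]) auto
  qed
  have orth: "g q (?F k q) (?F i q) = 0"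
    if "q \<in> U" "k \<in> {2, 3}" "i < 2" for q k i
  proof -
    have "k < 4" "i < 4" "k \<noteq> i" using that(2,3) by auto
    then show ?thesis
      using orthonormal_fields_orthonormal_at[OF F4' that(1)] unfolding orthonormal_at_def by presburger
  qed
  have H: "K \<in> sections A U (orthogonal_complement A g \<V>)"
    if K: "K \<in> vector_fields A U" "\<And>q i. q \<in> U \<Longrightarrow> i < 2 \<Longrightarrow> g q (K q) (?F i q) = 0" for K
    unfolding sections_def orthogonal_complement_def
  proof (intro CollectI conjI ballI K(1))
    fix q assume q: "q \<in> U"
    show KT: "K q \<in> tangent_space A q" by (rule vector_field_tangent[OF K(1) q])
    fix v assume v: "v \<in> \<V> q"
    show "g q (K q) v = 0"
    proof (rule orthonormal_orthogonal_span[OF orthonormal_fields_orthonormal_at[OF F2U q] KT])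
      show "g q (K q) ((F0(0 := H0, Suc 0 := H1)) i q) = 0" if i: "i < 2" for i
        using K(2)[OF q i] i by (auto simp: less_2_cases_iff)
      show "v \<in> span ((\<lambda>i. (F0(0 := H0, Suc 0 := H1)) i q) ` {..<2})"
        using v spanV[OF q] by (simp only:)
    qed
  qed
  have "H2 \<in> sections A U (orthogonal_complement A g \<V>)"
    by (rule H[OF fields(3)]) (use orth[of _ 2] in \<open>auto simp: numeral_eq_Suc\<close>)
  moreover have "H3 \<in> sections A U (orthogonal_complement A g \<V>)"
    by (rule H[OF fields(4)]) (use orth[of _ 3] in \<open>auto simp: numeral_eq_Suc\<close>)
  moreover have "H0 \<in> sections A U \<V>" "H1 \<in> sections A U \<V>"
    using fields(1,2) H0 H1 sub unfolding sections_def by auto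
  ultimately show thesis
    by (rule that[OF U(1,2) sub(3) ON])
qed

lemma orthonormal_frame_fields:
  assumes F: "orthonormal_frame A g U D n F"
  shows "orthonormal_fields U n F"
  unfolding orthonormal_fields_def orthonormal_at_def
proof (intro conjI allI impI ballI)
  show field: "F i \<in> vector_fields A U" if "i < n" for i
    using F that unfolding orthonormal_frame_def sections_def by blast
  fix q assume q: "q \<in> U"
  show "F i q \<in> tangent_space A q" if "i < n" for i
    by (rule vector_field_tangent[OF field[OF that] q])
  show "g q (F i q) (F j q) = (if i = j then 1 else 0)" if "i < n" "j < n" for i j
    using F that q unfolding orthonormal_frame_def by blast
qed


section \<open>Orientation of frames\<close>

text \<open>The chain rule for coordinates of tangent vectors.\<close>

lemma coordinates_change:
  assumes c: "compatible_chart A D \<phi>" and e: "compatible_chart A E \<psi>"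
    and q: "q \<in> D" "q \<in> E" and v: "v \<in> tangent_space A q"
    and tr: "((\<psi> \<circ> inv_into D \<phi>) has_derivative J) (at (\<phi> q))"
  shows "coordinates_in \<psi> v = matrix J *v coordinates_in \<phi> v"
proof -
  have near: "smooth_near A q (\<lambda>x. \<psi> x $ k)" for k
    using smooth_nearI[OF chart_open[OF e] q(2) smooth_fun_coordinate[OF e]] .
  have entry: "coordinate_field D \<phi> i q (\<lambda>x. \<psi> x $ k) = J (axis i 1) $ k" for i k
  proof -
    have "((\<lambda>x. \<psi> x $ k) \<circ> inv_into D \<phi> has_derivative (\<lambda>x. J x $ k)) (at (\<phi> q))"
      using bounded_linear.has_derivative[OF bounded_linear_vec_nth tr] by (simp add: o_def)
    then show ?thesis
      using near[of k] unfolding coordinate_field_def by (simp add: frechet_derivative_at[symmetric])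
  qed
  have expand: "v f = (\<Sum>i\<in>UNIV. v (\<lambda>q. \<phi> q $ i) * coordinate_field D \<phi> i q f)" for f
    by (subst tangent_in_coordinates[OF c q(1) v]) (simp only: sum_fun_apply scaleR_fun_def real_scaleR_def)
  have "v (\<lambda>x. \<psi> x $ k) = (\<Sum>i\<in>UNIV. v (\<lambda>q. \<phi> q $ i) * J (axis i 1) $ k)" for k
    by (subst expand) (simp only: entry)
  then show ?thesis
    by (simp add: vec_eq_iff coordinates_in_def matrix_vector_mult_def matrix_def mult.commute)
qed

text \<open>Expanding the coordinate fields in the frame yields an inverse of the matrix of coordinates of
  the frame.\<close>

lemma frame_coordinates_det_nonzero:
  assumes c: "compatible_chart A D \<phi>" and q: "q \<in> D"
    and F: "orthonormal_fields U 4 (frame_of X Y Z W)" and qU: "q \<in> U"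
  shows "det (vector [coordinates_in \<phi> (X q), coordinates_in \<phi> (Y q),
    coordinates_in \<phi> (Z q), coordinates_in \<phi> (W q)] :: real^4^4) \<noteq> 0"
proof -
  let ?R = "vector [coordinates_in \<phi> (X q), coordinates_in \<phi> (Y q),
    coordinates_in \<phi> (Z q), coordinates_in \<phi> (W q)] :: real^4^4"
  let ?d = "\<lambda>i. coordinate_field D \<phi> i q"
  \<comment> \<open>row \<open>i\<close> holds the components of the \<open>i\<close>-th coordinate field in the frame\<close>
  let ?S = "(\<chi> i. vector [g q (?d i) (X q), g q (?d i) (Y q), g q (?d i) (Z q), g q (?d i) (W q)]) :: real^4^4"
  have frame: "?d i = g q (?d i) (X q) *\<^sub>R X q + g q (?d i) (Y q) *\<^sub>R Y q
     + g q (?d i) (Z q) *\<^sub>R Z q + g q (?d i) (W q) *\<^sub>R W q" for i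
  proof -
    have "?d i \<in> span ((\<lambda>i. frame_of X Y Z W i q) ` {..<4})"
      using coordinate_field_tangent[OF c q] orthonormal_fields_frame[OF F] qU
      unfolding orthonormal_frame_def by blast
    from orthonormal_expansion[OF orthonormal_fields_orthonormal_at[OF F qU] this]
    show ?thesis by (simp add: lessThan_4 add.assoc)
  qed
  have frame_app: "?d i f = g q (?d i) (X q) * X q f + g q (?d i) (Y q) * Y q f
     + g q (?d i) (Z q) * Z q f + g q (?d i) (W q) * W q f" for i f
    using fun_cong[OF frame[of i], of f] by (simp only: plus_fun_apply scaleR_fun_def real_scaleR_def)
  have "(?S ** ?R) $ i $ m = ?d i (\<lambda>x. \<phi> x $ m)" for i m
    by (rule trans[OF _ frame_app[symmetric]])
      (simp add: matrix_matrix_mult_def sum_4 coordinates_in_def)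
  then have "?S ** ?R = mat 1"
    by (simp only: vec_eq_iff mat_def coordinate_field_coordinate[OF c q] vec_lambda_beta) simp
  then have "det ?S * det ?R = 1" by (simp only: det_mul[symmetric] det_I)
  then show ?thesis by auto
qed

text \<open>The matrices of coordinates in two charts of the orientation differ by a Jacobian matrix of
  positive determinant.\<close>

lemma positively_oriented_if_in_chart:
  assumes Or: "orientation A Or" and D: "(D, \<phi>) \<in> Or" "q \<in> D"
    and T: "x \<in> tangent_space A q" "y \<in> tangent_space A q" "z \<in> tangent_space A q" "w \<in> tangent_space A q"
    and pos: "det (vector [coordinates_in \<phi> x, coordinates_in \<phi> y,
      coordinates_in \<phi> z, coordinates_in \<phi> w] :: real^4^4) > 0"
  shows "positively_oriented Or q x y z w"
  unfolding positively_oriented_def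
proof (clarify)
  fix E \<psi> assume E: "(E, \<psi>) \<in> Or" "q \<in> E"
  have B: "smooth_atlas (A \<union> Or)" using Or unfolding orientation_def by blast
  have c: "compatible_chart A D \<phi>" and e: "compatible_chart A E \<psi>"
    using compatible_chart_of_larger_atlas[OF atlas B] D(1) E(1) by blast+
  let ?J = "frechet_derivative (\<psi> \<circ> inv_into D \<phi>) (at (\<phi> q))"
  have smooth: "smooth_on (\<phi> ` (D \<inter> E)) (\<psi> \<circ> inv_into D \<phi>)"
  proof -
    have "compatible_chart (A \<union> Or) D \<phi>" using compatible_chart_atlas[OF B] D(1) by blast
    then show ?thesis using chart_transition(1)[of "A \<union> Or" D \<phi> E \<psi>] E(1) by blast
  qed
  have tr: "((\<psi> \<circ> inv_into D \<phi>) has_derivative ?J) (at (\<phi> q))"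
    by (rule smooth_on_derivative[OF smooth]) (use D(2) E(2) in blast)
  have detJ: "det (matrix ?J) > 0"
  proof -
    have "\<forall>(D, \<phi>)\<in>Or. \<forall>(E, \<psi>)\<in>Or. \<forall>p\<in>D \<inter> E.
        det (matrix (frechet_derivative (\<psi> \<circ> inv_into D \<phi>) (at (\<phi> p)))) > 0"
      using Or unfolding orientation_def by blast
    from bspec[OF this D(1)] show ?thesis using E D(2) by blast
  qed
  note ch = coordinates_change[OF c e D(2) E(2) _ tr]
  have "(vector [coordinates_in \<psi> x, coordinates_in \<psi> y, coordinates_in \<psi> z, coordinates_in \<psi> w] :: real^4^4)
     = vector [coordinates_in \<phi> x, coordinates_in \<phi> y, coordinates_in \<phi> z, coordinates_in \<phi> w] ** transpose (matrix ?J)"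
    unfolding ch[OF T(1)] ch[OF T(2)] ch[OF T(3)] ch[OF T(4)]
    by (simp add: vec_eq_iff forall_4 matrix_matrix_mult_def matrix_vector_mult_def transpose_def mult.commute)
  then show "det (vector [coordinates_in \<psi> x, coordinates_in \<psi> y, coordinates_in \<psi> z, coordinates_in \<psi> w] :: real^4^4) > 0"
    using pos detJ by (simp add: det_mul)
qed

text \<open>A frame compatible with the splitting is oriented by changing the sign of \<open>W\<close> if necessary.
  Its sign in one chart is constant near \<open>p\<close> by continuity of the determinant.\<close>

lemma adapted_frame_exists:
  assumes V: "smooth_distribution A 2 \<V>" and Or: "orientation A Or" and N: "open N" "p \<in> N"
  obtains U X Y Z W where "open U" "p \<in> U" "U \<subseteq> N" "adapted_frame A Or g \<V> U X Y Z W"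
proof -
  obtain U X Y Z W where U: "open U" "p \<in> U" "U \<subseteq> N" and F: "orthonormal_fields U 4 (frame_of X Y Z W)"
    and H: "X \<in> sections A U (orthogonal_complement A g \<V>)" "Y \<in> sections A U (orthogonal_complement A g \<V>)"
    and VV: "Z \<in> sections A U \<V>" "W \<in> sections A U \<V>"
    by (rule split_frame_exists[OF V N])
  have "p \<in> (\<Union>(D, \<phi>)\<in>Or. D)" and B: "smooth_atlas (A \<union> Or)"
    using Or unfolding orientation_def by auto
  then obtain D \<phi> where D: "(D, \<phi>) \<in> Or" "p \<in> D" by auto
  have c: "compatible_chart A D \<phi>"
    using compatible_chart_of_larger_atlas[OF atlas B] D(1) by blast
  let ?det = "\<lambda>x y z w. det (vector [coordinates_in \<phi> x, coordinates_in \<phi> y,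
    coordinates_in \<phi> z, coordinates_in \<phi> w] :: real^4^4)"
  define \<sigma> :: real where "\<sigma> = sgn (?det (X p) (Y p) (Z p) (W p))"
  have \<sigma>: "\<sigma> = 1 \<or> \<sigma> = -1" "\<sigma> * ?det (X p) (Y p) (Z p) (W p) > 0"
    using frame_coordinates_det_nonzero[OF c D(2) F U(2)] unfolding \<sigma>_def by (auto simp: sgn_real_def)
  define W' where "W' q = \<sigma> *\<^sub>R W q" for q
  have detW: "?det x y z (\<sigma> *\<^sub>R w) = \<sigma> * ?det x y z w" for x y z w
  proof -
    let ?b = "\<lambda>i. (vector [coordinates_in \<phi> x, coordinates_in \<phi> y, coordinates_in \<phi> z, 0] :: real^4^4) $ i"
    have 1: "(vector [coordinates_in \<phi> x, coordinates_in \<phi> y, coordinates_in \<phi> z, coordinates_in \<phi> (\<sigma> *\<^sub>R w)] :: real^4^4)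
      = (\<chi> i. if i = 4 then \<sigma> *s coordinates_in \<phi> w else ?b i)"
      by (simp add: vec_eq_iff forall_4 coordinates_in_def scaleR_fun_def)
    have 2: "(vector [coordinates_in \<phi> x, coordinates_in \<phi> y, coordinates_in \<phi> z, coordinates_in \<phi> w] :: real^4^4)
      = (\<chi> i. if i = 4 then coordinates_in \<phi> w else ?b i)"
      by (simp add: vec_eq_iff forall_4)
    show ?thesis unfolding 1 2 by (rule det_row_mul)
  qed
  have fields: "X \<in> vector_fields A U" "Y \<in> vector_fields A U" "Z \<in> vector_fields A U" "W \<in> vector_fields A U"
    using F unfolding orthonormal_fields_def all_less_4 by simp_all
  have W': "W' \<in> vector_fields A U"
    unfolding W'_def by (rule vector_field_scale[OF smooth_fun_const[OF U(1)] fields(4)])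
  have subV: "subspace (\<V> q)" for q
    using V unfolding smooth_distribution_def by (metis subspace_span)
  have W'V: "W' \<in> sections A U \<V>"
    using W' VV(2) subspace_scale[OF subV] unfolding sections_def W'_def by auto
  have F': "orthonormal_fields U 4 (frame_of X Y Z W')"
    using F W' \<sigma>(1) fields vector_field_tangent[OF fields(1)] vector_field_tangent[OF fields(2)]
      vector_field_tangent[OF fields(3)] vector_field_tangent[OF fields(4)]
    unfolding orthonormal_fields_def orthonormal_at_def all_less_4
    by (auto simp: W'_def metric_neg_left metric_right tangent_closed)
  define d where "d q = ?det (X q) (Y q) (Z q) (W' q)" for q
  have cont: "continuous_on (U \<inter> D) d"
  proof -
    have "continuous_on (U \<inter> D) (\<lambda>q. K q (\<lambda>x. \<phi> x $ i))" if "K \<in> vector_fields A U" for K i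
    proof -
      have o: "open (U \<inter> D)" using U(1) chart_open[OF c] by blast
      show ?thesis
        by (rule smooth_fun_continuous[OF o vector_field_smooth[OF that o Int_lower1
          smooth_fun_subset[OF Int_lower2 smooth_fun_coordinate[OF c]]]])
    qed
    then have "continuous_on (U \<inter> D) (\<lambda>q. (vector [coordinates_in \<phi> (X q), coordinates_in \<phi> (Y q),
       coordinates_in \<phi> (Z q), coordinates_in \<phi> (W' q)] :: real^4^4) $ i $ j)" for i j
      using exhaust_4[of i] fields W' by (auto simp: coordinates_in_def)
    then show ?thesis
      unfolding d_def det_def
      by (intro continuous_on_sum continuous_on_mult continuous_on_prod continuous_on_const)
  qed
  have "open (U \<inter> D \<inter> d -` {0<..})"
    by (rule continuous_open_preimage[OF cont open_Int[OF U(1) chart_open[OF c]] open_greaterThan])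
  moreover have "d p > 0" unfolding d_def W'_def detW using \<sigma>(2) .
  moreover define S where "S = U \<inter> D \<inter> d -` {0<..}"
  ultimately have S: "open S" "p \<in> S" "S \<subseteq> U" "S \<subseteq> D" "\<And>q. q \<in> S \<Longrightarrow> d q > 0"
    using U(2) D(2) by auto
  have sec: "K \<in> sections A S Q" if "K \<in> sections A U Q" for K Q
    using that S(3) vector_field_subset[OF S(3)] unfolding sections_def by blast
  have "adapted_frame A Or g \<V> S X Y Z W'"
    unfolding adapted_frame_def
  proof (intro conjI ballI sec H VV W'V)
    show "orthonormal_frame A g S (tangent_space A) 4 (frame_of X Y Z W')"
      by (rule orthonormal_fields_frame[OF orthonormal_fields_subset[OF S(3) F']])
    fix q assume q: "q \<in> S"
    show "positively_oriented Or q (X q) (Y q) (Z q) (W' q)"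
      by (rule positively_oriented_if_in_chart[OF Or D(1)])
        (use q S fields W' vector_field_tangent in \<open>auto simp: d_def\<close>)
  qed
  then show thesis using that S U by blast
qed

end

section \<open>The Levi-Civita connection in orthonormal frames\<close>

locale levi_civita_manifold = riemannian_manifold A g
  for A :: "'a::{t2_space,second_countable_topology} chart set" and g +
  fixes nabla :: "'a connection"
  assumes levi_civita: "levi_civita A g nabla"
begin

context
  fixes U :: "'a set" assumes U: "open U"
begin

context
  fixes X Y assumes X: "X \<in> vector_fields A U" and Y: "Y \<in> vector_fields A U"
begin

lemmas connection_facts = levi_civita[unfolded levi_civita_def, THEN conjunct1, unfolded affine_connection_def,
    THEN spec, THEN mp, OF U, THEN bspec, OF X, THEN bspec, OF Y]

lemma nabla_field: "nabla X Y \<in> vector_fields A U"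
  by (rule connection_facts[THEN conjunct1])

lemma nabla_tangent: "p \<in> U \<Longrightarrow> nabla X Y p \<in> tangent_space A p"
  by (rule vector_field_tangent[OF nabla_field])

lemma nabla_cong:
  assumes "X' \<in> vector_fields A U" "Y' \<in> vector_fields A U" "\<And>q. q \<in> U \<Longrightarrow> X' q = X q"
    "\<And>q. q \<in> U \<Longrightarrow> Y' q = Y q" "p \<in> U"
  shows "nabla X' Y' p = nabla X Y p"
  using connection_facts[THEN conjunct2, THEN conjunct1, THEN bspec, OF assms(1), THEN bspec, OF assms(2)]
    assms(3-5) by simp

lemma nabla_add:
  assumes "Z \<in> vector_fields A U" "p \<in> U"
  shows "nabla (\<lambda>q. X q + Y q) Z p = nabla X Z p + nabla Y Z p"
    and "nabla Z (\<lambda>q. X q + Y q) p = nabla Z X p + nabla Z Y p"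
  using connection_facts[THEN conjunct2, THEN conjunct2, THEN conjunct1, THEN bspec, OF assms(1),
      THEN bspec, OF assms(2)] by simp_all

lemma nabla_scale:
  assumes "smooth_fun A U f" "p \<in> U"
  shows "nabla (\<lambda>q. f q *\<^sub>R X q) Y p = f p *\<^sub>R nabla X Y p"
    and "nabla X (\<lambda>q. f q *\<^sub>R Y q) p = X p f *\<^sub>R Y p + f p *\<^sub>R nabla X Y p"
  using connection_facts[THEN conjunct2, THEN conjunct2, THEN conjunct2, THEN spec, THEN mp,
      OF assms(1), THEN bspec, OF assms(2)] by simp_all

lemma nabla_scale_const:
  assumes p: "p \<in> U"
  shows "nabla X (\<lambda>q. c *\<^sub>R Y q) p = c *\<^sub>R nabla X Y p"
  using nabla_scale(2)[OF smooth_fun_const[OF U] p, of c]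
    tangent_const[OF vector_field_tangent[OF X p], of c] by simp

lemma torsion_free: "p \<in> U \<Longrightarrow> nabla X Y p - nabla Y X p = lie_bracket A X Y p"
  using levi_civita[unfolded levi_civita_def, THEN conjunct2, THEN spec, THEN mp, OF U, THEN conjunct1,
      THEN bspec, OF X, THEN bspec, OF Y] by simp

lemma nabla_metric:
  assumes "Z \<in> vector_fields A U" "p \<in> U"
  shows "X p (\<lambda>q. g q (Y q) (Z q)) = g p (nabla X Y p) (Z p) + g p (Y p) (nabla X Z p)"
  using levi_civita[unfolded levi_civita_def, THEN conjunct2, THEN spec, THEN mp, OF U, THEN conjunct2,
      THEN bspec, OF X, THEN bspec, OF Y, THEN bspec, OF assms(1)] assms(2) by simp

end

text \<open>Differentiate the constant \<open>g(Y, Z)\<close> along \<open>X\<close>.\<close>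

lemma nabla_antisym:
  assumes XYZ: "X \<in> vector_fields A U" "Y \<in> vector_fields A U" "Z \<in> vector_fields A U" and p: "p \<in> U"
    and const: "\<And>q. q \<in> U \<Longrightarrow> g q (Y q) (Z q) = c"
  shows "g p (nabla X Y p) (Z p) = - g p (nabla X Z p) (Y p)"
proof -
  have "g p (nabla X Y p) (Z p) + g p (Y p) (nabla X Z p) = 0"
    using nabla_metric[OF XYZ(1,2,3) p]
      tangent_locally_const[OF vector_field_tangent[OF XYZ(1) p] U p const] by simp
  moreover have "g p (Y p) (nabla X Z p) = g p (nabla X Z p) (Y p)"
    by (rule metric_sym[OF vector_field_tangent[OF XYZ(2) p] nabla_tangent[OF XYZ(1,3) p]])
  ultimately show ?thesis by simp
qed

end

end


section \<open>Frame independence of the divergence\<close>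

locale almost_hermitian_domain = levi_civita_manifold A g nabla
  for A :: "'a::{t2_space,second_countable_topology} chart set" and g nabla +
  fixes U :: "'a set" and J :: "'a endomorphism_field"
  assumes U: "open U" and almost_hermitian: "almost_hermitian A g U J"
begin

lemma J_tangent: "p \<in> U \<Longrightarrow> v \<in> tangent_space A p \<Longrightarrow> J p v \<in> tangent_space A p"
  and J_J: "p \<in> U \<Longrightarrow> v \<in> tangent_space A p \<Longrightarrow> J p (J p v) = - v"
  using almost_hermitian[unfolded almost_hermitian_def, THEN conjunct1] by simp_all

lemma J_lin: "p \<in> U \<Longrightarrow> v \<in> tangent_space A p \<Longrightarrow> w \<in> tangent_space A p \<Longrightarrow>
    J p (a *\<^sub>R v + b *\<^sub>R w) = a *\<^sub>R J p v + b *\<^sub>R J p w"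
  and J_isometry: "p \<in> U \<Longrightarrow> v \<in> tangent_space A p \<Longrightarrow> w \<in> tangent_space A p \<Longrightarrow>
    g p (J p v) (J p w) = g p v w"
  using almost_hermitian[unfolded almost_hermitian_def, THEN conjunct2, THEN conjunct1] by simp_all

lemma J_add: "p \<in> U \<Longrightarrow> v \<in> tangent_space A p \<Longrightarrow> w \<in> tangent_space A p \<Longrightarrow>
    J p (v + w) = J p v + J p w"
  using J_lin[of p v w 1 1] by simp

lemma J_scale: "p \<in> U \<Longrightarrow> v \<in> tangent_space A p \<Longrightarrow> J p (a *\<^sub>R v) = a *\<^sub>R J p v"
  using J_lin[of p v v a 0] by simp

lemma J_field: "X \<in> vector_fields A U \<Longrightarrow> (\<lambda>q. J q (X q)) \<in> vector_fields A U"
  using almost_hermitian[unfolded almost_hermitian_def, THEN conjunct2, THEN conjunct2,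
      THEN spec, THEN mp, OF U] by simp

lemma J_skew:
  assumes "p \<in> U" "v \<in> tangent_space A p" "w \<in> tangent_space A p"
  shows "g p (J p v) w = - g p v (J p w)"
  using J_isometry[OF assms(1) J_tangent[OF assms(1,2)] assms(3)] J_J[OF assms(1,2)]
    metric_neg_left[OF assms(2) J_tangent[OF assms(1,3)]] by simp

abbreviation DJ :: "'a vector_field \<Rightarrow> 'a vector_field \<Rightarrow> 'a \<Rightarrow> 'a tangent_vector" where
  "DJ \<equiv> covariant_derivative_endo nabla J"

context
  fixes X Y p assumes X: "X \<in> vector_fields A U" and Y: "Y \<in> vector_fields A U" and p: "p \<in> U"
begin

lemma DJ_cong:
  assumes "X' \<in> vector_fields A U" "Y' \<in> vector_fields A U" "\<And>q. q \<in> U \<Longrightarrow> X' q = X q"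
    "\<And>q. q \<in> U \<Longrightarrow> Y' q = Y q"
  shows "DJ X' Y' p = DJ X Y p"
  using nabla_cong[OF U X Y assms p] nabla_cong[OF U X J_field[OF Y] assms(1) J_field[OF assms(2)] assms(3) _ p]
    assms(4) unfolding covariant_derivative_endo_def by simp

lemma DJ_add:
  assumes Z: "Z \<in> vector_fields A U"
  shows "DJ (\<lambda>q. X q + Y q) Z p = DJ X Z p + DJ Y Z p"
    and "DJ Z (\<lambda>q. X q + Y q) p = DJ Z X p + DJ Z Y p"
proof -
  show "DJ (\<lambda>q. X q + Y q) Z p = DJ X Z p + DJ Y Z p"
    unfolding covariant_derivative_endo_def
    by (simp add: nabla_add(1)[OF U X Y] Z p J_field J_add nabla_tangent[OF U] X Y)
  have "nabla Z (\<lambda>q. J q (X q + Y q)) p = nabla Z (\<lambda>q. J q (X q) + J q (Y q)) p"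
    by (rule nabla_cong[OF U Z vector_field_add[OF J_field[OF X] J_field[OF Y]] Z
          J_field[OF vector_field_add[OF X Y]]])
      (auto simp: p J_add vector_field_tangent[OF X] vector_field_tangent[OF Y])
  then show "DJ Z (\<lambda>q. X q + Y q) p = DJ Z X p + DJ Z Y p"
    unfolding covariant_derivative_endo_def
    by (simp add: nabla_add(2)[OF U X Y] nabla_add(2)[OF U J_field[OF X] J_field[OF Y]]
        Z p J_field J_add nabla_tangent[OF U] X Y)
qed

text \<open>In the second equation the two terms that contain the derivative of \<open>f\<close> cancel,
  because \<open>J\<close> is linear on each tangent space.\<close>

lemma DJ_scale:
  assumes f: "smooth_fun A U f"
  shows "DJ (\<lambda>q. f q *\<^sub>R X q) Y p = f p *\<^sub>R DJ X Y p"
    and "DJ X (\<lambda>q. f q *\<^sub>R Y q) p = f p *\<^sub>R DJ X Y p"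
proof -
  show "DJ (\<lambda>q. f q *\<^sub>R X q) Y p = f p *\<^sub>R DJ X Y p"
    unfolding covariant_derivative_endo_def
    by (simp add: nabla_scale(1)[OF U X _ f p] p J_field J_scale nabla_tangent[OF U] X Y scaleR_diff_right)
  have "nabla X (\<lambda>q. J q (f q *\<^sub>R Y q)) p = nabla X (\<lambda>q. f q *\<^sub>R J q (Y q)) p"
    by (rule nabla_cong[OF U X vector_field_scale[OF f J_field[OF Y]] X
          J_field[OF vector_field_scale[OF f Y]]])
      (auto simp: p J_scale vector_field_tangent[OF Y])
  then show "DJ X (\<lambda>q. f q *\<^sub>R Y q) p = f p *\<^sub>R DJ X Y p"
    unfolding covariant_derivative_endo_def
    by (simp add: nabla_scale(2)[OF U X Y f p] nabla_scale(2)[OF U X J_field[OF Y] f p]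
        p J_scale J_add nabla_tangent[OF U] X Y tangent_closed vector_field_tangent[OF Y] scaleR_diff_right)
qed

end

lemma DJ_zero:
  assumes X: "X \<in> vector_fields A U" and p: "p \<in> U"
  shows "DJ (\<lambda>q. 0) X p = 0" "DJ X (\<lambda>q. 0) p = 0"
  using DJ_scale[OF X X p smooth_fun_const[OF U, of 0]] by simp_all

lemma DJ_sum:
  assumes X: "X \<in> vector_fields A U" and I: "finite I"
    and F: "\<And>i. i \<in> I \<Longrightarrow> F i \<in> vector_fields A U"
    and f: "\<And>i. i \<in> I \<Longrightarrow> smooth_fun A U (f i)" and p: "p \<in> U"
  shows "DJ (\<lambda>q. \<Sum>i\<in>I. f i q *\<^sub>R F i q) X p = (\<Sum>i\<in>I. f i p *\<^sub>R DJ (F i) X p)"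
    and "DJ X (\<lambda>q. \<Sum>i\<in>I. f i q *\<^sub>R F i q) p = (\<Sum>i\<in>I. f i p *\<^sub>R DJ X (F i) p)"
proof -
  define P where "P K \<longleftrightarrow> (\<lambda>q. \<Sum>i\<in>K. f i q *\<^sub>R F i q) \<in> vector_fields A U \<and>
     DJ (\<lambda>q. \<Sum>i\<in>K. f i q *\<^sub>R F i q) X p = (\<Sum>i\<in>K. f i p *\<^sub>R DJ (F i) X p) \<and>
     DJ X (\<lambda>q. \<Sum>i\<in>K. f i q *\<^sub>R F i q) p = (\<Sum>i\<in>K. f i p *\<^sub>R DJ X (F i) p)" for K
  have empty: "P {}"
    unfolding P_def by (simp add: DJ_zero[OF X p] vector_field_sum[OF U, of "{}", simplified])
  have step: "P (insert j K)" if K: "finite K" "j \<notin> K" "P K" and j: "j \<in> I" for j K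
  proof -
    let ?S = "\<lambda>q. \<Sum>i\<in>K. f i q *\<^sub>R F i q"
    have S: "?S \<in> vector_fields A U"
      and IH: "DJ ?S X p = (\<Sum>i\<in>K. f i p *\<^sub>R DJ (F i) X p)" "DJ X ?S p = (\<Sum>i\<in>K. f i p *\<^sub>R DJ X (F i) p)"
      by (fact K(3)[unfolded P_def, THEN conjunct1], fact K(3)[unfolded P_def, THEN conjunct2, THEN conjunct1],
        fact K(3)[unfolded P_def, THEN conjunct2, THEN conjunct2])
    have eq: "(\<lambda>q. \<Sum>i\<in>insert j K. f i q *\<^sub>R F i q) = (\<lambda>q. f j q *\<^sub>R F j q + ?S q)"
      by (simp only: sum.insert[OF K(1,2)])
    note fF = vector_field_scale[OF f[OF j] F[OF j]]
    show ?thesis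
      unfolding P_def eq sum.insert[OF K(1,2)] IH[symmetric]
        DJ_add(1)[OF fF S p X] DJ_scale(1)[OF F[OF j] X p f[OF j]]
        DJ_add(2)[OF fF S p X] DJ_scale(2)[OF X F[OF j] p f[OF j]]
      by (intro conjI refl vector_field_add fF S)
  qed
  have "P I"
    using I subset_refl by (rule finite_subset_induct) (use empty step in blast)+
  note P_I = this[unfolded P_def, THEN conjunct2]
  show "DJ (\<lambda>q. \<Sum>i\<in>I. f i q *\<^sub>R F i q) X p = (\<Sum>i\<in>I. f i p *\<^sub>R DJ (F i) X p)"
    and "DJ X (\<lambda>q. \<Sum>i\<in>I. f i q *\<^sub>R F i q) p = (\<Sum>i\<in>I. f i p *\<^sub>R DJ X (F i) p)"
    by (fact P_I[THEN conjunct1], fact P_I[THEN conjunct2])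
qed

text \<open>The divergence is the trace of a bilinear form: passing between two orthonormal frames
  multiplies by an orthogonal matrix, whose columns are orthonormal by Parseval's identity.\<close>

lemma divergence_frame_independent:
  assumes E: "orthonormal_fields U 4 E" and F: "orthonormal_fields U 4 F" and p: "p \<in> U"
  shows "(\<Sum>k<4. DJ (E k) (E k) p) = (\<Sum>k<4. DJ (F k) (F k) p)"
proof -
  have EV: "E k \<in> vector_fields A U" and FV: "F k \<in> vector_fields A U" if "k < 4" for k
    using E F that unfolding orthonormal_fields_def by blast+
  let ?a = "\<lambda>k i q. g q (E k q) (F i q)"
  let ?E = "\<lambda>k q. \<Sum>i<4. ?a k i q *\<^sub>R F i q"
  have a: "smooth_fun A U (?a k i)" if "k < 4" "i < 4" for k i
    by (rule metric_smooth[OF U EV[OF that(1)] FV[OF that(2)]])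
  have Eeq: "?E k q = E k q" if "k < 4" "q \<in> U" for k q
  proof -
    have "E k q \<in> span ((\<lambda>i. F i q) ` {..<4})"
      using vector_field_tangent[OF EV[OF that(1)] that(2)] orthonormal_fields_frame[OF F] that(2)
      unfolding orthonormal_frame_def by blast
    from orthonormal_expansion[OF orthonormal_fields_orthonormal_at[OF F that(2)] this]
    show ?thesis by (rule sym)
  qed
  have EF: "?E k \<in> vector_fields A U" if "k < 4" for k
    using that a FV by (intro vector_field_sum vector_field_scale U) auto
  have "DJ (E k) (E k) p = (\<Sum>i<4. \<Sum>j<4. (?a k i p * ?a k j p) *\<^sub>R DJ (F i) (F j) p)" if k: "k < 4" for k
  proof -
    have "DJ (E k) (E k) p = DJ (?E k) (?E k) p"
      by (rule DJ_cong[OF EF[OF k] EF[OF k] p EV[OF k] EV[OF k]]) (use Eeq[OF k] in auto)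
    also have "\<dots> = (\<Sum>i<4. ?a k i p *\<^sub>R DJ (F i) (?E k) p)"
      by (rule DJ_sum(1)[OF EF[OF k] finite_lessThan _ _ p]) (use FV a k in auto)
    also have "\<dots> = (\<Sum>i<4. ?a k i p *\<^sub>R (\<Sum>j<4. ?a k j p *\<^sub>R DJ (F i) (F j) p))"
    proof (rule sum.cong[OF refl])
      fix i :: nat assume "i \<in> {..<4}"
      then have i: "i < 4" by simp
      have "DJ (F i) (?E k) p = (\<Sum>j<4. ?a k j p *\<^sub>R DJ (F i) (F j) p)"
        by (rule DJ_sum(2)[OF FV[OF i] finite_lessThan _ _ p]) (use FV a k in auto)
      then show "?a k i p *\<^sub>R DJ (F i) (?E k) p = ?a k i p *\<^sub>R (\<Sum>j<4. ?a k j p *\<^sub>R DJ (F i) (F j) p)"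
        by (simp only:)
    qed
    finally show ?thesis by (simp only: scaleR_sum_right scaleR_scaleR)
  qed
  then have "(\<Sum>k<4. DJ (E k) (E k) p) =
      (\<Sum>k<4. \<Sum>i<4. \<Sum>j<4. (?a k i p * ?a k j p) *\<^sub>R DJ (F i) (F j) p)"
    by (intro sum.cong) auto
  also have "\<dots> = (\<Sum>i<4. \<Sum>k<4. \<Sum>j<4. (?a k i p * ?a k j p) *\<^sub>R DJ (F i) (F j) p)"
    by (rule sum.swap)
  also have "\<dots> = (\<Sum>i<4. \<Sum>j<4. \<Sum>k<4. (?a k i p * ?a k j p) *\<^sub>R DJ (F i) (F j) p)"
    by (rule sum.cong[OF refl], rule sum.swap)
  also have "\<dots> = (\<Sum>i<4. \<Sum>j<4. (if i = j then 1 else 0) *\<^sub>R DJ (F i) (F j) p)"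
  proof (intro sum.cong[OF refl])
    fix i j :: nat assume "i \<in> {..<4}" "j \<in> {..<4}"
    then have ij: "i < 4" "j < 4" by auto
    have "F i p \<in> span ((\<lambda>k. E k p) ` {..<4})"
      using vector_field_tangent[OF FV[OF ij(1)] p] orthonormal_fields_frame[OF E] p
      unfolding orthonormal_frame_def by blast
    from orthonormal_Parseval[OF orthonormal_fields_orthonormal_at[OF E p] this vector_field_tangent[OF FV[OF ij(2)] p]]
    have "g p (F i p) (F j p) = (\<Sum>k<4. g p (F i p) (E k p) * ?a k j p)" .
    also have "\<dots> = (\<Sum>k<4. ?a k i p * ?a k j p)"
      using metric_sym[OF vector_field_tangent[OF FV[OF ij(1)] p] vector_field_tangent[OF EV p]]
      by (intro sum.cong) auto
    finally have "(\<Sum>k<4. ?a k i p * ?a k j p) = (if i = j then 1 else 0)"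
      using orthonormal_fields_orthonormal_at[OF F p] ij unfolding orthonormal_at_def by simp
    then show "(\<Sum>k<4. (?a k i p * ?a k j p) *\<^sub>R DJ (F i) (F j) p) = (if i = j then 1 else 0) *\<^sub>R DJ (F i) (F j) p"
      by (simp only: scaleR_sum_left[symmetric])
  qed
  also have "\<dots> = (\<Sum>i<4. DJ (F i) (F i) p)"
    by (intro sum.cong[OF refl]) (simp add: if_distrib[of "\<lambda>c. c *\<^sub>R _"] cong: if_cong)
  finally show ?thesis .
qed

end

section \<open>Geometry of the splitting in an adapted frame\<close>

context riemannian_manifold
begin

text \<open>Positive definiteness makes the projection unique, so any admissible \<open>v\<close> is the vector that its
  definition describes.\<close>

lemma orthogonal_projection_inner:
  assumes D: "subspace (D p)" "D p \<subseteq> tangent_space A p"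
    and v: "v \<in> D p" "u - v \<in> orthogonal_complement A g D p"
    and u: "u \<in> tangent_space A p" and w: "w \<in> D p"
  shows "orthogonal_projection A g D p u \<in> D p" "g p (orthogonal_projection A g D p u) w = g p u w"
proof -
  have "orthogonal_projection A g D p u = v"
    unfolding orthogonal_projection_def
  proof (rule the_equality)
    show "v \<in> D p \<and> u - v \<in> orthogonal_complement A g D p" using v by blast
    fix x assume x: "x \<in> D p \<and> u - x \<in> orthogonal_complement A g D p"
    have xv: "x - v \<in> D p" using subspace_diff[OF D(1)] x v(1) by blast
    have "g p (x - v) (x - v) = g p ((u - v) - (u - x)) (x - v)" by simp
    also have "\<dots> = g p (u - v) (x - v) - g p (u - x) (x - v)"
      by (rule metric_diff_left) (use v(2) x xv D(2) in \<open>auto simp: orthogonal_complement_def\<close>)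
    also have "\<dots> = 0" using v(2) x xv by (simp add: orthogonal_complement_def)
    finally have "x - v = 0" using metric_pos[of "x - v" p] xv D(2) by force
    then show "x = v" by simp
  qed
  moreover have "g p (u - v) w = g p u w - g p v w"
    by (rule metric_diff_left) (use u v(1) w D(2) in auto)
  moreover have "g p (u - v) w = 0" using v(2) w by (simp add: orthogonal_complement_def)
  ultimately show "orthogonal_projection A g D p u \<in> D p" "g p (orthogonal_projection A g D p u) w = g p u w"
    using v(1) by simp_all
qed

end

locale adapted_frame_domain = levi_civita_manifold A g nabla
  for A :: "'a::{t2_space,second_countable_topology} chart set" and g nabla +
  fixes Or :: "'a chart set" and \<V> :: "'a distribution" and U :: "'a set"
    and X Y Z W :: "'a vector_field"
  assumes distribution: "smooth_distribution A 2 \<V>" and U: "open U"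
    and adapted: "adapted_frame A Or g \<V> U X Y Z W"
begin

abbreviation \<H> :: "'a distribution" where "\<H> \<equiv> orthogonal_complement A g \<V>"

lemma frame: "orthonormal_fields U 4 (frame_of X Y Z W)"
  using adapted orthonormal_frame_fields unfolding adapted_frame_def by blast

lemma frame_fields: "X \<in> vector_fields A U" "Y \<in> vector_fields A U" "Z \<in> vector_fields A U" "W \<in> vector_fields A U"
  using frame unfolding orthonormal_fields_def all_less_4 by simp_all

lemma frame_sections: "X \<in> sections A U \<H>" "Y \<in> sections A U \<H>" "Z \<in> sections A U \<V>" "W \<in> sections A U \<V>"
  using adapted unfolding adapted_frame_def by simp_all

lemma frame_tangent:
  "p \<in> U \<Longrightarrow> X p \<in> tangent_space A p" "p \<in> U \<Longrightarrow> Y p \<in> tangent_space A p"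
  "p \<in> U \<Longrightarrow> Z p \<in> tangent_space A p" "p \<in> U \<Longrightarrow> W p \<in> tangent_space A p"
  using frame_fields vector_field_tangent by blast+

lemma frame_inner:
  assumes "p \<in> U"
  shows "g p (X p) (X p) = 1" "g p (X p) (Y p) = 0" "g p (X p) (Z p) = 0" "g p (X p) (W p) = 0"
    "g p (Y p) (X p) = 0" "g p (Y p) (Y p) = 1" "g p (Y p) (Z p) = 0" "g p (Y p) (W p) = 0"
    "g p (Z p) (X p) = 0" "g p (Z p) (Y p) = 0" "g p (Z p) (Z p) = 1" "g p (Z p) (W p) = 0"
    "g p (W p) (X p) = 0" "g p (W p) (Y p) = 0" "g p (W p) (Z p) = 0" "g p (W p) (W p) = 1"
  using orthonormal_fields_orthonormal_at[OF frame assms]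
  unfolding orthonormal_at_def all_less_4 by simp_all

lemma frame_expansion:
  assumes p: "p \<in> U" and v: "v \<in> tangent_space A p"
  shows "v = g p v (X p) *\<^sub>R X p + g p v (Y p) *\<^sub>R Y p + g p v (Z p) *\<^sub>R Z p + g p v (W p) *\<^sub>R W p"
proof -
  have "v \<in> span ((\<lambda>i. frame_of X Y Z W i p) ` {..<4})"
    using v orthonormal_fields_frame[OF frame] p unfolding orthonormal_frame_def by blast
  from orthonormal_expansion[OF orthonormal_fields_orthonormal_at[OF frame p] this]
  show ?thesis by (simp add: lessThan_4 add.assoc)
qed

lemma frame_Parseval:
  assumes p: "p \<in> U" and v: "v \<in> tangent_space A p" and w: "w \<in> tangent_space A p"
  shows "g p v w = g p v (X p) * g p w (X p) + g p v (Y p) * g p w (Y p)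
    + g p v (Z p) * g p w (Z p) + g p v (W p) * g p w (W p)"
proof -
  note T = frame_tangent[OF p]
  have "g p v w = g p (g p v (X p) *\<^sub>R X p + g p v (Y p) *\<^sub>R Y p + g p v (Z p) *\<^sub>R Z p + g p v (W p) *\<^sub>R W p) w"
    using frame_expansion[OF p v] by (rule arg_cong)
  then show ?thesis
    by (simp add: metric_left tangent_closed T w metric_sym[OF T(1) w] metric_sym[OF T(2) w]
        metric_sym[OF T(3) w] metric_sym[OF T(4) w])
qed

lemma vertical_subspace: "subspace (\<V> p)"
  using distribution unfolding smooth_distribution_def by (metis subspace_span)

lemma vertical_frame: "orthonormal_fields U 2 (\<lambda>i. [Z, W] ! i)"
  unfolding orthonormal_fields_def orthonormal_at_def all_less_2
  using frame_fields frame_tangent frame_inner by simp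

text \<open>The foliation has two generators near each point, and \<open>Z\<close> and \<open>W\<close> are orthonormal.\<close>

lemma vertical_span:
  assumes p: "p \<in> U"
  shows "\<V> p = span ((\<lambda>i. ([Z, W] ! i) p) ` {..<2})"
proof -
  obtain E where E: "\<V> p = span ((\<lambda>i. E i p) ` {..<2::nat})"
    using distribution unfolding smooth_distribution_def by meson
  have "(\<lambda>i. ([Z, W] ! i) p) ` {..<2} \<subseteq> \<V> p"
    using frame_sections(3,4) p unfolding sections_def lessThan_2 by auto
  moreover have "card ((\<lambda>i. E i p) ` {..<2::nat}) \<le> 2"
    using card_image_le[of "{..<2::nat}" "\<lambda>i. E i p"] by simp
  ultimately show ?thesis
    unfolding E by (intro orthonormal_span[OF orthonormal_fields_orthonormal_at[OF vertical_frame p], symmetric]) auto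
qed

lemma vertical_tangent: "p \<in> U \<Longrightarrow> \<V> p \<subseteq> tangent_space A p"
  unfolding vertical_span by (rule span_minimal[OF _ subspace_tangent_space])
    (auto simp: lessThan_2 frame_tangent)

lemma vertical_orthonormal_frame: "orthonormal_frame A g U \<V> 2 (\<lambda>i. [Z, W] ! i)"
  unfolding orthonormal_frame_def all_less_2
  using frame_sections(3,4) frame_inner vertical_span by simp

lemma horizontal_iff:
  assumes p: "p \<in> U" and v: "v \<in> tangent_space A p"
  shows "v \<in> \<H> p \<longleftrightarrow> g p v (Z p) = 0 \<and> g p v (W p) = 0"
proof
  assume "v \<in> \<H> p"
  moreover have "Z p \<in> \<V> p" "W p \<in> \<V> p" using frame_sections(3,4) p unfolding sections_def by auto
  ultimately show "g p v (Z p) = 0 \<and> g p v (W p) = 0" unfolding orthogonal_complement_def by blast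
next
  assume "g p v (Z p) = 0 \<and> g p v (W p) = 0"
  then have 0: "g p v (([Z, W] ! i) p) = 0" if "i < 2" for i using that by (auto simp: less_2_cases_iff)
  have "g p v w = 0" if "w \<in> \<V> p" for w
    by (rule orthonormal_orthogonal_span[OF orthonormal_fields_orthonormal_at[OF vertical_frame p] v 0])
      (use that vertical_span[OF p] in simp_all)
  then show "v \<in> \<H> p" unfolding orthogonal_complement_def using v by blast
qed

lemma vertical_orthogonal:
  assumes p: "p \<in> U" and v: "v \<in> \<V> p"
  shows "g p v (X p) = 0" "g p v (Y p) = 0"
proof -
  have "X p \<in> \<H> p" "Y p \<in> \<H> p" using frame_sections(1,2) p unfolding sections_def by auto
  then have "g p (X p) v = 0" "g p (Y p) v = 0" using v unfolding orthogonal_complement_def by auto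
  then show "g p v (X p) = 0" "g p v (Y p) = 0"
    using metric_sym[of v p] vertical_tangent[OF p] v frame_tangent[OF p] by auto
qed

lemma horizontal_subspace: "subspace (\<H> p)" if "p \<in> U"
proof (rule subspaceI)
  have VT: "v \<in> \<V> p \<Longrightarrow> v \<in> tangent_space A p" for v using vertical_tangent[OF that] by blast
  show "0 \<in> \<H> p"
    unfolding orthogonal_complement_def using VT by (simp add: tangent_closed metric_left)
  show "x + y \<in> \<H> p" if "x \<in> \<H> p" "y \<in> \<H> p" for x y
    using that unfolding orthogonal_complement_def using VT by (simp add: tangent_closed metric_left)
  show "c *\<^sub>R x \<in> \<H> p" if "x \<in> \<H> p" for x c
    using that unfolding orthogonal_complement_def using VT by (simp add: tangent_closed metric_left)
qed

lemma projection_inner: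
  assumes p: "p \<in> U" and u: "u \<in> tangent_space A p"
  shows "w \<in> \<V> p \<Longrightarrow> g p (orthogonal_projection A g \<V> p u) w = g p u w"
    and "w \<in> \<H> p \<Longrightarrow> g p (orthogonal_projection A g \<H> p u) w = g p u w"
    and "orthogonal_projection A g \<V> p u \<in> tangent_space A p"
    and "orthogonal_projection A g \<H> p u \<in> tangent_space A p"
proof -
  let ?v = "g p u (Z p) *\<^sub>R Z p + g p u (W p) *\<^sub>R W p"
  note T = frame_tangent[OF p]
  have ZW: "Z p \<in> \<V> p" "W p \<in> \<V> p" using frame_sections(3,4) p unfolding sections_def by auto
  have v: "?v \<in> \<V> p"
    by (intro subspace_add[OF vertical_subspace] subspace_scale[OF vertical_subspace] ZW)
  have vT: "?v \<in> tangent_space A p" using v vertical_tangent[OF p] by blast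
  have uv: "u - ?v \<in> \<H> p"
    by (subst horizontal_iff[OF p])
      (simp_all add: tangent_closed metric_left T u vT frame_inner[OF p])
  have HT: "\<H> p \<subseteq> tangent_space A p" unfolding orthogonal_complement_def by blast
  have VHH: "?v \<in> orthogonal_complement A g \<H> p"
    unfolding orthogonal_complement_def[of A g \<H>]
  proof (intro CollectI conjI ballI vT)
    fix h assume h: "h \<in> \<H> p"
    then have "g p h ?v = 0" using v unfolding orthogonal_complement_def by blast
    then show "g p ?v h = 0" using metric_sym[OF vT] h HT by auto
  qed
  note V = orthogonal_projection_inner[of \<V> p ?v u, OF vertical_subspace vertical_tangent[OF p] v uv u]
  have uVHH: "u - (u - ?v) \<in> orthogonal_complement A g \<H> p" using VHH by simp
  note H = orthogonal_projection_inner[of \<H> p "u - ?v" u, OF horizontal_subspace[OF p] HT uv uVHH u]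
  show "w \<in> \<V> p \<Longrightarrow> g p (orthogonal_projection A g \<V> p u) w = g p u w" by (rule V(2))
  show "w \<in> \<H> p \<Longrightarrow> g p (orthogonal_projection A g \<H> p u) w = g p u w" by (rule H(2))
  show "orthogonal_projection A g \<V> p u \<in> tangent_space A p"
    using V(1)[OF v] vertical_tangent[OF p] by blast
  show "orthogonal_projection A g \<H> p u \<in> tangent_space A p"
    using H(1)[OF uv] HT by blast
qed

lemma second_fundamental_form_inner:
  assumes p: "p \<in> U" and KL: "K \<in> vector_fields A U" "L \<in> vector_fields A U"
  shows "w \<in> \<V> p \<Longrightarrow> g p (second_fundamental_form A g nabla \<V> K L p) w =
      (g p (nabla K L p) w + g p (nabla L K p) w) / 2"
    and "w \<in> \<H> p \<Longrightarrow> g p (second_fundamental_form A g nabla \<H> K L p) w =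
      (g p (nabla K L p) w + g p (nabla L K p) w) / 2"
    and "second_fundamental_form A g nabla \<H> K L p \<in> tangent_space A p"
proof -
  note T = nabla_tangent[OF U KL p] nabla_tangent[OF U KL(2,1) p]
  have s: "nabla K L p + nabla L K p \<in> tangent_space A p" using T by (simp add: tangent_closed)
  have HT: "\<H> p \<subseteq> tangent_space A p" unfolding orthogonal_complement_def by blast
  note P = projection_inner[OF p s]
  show "g p (second_fundamental_form A g nabla \<V> K L p) w =
      (g p (nabla K L p) w + g p (nabla L K p) w) / 2" if w: "w \<in> \<V> p"
  proof -
    have wT: "w \<in> tangent_space A p" using w vertical_tangent[OF p] by blast
    show ?thesis
      unfolding second_fundamental_form_def metric_scale_left[OF P(3) wT] P(1)[OF w]
        metric_add_left[OF T wT] by simp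
  qed
  show "g p (second_fundamental_form A g nabla \<H> K L p) w =
      (g p (nabla K L p) w + g p (nabla L K p) w) / 2" if w: "w \<in> \<H> p"
  proof -
    have wT: "w \<in> tangent_space A p" using w HT by blast
    show ?thesis
      unfolding second_fundamental_form_def metric_scale_left[OF P(4) wT] P(2)[OF w]
        metric_add_left[OF T wT] by simp
  qed
  show "second_fundamental_form A g nabla \<H> K L p \<in> tangent_space A p"
    unfolding second_fundamental_form_def by (rule tangent_closed(3)[OF P(4)])
qed

text \<open>The coefficients of the connection with respect to the frame.\<close>

abbreviation \<Gamma> :: "'a \<Rightarrow> 'a vector_field \<Rightarrow> 'a vector_field \<Rightarrow> 'a vector_field \<Rightarrow> real" where
  "\<Gamma> p K L M \<equiv> g p (nabla K L p) (M p)"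

lemma frame_in_distributions:
  "p \<in> U \<Longrightarrow> X p \<in> \<H> p" "p \<in> U \<Longrightarrow> Y p \<in> \<H> p" "p \<in> U \<Longrightarrow> Z p \<in> \<V> p" "p \<in> U \<Longrightarrow> W p \<in> \<V> p"
  using frame_sections unfolding sections_def by auto

lemma \<Gamma>_antisym:
  assumes p: "p \<in> U" and K: "K \<in> vector_fields A U" and L: "L \<in> {X, Y, Z, W}" and M: "M \<in> {X, Y, Z, W}"
  shows "\<Gamma> p K L M = - \<Gamma> p K M L"
proof -
  have LM: "L \<in> vector_fields A U" "M \<in> vector_fields A U" using L M frame_fields by auto
  have "\<exists>c. \<forall>q\<in>U. g q (L q) (M q) = c"
    using L M by (elim insertE emptyE) (simp_all add: frame_inner)
  then obtain c where "\<forall>q\<in>U. g q (L q) (M q) = c" ..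
  then show ?thesis by (intro nabla_antisym[OF U K LM p, of c]) simp
qed

lemma vertical_brackets:
  assumes inv: "involutive A \<V>" and p: "p \<in> U"
  shows "\<Gamma> p Z W X = \<Gamma> p W Z X" "\<Gamma> p Z W Y = \<Gamma> p W Z Y"
proof -
  note T = nabla_tangent[OF U frame_fields(3,4) p] nabla_tangent[OF U frame_fields(4,3) p] frame_tangent[OF p]
  have "lie_bracket A Z W p \<in> \<V> p"
    using inv U frame_sections(3,4) p unfolding involutive_def by blast
  then have "nabla Z W p - nabla W Z p \<in> \<V> p"
    by (simp only: torsion_free[OF U frame_fields(3,4) p])
  from vertical_orthogonal[OF p this] show "\<Gamma> p Z W X = \<Gamma> p W Z X" "\<Gamma> p Z W Y = \<Gamma> p W Z Y"
    by (simp_all add: metric_diff_left T)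
qed

lemma horizontal_brackets:
  assumes inv: "involutive A \<H>" and p: "p \<in> U"
  shows "\<Gamma> p X Y Z = \<Gamma> p Y X Z" "\<Gamma> p X Y W = \<Gamma> p Y X W"
proof -
  note T = nabla_tangent[OF U frame_fields(1,2) p] nabla_tangent[OF U frame_fields(2,1) p] frame_tangent[OF p]
  have "lie_bracket A X Y p \<in> \<H> p"
    using inv U frame_sections(1,2) p unfolding involutive_def by blast
  then have "nabla X Y p - nabla Y X p \<in> \<H> p"
    by (simp only: torsion_free[OF U frame_fields(1,2) p])
  then show "\<Gamma> p X Y Z = \<Gamma> p Y X Z" "\<Gamma> p X Y W = \<Gamma> p Y X W"
    by (simp_all add: horizontal_iff[OF p] metric_diff_left T tangent_closed)
qed

lemma vertical_trace:
  assumes min: "minimal_foliation A g nabla \<V>" and p: "p \<in> U"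
  shows "\<Gamma> p Z Z X + \<Gamma> p W W X = 0" "\<Gamma> p Z Z Y + \<Gamma> p W W Y = 0"
proof -
  let ?B = "\<lambda>K. second_fundamental_form A g nabla \<H> K K p"
  have "(\<Sum>i<2. ?B ([Z, W] ! i)) = 0"
    using min[unfolded minimal_foliation_def, THEN spec, THEN spec, THEN mp, OF U, THEN mp,
        OF vertical_orthonormal_frame] p by blast
  then have 0: "?B Z + ?B W = 0" by (simp add: lessThan_2)
  note B = second_fundamental_form_inner(2,3)[OF p frame_fields(3,3)]
    second_fundamental_form_inner(2,3)[OF p frame_fields(4,4)]
  have "g p (?B Z + ?B W) (X p) = \<Gamma> p Z Z X + \<Gamma> p W W X"
    by (simp add: metric_add_left B frame_tangent[OF p] frame_in_distributions[OF p])
  then show "\<Gamma> p Z Z X + \<Gamma> p W W X = 0"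
    unfolding 0 by (simp add: metric_zero_left frame_tangent[OF p])
  have "g p (?B Z + ?B W) (Y p) = \<Gamma> p Z Z Y + \<Gamma> p W W Y"
    by (simp add: metric_add_left B frame_tangent[OF p] frame_in_distributions[OF p])
  then show "\<Gamma> p Z Z Y + \<Gamma> p W W Y = 0"
    unfolding 0 by (simp add: metric_zero_left frame_tangent[OF p])
qed

lemma horizontal_second_fundamental_form:
  assumes conf: "conformal_foliation_with A g nabla \<V> \<xi>" and p: "p \<in> U" and M: "M = Z \<or> M = W"
  shows "\<Gamma> p X X M = g p (\<xi> p) (M p)" "\<Gamma> p Y Y M = g p (\<xi> p) (M p)" "\<Gamma> p X Y M + \<Gamma> p Y X M = 0"
proof -
  have B: "second_fundamental_form A g nabla \<V> K L p = g p (K p) (L p) *\<^sub>R \<xi> p"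
    if "K \<in> sections A U \<H>" "L \<in> sections A U \<H>" for K L
    using conf[unfolded conformal_foliation_with_def, THEN spec, THEN mp, OF U, THEN bspec, OF that(1),
        THEN bspec, OF that(2)] p by blast
  have Mp: "M p \<in> \<V> p" "M p \<in> tangent_space A p"
    using M frame_in_distributions[OF p] frame_tangent[OF p] by auto
  show "\<Gamma> p X X M = g p (\<xi> p) (M p)"
    using second_fundamental_form_inner(1)[OF p frame_fields(1,1) Mp(1)] B[OF frame_sections(1,1)]
      frame_inner[OF p] by simp
  show "\<Gamma> p Y Y M = g p (\<xi> p) (M p)"
    using second_fundamental_form_inner(1)[OF p frame_fields(2,2) Mp(1)] B[OF frame_sections(2,2)]
      frame_inner[OF p] by simp
  show "\<Gamma> p X Y M + \<Gamma> p Y X M = 0"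
    using second_fundamental_form_inner(1)[OF p frame_fields(1,2) Mp(1)] B[OF frame_sections(1,2)]
      frame_inner[OF p] metric_zero_left[OF Mp(2)] by simp
qed


section \<open>The divergence of an adapted structure\<close>

text \<open>Compare inner products with the four fields of the frame. Since \<open>J\<close> is skew, a field \<open>K\<close> with
  \<open>J K = c L\<close> contributes \<open>c \<Gamma>(K, L, M) + g(\<nabla>\<^sub>K K, J M)\<close> to the inner product with \<open>M\<close>, and all
  coefficients that occur are governed by skew-symmetry, minimality, involutivity or conformality.\<close>

lemma divergence_in_adapted_frame:
  assumes min: "minimal_foliation A g nabla \<V>" and inv: "involutive A \<V>"
    and conf: "conformal_foliation_with A g nabla \<V> \<xi>"
    and J: "almost_hermitian A g U J"
    and JX: "\<And>q. q \<in> U \<Longrightarrow> J q (X q) = Y q" and JY: "\<And>q. q \<in> U \<Longrightarrow> J q (Y q) = - X q"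
    and JZ: "\<And>q. q \<in> U \<Longrightarrow> J q (Z q) = \<epsilon> *\<^sub>R W q" and JW: "\<And>q. q \<in> U \<Longrightarrow> J q (W q) = - (\<epsilon> *\<^sub>R Z q)"
    and p: "p \<in> U"
  shows "(\<Sum>k<4. covariant_derivative_endo nabla J (frame_of X Y Z W k) (frame_of X Y Z W k) p) =
    (\<Gamma> p X Y Z - \<Gamma> p Y X Z + 2 * \<epsilon> * g p (\<xi> p) (W p)) *\<^sub>R Z p +
    (\<Gamma> p X Y W - \<Gamma> p Y X W - 2 * \<epsilon> * g p (\<xi> p) (Z p)) *\<^sub>R W p"
proof -
  interpret almost_hermitian_domain A g nabla U J
    by unfold_locales (rule U, rule J)
  note T = frame_tangent[OF p]
  note n = nabla_tangent[OF U _ _ p]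
  \<comment> \<open>the contribution of one field to the divergence\<close>
  define d where "d K = DJ K K p" for K
  have dT: "d K \<in> tangent_space A p" if "K \<in> vector_fields A U" for K
    unfolding d_def covariant_derivative_endo_def
    using that by (intro tangent_closed n J_field J_tangent p)
  have d: "g p (d K) (M p) = c * \<Gamma> p K L M + g p (nabla K K p) (J p (M p))"
    if K: "K \<in> vector_fields A U" and L: "L \<in> vector_fields A U" and M: "M \<in> vector_fields A U"
      and JK: "\<And>q. q \<in> U \<Longrightarrow> J q (K q) = c *\<^sub>R L q" for K L M c
  proof -
    note MT = vector_field_tangent[OF M p]
    have "nabla K (\<lambda>q. J q (K q)) p = nabla K (\<lambda>q. c *\<^sub>R L q) p"
      by (rule nabla_cong[OF U K vector_field_scale[OF smooth_fun_const[OF U] L] K J_field[OF K]])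
        (use JK p in auto)
    then have "d K = c *\<^sub>R nabla K L p - J p (nabla K K p)"
      unfolding d_def covariant_derivative_endo_def by (simp add: nabla_scale_const[OF U K L p])
    then show ?thesis
      by (simp add: metric_left tangent_closed n K L MT J_tangent p J_skew)
  qed
  note f = frame_fields
  have JX': "J q (X q) = 1 *\<^sub>R Y q" and JY': "J q (Y q) = (-1) *\<^sub>R X q" and JW': "J q (W q) = (-\<epsilon>) *\<^sub>R Z q"
    if "q \<in> U" for q using JX[OF that] JY[OF that] JW[OF that] by simp_all
  note dX = d[OF f(1) f(2) _ JX'] and dY = d[OF f(2) f(1) _ JY']
    and dZ = d[OF f(3) f(4) _ JZ] and dW = d[OF f(4) f(3) _ JW']
  note dd = dX dY dZ dW
  have \<Gamma>J: "g p (nabla K K p) (J p (X p)) = \<Gamma> p K K Y" "g p (nabla K K p) (J p (Y p)) = - \<Gamma> p K K X"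
    "g p (nabla K K p) (J p (Z p)) = \<epsilon> * \<Gamma> p K K W" "g p (nabla K K p) (J p (W p)) = - (\<epsilon> * \<Gamma> p K K Z)"
    if K: "K \<in> vector_fields A U" for K
    using JX[OF p] JY[OF p] JZ[OF p] JW[OF p]
    by (simp_all add: metric_right n K T tangent_closed)
  have skew: "\<Gamma> p K L L = 0" if "K \<in> vector_fields A U" "L \<in> {X, Y, Z, W}" for K L
    using \<Gamma>_antisym[OF p that that(2)] by simp
  note conf_Z = horizontal_second_fundamental_form[OF conf p disjI1[OF refl]]
    and conf_W = horizontal_second_fundamental_form[OF conf p disjI2[OF refl]]
  note trace = vertical_trace[OF min p] and brackets = vertical_brackets[OF inv p]
  let ?\<delta> = "d X + d Y + d Z + d W"
  have \<delta>T: "?\<delta> \<in> tangent_space A p" by (intro tangent_closed dT f)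
  have split: "g p ?\<delta> (M p) = g p (d X) (M p) + g p (d Y) (M p) + g p (d Z) (M p) + g p (d W) (M p)"
    if "M \<in> vector_fields A U" for M
    by (simp add: metric_left tangent_closed dT f vector_field_tangent[OF that p])
  have "g p ?\<delta> (X p) = 0"
    using skew[OF f(2), of X] skew[OF f(2), of Y] \<Gamma>_antisym[OF p f(1), of X Y] trace(2) brackets(1)
    by (simp add: split f dd \<Gamma>J)
  moreover have "g p ?\<delta> (Y p) = 0"
    using skew[OF f(1), of X] skew[OF f(1), of Y] \<Gamma>_antisym[OF p f(2), of X Y] trace(1) brackets(2)
    by (simp add: split f dd \<Gamma>J)
  moreover have "g p ?\<delta> (Z p) = \<Gamma> p X Y Z - \<Gamma> p Y X Z + 2 * \<epsilon> * g p (\<xi> p) (W p)"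
    using skew[OF f(4), of Z] skew[OF f(4), of W] \<Gamma>_antisym[OF p f(3), of W Z] conf_W(1,2)
    by (simp add: split f dd \<Gamma>J)
  moreover have "g p ?\<delta> (W p) = \<Gamma> p X Y W - \<Gamma> p Y X W - 2 * \<epsilon> * g p (\<xi> p) (Z p)"
    using skew[OF f(3), of Z] skew[OF f(3), of W] \<Gamma>_antisym[OF p f(4), of Z W] conf_Z(1,2)
    by (simp add: split f dd \<Gamma>J)
  moreover have "(\<Sum>k<4. DJ (frame_of X Y Z W k) (frame_of X Y Z W k) p) = ?\<delta>"
    by (simp add: lessThan_4 d_def add.assoc)
  ultimately show ?thesis
    using frame_expansion[OF p \<delta>T] by simp
qed

text \<open>The first adapted structure for \<open>\<epsilon> = 1\<close>, the second for \<open>\<epsilon> = -1\<close>. It is written as a sum of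
  multiples, with signs in the coefficients, to match the closure properties of vector fields.\<close>

definition frame_structure :: "real \<Rightarrow> 'a endomorphism_field" where
  "frame_structure \<epsilon> q v = g q v (X q) *\<^sub>R Y q + (- g q v (Y q)) *\<^sub>R X q
     + (\<epsilon> * g q v (Z q)) *\<^sub>R W q + (- (\<epsilon> * g q v (W q))) *\<^sub>R Z q"

lemma frame_structure_frame:
  assumes "q \<in> U"
  shows "frame_structure \<epsilon> q (X q) = Y q" "frame_structure \<epsilon> q (Y q) = - X q"
    and "frame_structure \<epsilon> q (Z q) = \<epsilon> *\<^sub>R W q" "frame_structure \<epsilon> q (W q) = - (\<epsilon> *\<^sub>R Z q)"
  by (simp_all add: frame_structure_def frame_inner[OF assms])

lemma frame_structure_almost_hermitian:
  assumes \<epsilon>: "\<epsilon> * \<epsilon> = 1"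
  shows "almost_hermitian A g U (frame_structure \<epsilon>)"
proof -
  let ?J = "frame_structure \<epsilon>"
  have JT: "?J p v \<in> tangent_space A p" if "p \<in> U" for p v
    unfolding frame_structure_def by (intro tangent_closed(2,3) frame_tangent that)
  have inner: "g p (?J p v) (X p) = - g p v (Y p)" "g p (?J p v) (Y p) = g p v (X p)"
    "g p (?J p v) (Z p) = - (\<epsilon> * g p v (W p))" "g p (?J p v) (W p) = \<epsilon> * g p v (Z p)" if "p \<in> U" for p v
    unfolding frame_structure_def
    by (simp_all add: metric_left tangent_closed frame_tangent[OF that] frame_inner[OF that])
  have \<epsilon>': "\<epsilon> * (\<epsilon> * c) = c" for c using \<epsilon> by (simp add: mult.assoc[symmetric])
  show "almost_hermitian A g U ?J"
    unfolding almost_hermitian_def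
  proof (intro conjI ballI allI impI)
    fix p v assume p: "p \<in> U" and v: "v \<in> tangent_space A p"
    show "?J p v \<in> tangent_space A p" by (rule JT[OF p])
    have "?J p (?J p v) = - (g p v (X p) *\<^sub>R X p + g p v (Y p) *\<^sub>R Y p + g p v (Z p) *\<^sub>R Z p + g p v (W p) *\<^sub>R W p)"
      unfolding frame_structure_def[of _ _ "frame_structure \<epsilon> p v"] inner[OF p] by (simp add: \<epsilon>')
    then show "?J p (?J p v) = - v" using frame_expansion[OF p v] by simp
    fix w assume w: "w \<in> tangent_space A p"
    show "?J p (a *\<^sub>R v + b *\<^sub>R w) = a *\<^sub>R ?J p v + b *\<^sub>R ?J p w" for a b
      unfolding frame_structure_def
      by (simp add: metric_lin v w frame_tangent[OF p] algebra_simps)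
    show "g p (?J p v) (?J p w) = g p v w"
      unfolding frame_Parseval[OF p JT[OF p] JT[OF p]] frame_Parseval[OF p v w] inner[OF p]
      using \<epsilon> by (simp add: algebra_simps \<epsilon>')
  next
    fix S K assume S: "open S" "S \<subseteq> U" and K: "K \<in> vector_fields A S"
    note f = frame_fields[THEN vector_field_subset[OF S(2)]]
    have "smooth_fun A S (\<lambda>q. (-1) * g q (K q) (Y q))" "smooth_fun A S (\<lambda>q. (-1) * (\<epsilon> * g q (K q) (W q)))"
      by (intro smooth_fun_mult smooth_fun_const metric_smooth S K f)+
    then show "(\<lambda>p. ?J p (K p)) \<in> vector_fields A S"
      unfolding frame_structure_def
      by (intro vector_field_add vector_field_scale f smooth_fun_mult smooth_fun_const metric_smooth S K) simp_all
  qed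
qed

text \<open>\<open>Z\<close> and \<open>W\<close> are independent, so both coefficients of the divergence vanish.\<close>

lemma cosymplectic_coefficients:
  assumes min: "minimal_foliation A g nabla \<V>" and inv: "involutive A \<V>"
    and conf: "conformal_foliation_with A g nabla \<V> \<xi>"
    and J: "almost_hermitian A g U J"
    and JF: "\<And>q. q \<in> U \<Longrightarrow> J q (X q) = Y q" "\<And>q. q \<in> U \<Longrightarrow> J q (Y q) = - X q"
      "\<And>q. q \<in> U \<Longrightarrow> J q (Z q) = \<epsilon> *\<^sub>R W q" "\<And>q. q \<in> U \<Longrightarrow> J q (W q) = - (\<epsilon> *\<^sub>R Z q)"
    and cos: "cosymplectic A g nabla U J" and p: "p \<in> U"
  shows "\<Gamma> p X Y Z - \<Gamma> p Y X Z + 2 * \<epsilon> * g p (\<xi> p) (W p) = 0"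
    and "\<Gamma> p X Y W - \<Gamma> p Y X W - 2 * \<epsilon> * g p (\<xi> p) (Z p) = 0"
proof -
  have "(\<Sum>k<4. covariant_derivative_endo nabla J (frame_of X Y Z W k) (frame_of X Y Z W k) p) = 0"
    using cos[unfolded cosymplectic_def, THEN spec, THEN spec, THEN mp, OF U, THEN mp, OF subset_refl,
        THEN mp, OF orthonormal_fields_frame[OF frame]] p by blast
  then have 0: "(\<Gamma> p X Y Z - \<Gamma> p Y X Z + 2 * \<epsilon> * g p (\<xi> p) (W p)) *\<^sub>R Z p +
    (\<Gamma> p X Y W - \<Gamma> p Y X W - 2 * \<epsilon> * g p (\<xi> p) (Z p)) *\<^sub>R W p = 0"
    by (simp only: divergence_in_adapted_frame[OF min inv conf J JF p])
  have coeff: "a = 0 \<and> b = 0" if "a *\<^sub>R Z p + b *\<^sub>R W p = 0" for a b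
  proof -
    have "g p (a *\<^sub>R Z p + b *\<^sub>R W p) (Z p) = a" "g p (a *\<^sub>R Z p + b *\<^sub>R W p) (W p) = b"
      using frame_tangent[OF p] frame_inner[OF p] by (simp_all add: metric_lin)
    then show ?thesis unfolding that using frame_tangent[OF p] by (simp add: metric_zero_left)
  qed
  from coeff[OF 0] show "\<Gamma> p X Y Z - \<Gamma> p Y X Z + 2 * \<epsilon> * g p (\<xi> p) (W p) = 0"
    and "\<Gamma> p X Y W - \<Gamma> p Y X W - 2 * \<epsilon> * g p (\<xi> p) (Z p) = 0" by blast+
qed

text \<open>Adding and subtracting the equations for \<open>\<epsilon> = 1\<close> and \<open>\<epsilon> = -1\<close> separates the vertical part of the
  bracket, the skew part of \<open>\<Gamma>(X, Y, _)\<close>, from \<open>\<xi>\<close>. The symmetric part of \<open>\<Gamma>(X, Y, _)\<close> is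
  zero by conformality, since \<open>X\<close> and \<open>Y\<close> are orthogonal.\<close>

lemma both_cosymplectic:
  assumes min: "minimal_foliation A g nabla \<V>" and inv: "involutive A \<V>"
    and conf: "conformal_foliation_with A g nabla \<V> \<xi>" and \<xi>: "\<xi> p \<in> \<V> p"
    and cos1: "\<And>J. adapted_structure_1 A Or g \<V> U J \<Longrightarrow> cosymplectic A g nabla U J"
    and cos2: "\<And>J. adapted_structure_2 A Or g \<V> U J \<Longrightarrow> cosymplectic A g nabla U J"
    and p: "p \<in> U"
  shows "\<xi> p = 0"
    and "M = Z \<or> M = W \<Longrightarrow> \<Gamma> p X X M = 0 \<and> \<Gamma> p Y Y M = 0 \<and> \<Gamma> p X Y M = 0 \<and> \<Gamma> p Y X M = 0"
proof -
  let ?J = "frame_structure"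
  note J = frame_structure_almost_hermitian frame_structure_frame
  have "adapted_structure_1 A Or g \<V> U (?J 1)"
    unfolding adapted_structure_1_def
  proof (intro conjI ballI)
    show "almost_hermitian A g U (?J 1)" by (rule J(1)) simp
    fix x assume x: "x \<in> U"
    have "\<forall>q\<in>U. ?J 1 q (X q) = Y q \<and> ?J 1 q (Y q) = - X q \<and> ?J 1 q (Z q) = W q \<and> ?J 1 q (W q) = - Z q"
      by (simp add: J(2-5))
    then show "\<exists>S X Y Z W. open S \<and> x \<in> S \<and> S \<subseteq> U \<and> adapted_frame A Or g \<V> S X Y Z W \<and>
        (\<forall>q\<in>S. ?J 1 q (X q) = Y q \<and> ?J 1 q (Y q) = - X q \<and> ?J 1 q (Z q) = W q \<and> ?J 1 q (W q) = - Z q)"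
      by (intro exI[of _ U] exI[of _ X] exI[of _ Y] exI[of _ Z] exI[of _ W] conjI U x subset_refl adapted)
  qed
  from cosymplectic_coefficients[OF min inv conf J(1) J(2-5) cos1[OF this] p]
  have 1: "\<Gamma> p X Y Z - \<Gamma> p Y X Z + 2 * 1 * g p (\<xi> p) (W p) = 0"
    "\<Gamma> p X Y W - \<Gamma> p Y X W - 2 * 1 * g p (\<xi> p) (Z p) = 0" by simp_all
  have "adapted_structure_2 A Or g \<V> U (?J (-1))"
    unfolding adapted_structure_2_def
  proof (intro conjI ballI)
    show "almost_hermitian A g U (?J (-1))" by (rule J(1)) simp
    fix x assume x: "x \<in> U"
    have "\<forall>q\<in>U. ?J (-1) q (X q) = Y q \<and> ?J (-1) q (Y q) = - X q \<and> ?J (-1) q (Z q) = - W q \<and> ?J (-1) q (W q) = Z q"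
      by (simp add: J(2-5))
    then show "\<exists>S X Y Z W. open S \<and> x \<in> S \<and> S \<subseteq> U \<and> adapted_frame A Or g \<V> S X Y Z W \<and>
        (\<forall>q\<in>S. ?J (-1) q (X q) = Y q \<and> ?J (-1) q (Y q) = - X q \<and> ?J (-1) q (Z q) = - W q \<and> ?J (-1) q (W q) = Z q)"
      by (intro exI[of _ U] exI[of _ X] exI[of _ Y] exI[of _ Z] exI[of _ W] conjI U x subset_refl adapted)
  qed
  from cosymplectic_coefficients[OF min inv conf J(1) J(2-5) cos2[OF this] p]
  have 2: "\<Gamma> p X Y Z - \<Gamma> p Y X Z + 2 * (-1) * g p (\<xi> p) (W p) = 0"
    "\<Gamma> p X Y W - \<Gamma> p Y X W - 2 * (-1) * g p (\<xi> p) (Z p) = 0" by simp_all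
  have \<xi>0: "g p (\<xi> p) (Z p) = 0" "g p (\<xi> p) (W p) = 0"
    and b: "\<Gamma> p X Y Z = \<Gamma> p Y X Z" "\<Gamma> p X Y W = \<Gamma> p Y X W"
    using 1 2 by linarith+
  have "\<xi> p \<in> tangent_space A p" using \<xi> vertical_tangent[OF p] by blast
  from frame_expansion[OF p this] show "\<xi> p = 0"
    by (simp add: \<xi>0 vertical_orthogonal[OF p \<xi>])
  show "\<Gamma> p X X M = 0 \<and> \<Gamma> p Y Y M = 0 \<and> \<Gamma> p X Y M = 0 \<and> \<Gamma> p Y X M = 0" if M: "M = Z \<or> M = W"
  proof -
    have "g p (\<xi> p) (M p) = 0" "\<Gamma> p X Y M = \<Gamma> p Y X M" using M \<xi>0 b by auto
    then show ?thesis using horizontal_second_fundamental_form[OF conf p M] by simp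
  qed
qed

text \<open>The inner product equals \<open>- g(\<nabla>\<^sub>K M, L)\<close>, which is linear over functions in \<open>K\<close> and \<open>L\<close>. So
  coefficients for the frame suffice, although the coefficients of \<open>K\<close> and \<open>L\<close> in it vary.\<close>

lemma horizontal_derivative:
  assumes p: "p \<in> U" and M: "M = Z \<or> M = W"
    and 0: "\<Gamma> p X X M = 0 \<and> \<Gamma> p Y Y M = 0 \<and> \<Gamma> p X Y M = 0 \<and> \<Gamma> p Y X M = 0"
    and K: "K \<in> sections A U \<H>" and L: "L \<in> sections A U \<H>"
  shows "g p (nabla K L p) (M p) = 0"
proof -
  have KF: "K \<in> vector_fields A U" and LF: "L \<in> vector_fields A U" and MF: "M \<in> vector_fields A U"
    using K L M frame_fields unfolding sections_def by auto
  have KH: "K q \<in> \<H> q" and LH: "L q \<in> \<H> q" and MV: "M q \<in> \<V> q" if "q \<in> U" for q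
    using K L M frame_in_distributions that unfolding sections_def by auto
  have expand: "v = g q v (X q) *\<^sub>R X q + g q v (Y q) *\<^sub>R Y q" if q: "q \<in> U" and v: "v \<in> \<H> q" for q v
  proof -
    have vT: "v \<in> tangent_space A q" using v unfolding orthogonal_complement_def by blast
    show ?thesis using frame_expansion[OF q vT] horizontal_iff[OF q vT] v by simp
  qed
  let ?k = "\<lambda>q. g q (K q) (X q)" and ?l = "\<lambda>q. g q (K q) (Y q)"
  have kl: "smooth_fun A U ?k" "smooth_fun A U ?l" by (intro metric_smooth U KF frame_fields)+
  note kX = vector_field_scale[OF kl(1) frame_fields(1)] and lY = vector_field_scale[OF kl(2) frame_fields(2)]
  have "nabla K M p = nabla (\<lambda>q. ?k q *\<^sub>R X q + ?l q *\<^sub>R Y q) M p"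
    by (rule nabla_cong[OF U vector_field_add[OF kX lY] MF KF MF _ _ p])
      (use expand KH in auto)
  also have "\<dots> = ?k p *\<^sub>R nabla X M p + ?l p *\<^sub>R nabla Y M p"
    by (simp add: nabla_add(1)[OF U kX lY MF p] nabla_scale(1)[OF U frame_fields(1) MF kl(1) p]
        nabla_scale(1)[OF U frame_fields(2) MF kl(2) p])
  finally have KM: "nabla K M p = ?k p *\<^sub>R nabla X M p + ?l p *\<^sub>R nabla Y M p" .
  note n = nabla_tangent[OF U frame_fields(1) MF p] nabla_tangent[OF U frame_fields(2) MF p]
  have \<Gamma>0: "\<Gamma> p X M X = 0" "\<Gamma> p X M Y = 0" "\<Gamma> p Y M X = 0" "\<Gamma> p Y M Y = 0"
    using 0 M \<Gamma>_antisym[OF p frame_fields(1), of M X] \<Gamma>_antisym[OF p frame_fields(1), of M Y]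
      \<Gamma>_antisym[OF p frame_fields(2), of M X] \<Gamma>_antisym[OF p frame_fields(2), of M Y] by auto
  have "g p (nabla K M p) (L p) = g p (nabla K M p) (g p (L p) (X p) *\<^sub>R X p + g p (L p) (Y p) *\<^sub>R Y p)"
    using expand[OF p LH[OF p]] by (rule arg_cong)
  also have "\<dots> = 0"
    unfolding KM by (simp add: metric_left metric_right tangent_closed n frame_tangent[OF p] \<Gamma>0)
  finally have "g p (nabla K M p) (L p) = 0" .
  moreover have "g q (L q) (M q) = 0" if "q \<in> U" for q
    using LH[OF that] MV[OF that] unfolding orthogonal_complement_def by blast
  ultimately show ?thesis
    using nabla_antisym[OF U KF LF MF p] by simp
qed

end


section \<open>Characterisation of cosymplectic adapted structures\<close>

context levi_civita_manifold
begin

lemma sections_subset: "S \<subseteq> U \<Longrightarrow> K \<in> sections A U D \<Longrightarrow> K \<in> sections A S D"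
  unfolding sections_def using vector_field_subset by blast

lemma adapted_frame_subset:
  assumes S: "S \<subseteq> U" and F: "adapted_frame A Or g \<V> U X Y Z W"
  shows "adapted_frame A Or g \<V> S X Y Z W"
  unfolding adapted_frame_def
proof (intro conjI ballI)
  show "orthonormal_frame A g S (tangent_space A) 4 (frame_of X Y Z W)"
    using F unfolding adapted_frame_def
    by (intro orthonormal_fields_frame orthonormal_fields_subset[OF S] orthonormal_frame_fields) blast
qed (use F S in \<open>auto simp: adapted_frame_def intro: sections_subset[OF S]\<close>)

lemma almost_hermitian_subset:
  assumes S: "S \<subseteq> U" and J: "almost_hermitian A g U J"
  shows "almost_hermitian A g S J"
  unfolding almost_hermitian_def
proof (intro conjI)
  note J' = J[unfolded almost_hermitian_def]
  show "\<forall>p\<in>S. \<forall>v\<in>tangent_space A p. J p v \<in> tangent_space A p \<and> J p (J p v) = - v"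
    by (rule ballI, rule bspec[OF J'[THEN conjunct1]], rule subsetD[OF S])
  show "\<forall>p\<in>S. \<forall>v\<in>tangent_space A p. \<forall>w\<in>tangent_space A p.
      (\<forall>a b. J p (a *\<^sub>R v + b *\<^sub>R w) = a *\<^sub>R J p v + b *\<^sub>R J p w) \<and> g p (J p v) (J p w) = g p v w"
    by (rule ballI, rule bspec[OF J'[THEN conjunct2, THEN conjunct1]], rule subsetD[OF S])
  show "\<forall>T. open T \<longrightarrow> T \<subseteq> S \<longrightarrow> (\<forall>X\<in>vector_fields A T. (\<lambda>p. J p (X p)) \<in> vector_fields A T)"
    using J'[THEN conjunct2, THEN conjunct2] order_trans[OF _ S] by simp
qed

text \<open>Passing to the adapted frame by frame independence leaves \<open>\<V> [X, Y] - 2 J \<xi>\<close>, and both terms are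
  zero.\<close>

lemma cosymplectic_if_riemannian_integrable:
  assumes V: "smooth_distribution A 2 \<V>" "involutive A \<V>" "minimal_foliation A g nabla \<V>"
    and riem: "riemannian_foliation A g nabla \<V>"
    and H: "involutive A (orthogonal_complement A g \<V>)"
    and J: "almost_hermitian A g U J"
    and JF: "\<forall>p\<in>U. \<exists>S X Y Z W. open S \<and> p \<in> S \<and> S \<subseteq> U \<and> adapted_frame A Or g \<V> S X Y Z W \<and>
        (\<forall>q\<in>S. J q (X q) = Y q \<and> J q (Y q) = - X q \<and> J q (Z q) = \<epsilon> *\<^sub>R W q \<and> J q (W q) = - (\<epsilon> *\<^sub>R Z q))"
  shows "cosymplectic A g nabla U J"
  unfolding cosymplectic_def
proof (intro allI impI ballI)
  fix S E p assume S: "open S" "S \<subseteq> U" and E: "orthonormal_frame A g S (tangent_space A) 4 E" and p: "p \<in> S"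
  from p S(2) have "p \<in> U" by blast
  from bspec[OF JF this] obtain N X Y Z W where N: "open N" "p \<in> N" "N \<subseteq> U" and F: "adapted_frame A Or g \<V> N X Y Z W"
    and JN: "\<forall>q\<in>N. J q (X q) = Y q \<and> J q (Y q) = - X q \<and> J q (Z q) = \<epsilon> *\<^sub>R W q \<and> J q (W q) = - (\<epsilon> *\<^sub>R Z q)"
    by (elim exE conjE) (rule that)
  let ?T = "S \<inter> N"
  have T: "open ?T" "p \<in> ?T" using S(1) N(1,2) p by auto
  interpret F: adapted_frame_domain A g nabla Or \<V> ?T X Y Z W
    by unfold_locales (rule V(1), rule T(1), rule adapted_frame_subset[OF Int_lower2 F])
  have JT: "almost_hermitian A g ?T J"
    by (rule almost_hermitian_subset[OF _ J]) (use S(2) in blast)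
  interpret J: almost_hermitian_domain A g nabla ?T J
    by unfold_locales (rule T(1), rule JT)
  have "(\<Sum>k<4. J.DJ (E k) (E k) p) = (\<Sum>k<4. J.DJ (frame_of X Y Z W k) (frame_of X Y Z W k) p)"
    by (rule J.divergence_frame_independent[OF orthonormal_fields_subset[OF Int_lower1 orthonormal_frame_fields[OF E]]
          F.frame T(2)])
  also have "\<dots> = (F.\<Gamma> p X Y Z - F.\<Gamma> p Y X Z + 2 * \<epsilon> * g p 0 (W p)) *\<^sub>R Z p +
    (F.\<Gamma> p X Y W - F.\<Gamma> p Y X W - 2 * \<epsilon> * g p 0 (Z p)) *\<^sub>R W p"
    by (rule F.divergence_in_adapted_frame[OF V(3,2) riem[unfolded riemannian_foliation_def] JT _ _ _ _ T(2)])
      (use JN in auto)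
  also have "\<dots> = 0"
    using F.horizontal_brackets[OF H T(2)] F.frame_tangent[OF T(2)] by (simp add: metric_zero_left)
  finally show "(\<Sum>k<4. J.DJ (E k) (E k) p) = 0" .
qed

text \<open>Near every point, apply the pointwise conclusions to the structures built from an adapted frame.
  For integrability, not only the bracket of two horizontal fields but each of the
  two covariant derivatives in it turns out to be horizontal.\<close>

lemma riemannian_integrable_if_cosymplectic:
  assumes V: "smooth_distribution A 2 \<V>" "involutive A \<V>" "minimal_foliation A g nabla \<V>"
    and conf: "conformal_foliation A g nabla \<V>" and Or: "orientation A Or"
    and cos1: "\<And>U J. open U \<Longrightarrow> adapted_structure_1 A Or g \<V> U J \<Longrightarrow> cosymplectic A g nabla U J"
    and cos2: "\<And>U J. open U \<Longrightarrow> adapted_structure_2 A Or g \<V> U J \<Longrightarrow> cosymplectic A g nabla U J"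
  shows "riemannian_foliation A g nabla \<V>" "involutive A (orthogonal_complement A g \<V>)"
proof -
  obtain \<xi> where \<xi>s: "\<xi> \<in> sections A UNIV \<V>" and \<xi>: "conformal_foliation_with A g nabla \<V> \<xi>"
    using conf unfolding conformal_foliation_def by blast
  have \<xi>V: "\<xi> p \<in> \<V> p" for p using \<xi>s unfolding sections_def by blast
  have \<xi>0: "\<xi> p = 0" for p
  proof -
    obtain U X Y Z W where dom: "open U" "p \<in> U" and F: "adapted_frame A Or g \<V> U X Y Z W"
      by (rule adapted_frame_exists[OF V(1) Or open_UNIV UNIV_I])
    interpret adapted_frame_domain A g nabla Or \<V> U X Y Z W
      by unfold_locales (rule V(1), rule dom(1), rule F)
    show ?thesis
      by (rule both_cosymplectic(1)[OF V(3,2) \<xi> \<xi>V cos1[OF dom(1)] cos2[OF dom(1)] dom(2)])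
  qed
  show "riemannian_foliation A g nabla \<V>"
    using \<xi> unfolding riemannian_foliation_def conformal_foliation_with_def \<xi>0 .
  show "involutive A (orthogonal_complement A g \<V>)"
    unfolding involutive_def
  proof (intro allI impI ballI)
    fix N K L p assume N: "open N" and K: "K \<in> sections A N (orthogonal_complement A g \<V>)"
      and L: "L \<in> sections A N (orthogonal_complement A g \<V>)" and p: "p \<in> N"
    obtain U X Y Z W where dom: "open U" "p \<in> U" "U \<subseteq> N" and F: "adapted_frame A Or g \<V> U X Y Z W"
      by (rule adapted_frame_exists[OF V(1) Or N p])
    interpret adapted_frame_domain A g nabla Or \<V> U X Y Z W
      by unfold_locales (rule V(1), rule dom(1), rule F)
    note KL = sections_subset[OF dom(3) K] sections_subset[OF dom(3) L]
    have KLF: "K \<in> vector_fields A U" "L \<in> vector_fields A U" using KL unfolding sections_def by auto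
    have 0: "\<Gamma> p X X M = 0 \<and> \<Gamma> p Y Y M = 0 \<and> \<Gamma> p X Y M = 0 \<and> \<Gamma> p Y X M = 0" if "M = Z \<or> M = W" for M
      by (rule both_cosymplectic(2)[OF V(3,2) \<xi> \<xi>V cos1[OF dom(1)] cos2[OF dom(1)] dom(2) that])
    have "g p (nabla K L p) (M p) = 0" "g p (nabla L K p) (M p) = 0" if M: "M = Z \<or> M = W" for M
      by (rule horizontal_derivative[OF dom(2) M 0[OF M]]; rule KL)+
    note d = this[OF disjI1[OF refl]] this[OF disjI2[OF refl]]
    note n = nabla_tangent[OF dom(1) KLF dom(2)] nabla_tangent[OF dom(1) KLF(2,1) dom(2)]
    have "nabla K L p - nabla L K p \<in> orthogonal_complement A g \<V> p"
      by (subst horizontal_iff[OF dom(2)]) (simp_all add: metric_left tangent_closed n frame_tangent[OF dom(2)] d)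
    then show "lie_bracket A K L p \<in> orthogonal_complement A g \<V> p"
      by (simp only: torsion_free[OF dom(1) KLF dom(2)])
  qed
qed

end

theorem theorem1p1:
  fixes A Or :: "'a::{t2_space,second_countable_topology} chart set"
    and g :: "'a metric_tensor"
    and nabla :: "'a connection"
    and \<V> \<H> :: "'a distribution"
  assumes "smooth_atlas A"
    and "orientation A Or"
    and "riemannian_metric A g"
    and "levi_civita A g nabla"
    and "smooth_distribution A 2 \<V>"
    and "involutive A \<V>"
    and "\<H> = orthogonal_complement A g \<V>"
    and "minimal_foliation A g nabla \<V>"
    and "conformal_foliation A g nabla \<V>"
  shows "((\<forall>U J. open U \<longrightarrow> adapted_structure_1 A Or g \<V> U J \<longrightarrow> cosymplectic A g nabla U J) \<and>
          (\<forall>U J. open U \<longrightarrow> adapted_structure_2 A Or g \<V> U J \<longrightarrow> cosymplectic A g nabla U J))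
         \<longleftrightarrow> (riemannian_foliation A g nabla \<V> \<and> involutive A \<H>)"
proof -
  interpret levi_civita_manifold A g nabla
    by unfold_locales (use assms in auto)
  note V = assms(5,6,8)
  show ?thesis
    unfolding assms(7)
  proof
    assume cos: "(\<forall>U J. open U \<longrightarrow> adapted_structure_1 A Or g \<V> U J \<longrightarrow> cosymplectic A g nabla U J) \<and>
      (\<forall>U J. open U \<longrightarrow> adapted_structure_2 A Or g \<V> U J \<longrightarrow> cosymplectic A g nabla U J)"
    show "riemannian_foliation A g nabla \<V> \<and> involutive A (orthogonal_complement A g \<V>)"
      by (rule conjI; rule riemannian_integrable_if_cosymplectic[OF V assms(9,2)]) (use cos in simp_all)
  next
    assume "riemannian_foliation A g nabla \<V> \<and> involutive A (orthogonal_complement A g \<V>)"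
    then have RH: "riemannian_foliation A g nabla \<V>" "involutive A (orthogonal_complement A g \<V>)"
      by simp_all
    show "(\<forall>U J. open U \<longrightarrow> adapted_structure_1 A Or g \<V> U J \<longrightarrow> cosymplectic A g nabla U J) \<and>
      (\<forall>U J. open U \<longrightarrow> adapted_structure_2 A Or g \<V> U J \<longrightarrow> cosymplectic A g nabla U J)"
    proof (intro conjI allI impI)
      fix U J assume "adapted_structure_1 A Or g \<V> U J"
      then show "cosymplectic A g nabla U J"
        unfolding adapted_structure_1_def
        by (elim conjE) (rule cosymplectic_if_riemannian_integrable[OF V RH, where \<epsilon> = 1], simp_all)
    next
      fix U J assume "adapted_structure_2 A Or g \<V> U J"
      then show "cosymplectic A g nabla U J"
        unfolding adapted_structure_2_def
        by (elim conjE) (rule cosymplectic_if_riemannian_integrable[OF V RH, where \<epsilon> = "-1"], simp_all)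
    qed
  qed
qed

end
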